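(* There is an algorithm which, given a permutation $\pi$ of $\{1,\dots,n\}$, outputs a maximum induced matching of the permutation graph $G(\pi)$ in $\mathcal{O}(m+n)$ time, where $m$ is the number of edges of $G(\pi)$.
   Context: For a permutation $\pi=(\pi(1),\dots,\pi(n))$ of $\{1,\dots,n\}$, $\pi^{-1}(i)$ denotes the position of $i$ in $\pi$. The permutation graph $G(\pi)=(V,E)$ has $V=\{1,\dots,n\}$ and $uv\in E$ iff $(u-v)(\pi^{-1}(u)-\pi^{-1}(v))<0$. An induced matching of a graph $G=(V,E)$ is a set $M\subseteq E$ such that for any two distinct edges $u_1v_1,u_2v_2\in M$, none of $u_1u_2,u_1v_2,v_1u_2,v_1v_2$ is in $E$ (in particular the edges are vertex-disjoint). A maximum induced matching is one of maximum cardinality. Running times are in the standard RAM model. *)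

theory Defs
  imports Main
begin

text \<open>A permutation of {1..n} is given as the list [pi(1),...,pi(n)].\<close>
definition is_perm :: "nat \<Rightarrow> nat list \<Rightarrow> bool" where
  "is_perm n p \<longleftrightarrow> length p = n \<and> distinct p \<and> set p = {1..n}"

definition pos :: "nat list \<Rightarrow> nat \<Rightarrow> nat" where
  "pos p i = (THE k. 1 \<le> k \<and> k \<le> length p \<and> p ! (k - 1) = i)"

definition perm_edges :: "nat \<Rightarrow> nat list \<Rightarrow> nat set set" where
  "perm_edges n p = {{u, v} | u v. u \<in> {1..n} \<and> v \<in> {1..n} \<and>
      (int u - int v) * (int (pos p u) - int (pos p v)) < 0}"

definition induced_matching :: "nat set set \<Rightarrow> nat set set \<Rightarrow> bool" where
  "induced_matching E M \<longleftrightarrow> M \<subseteq> E \<and>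
     (\<forall>e1\<in>M. \<forall>e2\<in>M. e1 \<noteq> e2 \<longrightarrow> (\<forall>x\<in>e1. \<forall>y\<in>e2. {x, y} \<notin> E))"

definition maximum_induced_matching :: "nat set set \<Rightarrow> nat set set \<Rightarrow> bool" where
  "maximum_induced_matching E M \<longleftrightarrow> induced_matching E M \<and>
     (\<forall>M'. induced_matching E M' \<longrightarrow> card M' \<le> card M)"

text \<open>Memory: infinitely many integer registers indexed by nat; direct and
 indirect addressing; unit cost per executed instruction.\<close>
datatype instr =
    LoadConst nat int
  | Add nat nat nat
  | Sub nat nat nat
  | Copy nat nat
  | LoadInd nat nat
  | StoreInd nat nat
  | Jz nat nat
  | Jneg nat nat
  | Jmp nat
  | Halt

type_synonym config = "nat \<times> (nat \<Rightarrow> int)"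

definition halted :: "instr list \<Rightarrow> config \<Rightarrow> bool" where
  "halted P s \<longleftrightarrow> fst s \<ge> length P \<or> P ! fst s = Halt"

fun exec :: "instr \<Rightarrow> config \<Rightarrow> config" where
  "exec (LoadConst r c) (pc, m) = (Suc pc, m(r := c))"
| "exec (Add d a b) (pc, m) = (Suc pc, m(d := m a + m b))"
| "exec (Sub d a b) (pc, m) = (Suc pc, m(d := m a - m b))"
| "exec (Copy d s) (pc, m) = (Suc pc, m(d := m s))"
| "exec (LoadInd d a) (pc, m) = (Suc pc, m(d := m (nat (m a))))"
| "exec (StoreInd a s) (pc, m) = (Suc pc, m(nat (m a) := m s))"
| "exec (Jz r t) (pc, m) = (if m r = 0 then t else Suc pc, m)"
| "exec (Jneg r t) (pc, m) = (if m r < 0 then t else Suc pc, m)"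
| "exec (Jmp t) (pc, m) = (t, m)"
| "exec Halt (pc, m) = (pc, m)"

definition step :: "instr list \<Rightarrow> config \<Rightarrow> config" where
  "step P s = (if halted P s then s else exec (P ! fst s) s)"

definition steps :: "instr list \<Rightarrow> nat \<Rightarrow> config \<Rightarrow> config" where
  "steps P t s = (step P ^^ t) s"

definition input_mem :: "nat list \<Rightarrow> nat \<Rightarrow> int" where
  "input_mem p i = (if i = 0 then int (length p)
                    else if i \<le> length p then int (p ! (i - 1)) else 0)"

definition output_matching :: "(nat \<Rightarrow> int) \<Rightarrow> nat set set" where
  "output_matching m = {{nat (m (2*j+1)), nat (m (2*j+2))} | j. j < nat (m 0)}"

end

theory Submission
  imports Defs
begin

text \<open>
  Two edges of the permutation graph are independent iff one of them lies, both in value and in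
  position, entirely below the other. An induced matching is therefore a chain of inversions,
  and the maximal number \<open>F a b\<close> of inversions in a chain using only values \<open>\<le> a\<close> and positions
  \<open>\<le> b\<close> satisfies a recursion that changes only at the points of the grid given by an edge: if
  the entry at position \<open>b\<close> is some \<open>u < a\<close> and \<open>a\<close> stands at a position \<open>< b\<close>, then one may also
  use the edge \<open>ua\<close> on top of a chain counted by \<open>F (u - 1) (pos a - 1)\<close>.

  The algorithm sweeps the values \<open>u = 1, ..., n\<close> and stores, for every position \<open>y\<close> with an
  entry \<open>\<le> u\<close>, an optimal chain for \<open>(u, y)\<close>. Positions with larger entries do not contribute
  to \<open>F u\<close>, so the value there is the one at the nearest smaller position. The positions of the
  larger entries to the left of \<open>u\<close> and of the smaller entries to the right of \<open>u\<close> are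
  enumerated, from the front and from the back respectively, in two linked lists; since these
  are precisely the neighbours of \<open>u\<close>, the total time is linear in \<open>m + n\<close>. The value
  \<open>F (u - 1) (pos v - 1)\<close> needed for an edge \<open>uv\<close> with \<open>u < v\<close> is recorded while \<open>u\<close> is being
  processed, in a sparsely used two-dimensional table, which is then read while \<open>v\<close> is processed.
\<close>

section \<open>A structured language compiled to the machine\<close>

text \<open>Linear time requires that row \<open>F u\<close> be obtained from row
  \<open>F (u - 1)\<close> by touching only neighbours of \<open>u\<close>. Three facts make this
  possible. To the left of the position of \<open>u\<close> the two rows agree; at that position the
  value is \<open>F (u - 1) (pos p u - 1)\<close>; to the right of it, positions with entries above
  \<open>u\<close> copy their left neighbour. Hence only smaller entries to the right have to be
  recomputed. The value wanted for an edge may sit at a position with a larger entry, where the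
  stored chain is stale; the forward scan refreshes such positions on its way. The backward scan
  meets the positions to be recomputed in the wrong order, because \<open>F u y\<close> depends on
  \<open>F u (y - 1)\<close>; it leaves return pointers so that they can be processed from left to
  right. That a chain of length \<open>F n n\<close> exists is never shown separately: every stored
  value comes with a chain of that length, and the upper bound for all chains makes the final one
  maximum.\<close>

type_synonym state = "(nat \<Rightarrow> int) \<times> (nat \<Rightarrow> nat \<Rightarrow> int) \<times> (nat \<Rightarrow> int) \<times> nat"

datatype atom =
    Cst nat int
  | Pls nat nat nat
  | Mns nat nat nat
  | Ld nat nat nat
  | St nat nat nat
  | RLd nat nat
  | RSt nat nat

datatype test = Neq nat nat | Lt nat nat

datatype com =
    At atom
  | Sq com com (infixr ";;" 60)
  | Cond test com
  | Loop test com

text \<open>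
  A state consists of scalar variables, integer arrays \<open>a f\<close>, the raw memory cells below the base
  address \<open>B\<close>, and a clock. The raw cells with address \<open>< 4\<close> are excluded, since
  compiled code uses these four registers as \<open>B\<close> and temporaries.
\<close>

fun ok :: "nat \<Rightarrow> atom \<Rightarrow> state \<Rightarrow> bool" where
  "ok B (Ld x f y) (v, a, r, t) = (0 \<le> v y)"
| "ok B (St f y x) (v, a, r, t) = (0 \<le> v y)"
| "ok B (RLd x y) (v, a, r, t) = (4 \<le> v y \<and> v y < int B)"
| "ok B (RSt y x) (v, a, r, t) = (4 \<le> v y \<and> v y < int B)"
| "ok B _ s = True"

fun eff :: "atom \<Rightarrow> state \<Rightarrow> state" where
  "eff (Cst x c) (v, a, r, t) = (v(x := c), a, r, Suc t)"
| "eff (Pls x y z) (v, a, r, t) = (v(x := v y + v z), a, r, Suc t)"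
| "eff (Mns x y z) (v, a, r, t) = (v(x := v y - v z), a, r, Suc t)"
| "eff (Ld x f y) (v, a, r, t) = (v(x := a f (nat (v y))), a, r, Suc t)"
| "eff (St f y x) (v, a, r, t) = (v, a(f := (a f)(nat (v y) := v x)), r, Suc t)"
| "eff (RLd x y) (v, a, r, t) = (v(x := r (nat (v y))), a, r, Suc t)"
| "eff (RSt y x) (v, a, r, t) = (v, a, r(nat (v y) := v x), Suc t)"

fun holds :: "test \<Rightarrow> state \<Rightarrow> bool" where
  "holds (Neq x y) (v, a, r, t) = (v x \<noteq> v y)"
| "holds (Lt x y) (v, a, r, t) = (v x < v y)"

fun tick :: "state \<Rightarrow> state" where
  "tick (v, a, r, t) = (v, a, r, Suc t)"

fun ticks :: "state \<Rightarrow> nat" where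
  "ticks (v, a, r, t) = t"

inductive big :: "nat \<Rightarrow> com \<Rightarrow> state \<Rightarrow> state \<Rightarrow> bool" for B where
  big_At: "ok B x s \<Longrightarrow> big B (At x) s (eff x s)"
| big_Sq: "big B c1 s s' \<Longrightarrow> big B c2 s' s'' \<Longrightarrow> big B (c1 ;; c2) s s''"
| big_CondF: "\<not> holds b s \<Longrightarrow> big B (Cond b c) s (tick s)"
| big_CondT: "holds b s \<Longrightarrow> big B c (tick s) s' \<Longrightarrow> big B (Cond b c) s s'"
| big_LoopF: "\<not> holds b s \<Longrightarrow> big B (Loop b c) s (tick s)"
| big_LoopT: "holds b s \<Longrightarrow> big B c (tick s) s' \<Longrightarrow> big B (Loop b c) s' s'' \<Longrightarrow>
    big B (Loop b c) s s''"

fun wf_atom :: "atom \<Rightarrow> bool" where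
  "wf_atom (Cst x c) = (x < 32)"
| "wf_atom (Pls x y z) = (x < 32 \<and> y < 32 \<and> z < 32)"
| "wf_atom (Mns x y z) = (x < 32 \<and> y < 32 \<and> z < 32)"
| "wf_atom (Ld x f y) = (x < 32 \<and> f < 32 \<and> y < 32)"
| "wf_atom (St f y x) = (x < 32 \<and> f < 32 \<and> y < 32)"
| "wf_atom (RLd x y) = (x < 32 \<and> y < 32)"
| "wf_atom (RSt y x) = (x < 32 \<and> y < 32)"

fun wf_test :: "test \<Rightarrow> bool" where
  "wf_test (Neq x y) = (x < 32 \<and> y < 32)"
| "wf_test (Lt x y) = (x < 32 \<and> y < 32)"

fun wf_com :: "com \<Rightarrow> bool" where
  "wf_com (At x) = wf_atom x"
| "wf_com (c1 ;; c2) = (wf_com c1 \<and> wf_com c2)"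
| "wf_com (Cond b c) = (wf_test b \<and> wf_com c)"
| "wf_com (Loop b c) = (wf_test b \<and> wf_com c)"

text \<open>The base address depends on \<open>n\<close> and is known only at run time, so even a
  scalar is reached indirectly, relative to register 0. The target register serves as its own
  address register.\<close>

definition rd :: "nat \<Rightarrow> nat \<Rightarrow> instr list" where
  "rd r x = [LoadConst r (int x), Add r r 0, LoadInd r r]"

definition wr :: "nat \<Rightarrow> instr list" where
  "wr x = [LoadConst 2 (int x), Add 2 2 0, StoreInd 2 1]"

definition addr :: "nat \<Rightarrow> nat \<Rightarrow> instr list" where
  "addr f y = rd 1 y @ [Add 1 1 1, Add 1 1 1, Add 1 1 1, Add 1 1 1, Add 1 1 1, Add 1 1 0,
     LoadConst 2 (int (32 + f)), Add 1 1 2]"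

fun atom_code :: "atom \<Rightarrow> instr list" where
  "atom_code (Cst x c) = LoadConst 1 c # wr x"
| "atom_code (Pls x y z) = rd 1 y @ rd 2 z @ Add 1 1 2 # wr x"
| "atom_code (Mns x y z) = rd 1 y @ rd 2 z @ Sub 1 1 2 # wr x"
| "atom_code (Ld x f y) = addr f y @ LoadInd 1 1 # wr x"
| "atom_code (St f y x) = addr f y @ rd 2 x @ [StoreInd 1 2]"
| "atom_code (RLd x y) = rd 1 y @ LoadInd 1 1 # wr x"
| "atom_code (RSt y x) = rd 1 y @ rd 2 x @ [StoreInd 1 2]"

text \<open>The jump skips the guarded command, so it has to fire exactly if the test fails. For
  \<open>Lt x y\<close> the register receives the difference minus 1, which over the integers is
  negative iff the strict inequality fails.\<close>

fun guard_code :: "test \<Rightarrow> instr list" where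
  "guard_code (Neq x y) = rd 1 x @ rd 2 y @ [Sub 1 1 2]"
| "guard_code (Lt x y) = rd 1 x @ rd 2 y @ [Sub 1 2 1, LoadConst 2 1, Sub 1 1 2]"

fun guard_jump :: "test \<Rightarrow> nat \<Rightarrow> instr" where
  "guard_jump (Neq x y) l = Jz 1 l"
| "guard_jump (Lt x y) l = Jneg 1 l"

text \<open>Jump targets are absolute, hence the argument \<open>i\<close>, the address at which the
  code is placed. The exit of a loop lies one instruction further than that of a conditional, behind
  the jump back to \<open>i\<close>.\<close>

fun compile :: "nat \<Rightarrow> com \<Rightarrow> instr list" where
  "compile i (At x) = atom_code x"
| "compile i (c1 ;; c2) = (let p = compile i c1 in p @ compile (i + length p) c2)"
| "compile i (Cond b c) = (let q = guard_code b; p = compile (i + length q + 1) c in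
     q @ guard_jump b (i + length q + 1 + length p) # p)"
| "compile i (Loop b c) = (let q = guard_code b; p = compile (i + length q + 1) c in
     q @ guard_jump b (i + length q + length p + 2) # p @ [Jmp i])"

section \<open>Simulation of structured commands by compiled code\<close>

fun straight :: "instr \<Rightarrow> bool" where
  "straight (Jz _ _) = False"
| "straight (Jneg _ _) = False"
| "straight (Jmp _) = False"
| "straight Halt = False"
| "straight _ = True"

definition ieff :: "instr \<Rightarrow> (nat \<Rightarrow> int) \<Rightarrow> nat \<Rightarrow> int" where
  "ieff x m = snd (exec x (0, m))"

lemma ieff_simps [simp]:
  "ieff (LoadConst r c) m = m(r := c)"
  "ieff (Add d a b) m = m(d := m a + m b)"
  "ieff (Sub d a b) m = m(d := m a - m b)"
  "ieff (Copy d s) m = m(d := m s)"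
  "ieff (LoadInd d a) m = m(d := m (nat (m a)))"
  "ieff (StoreInd a s) m = m(nat (m a) := m s)"
  by (simp_all add: ieff_def)

lemma steps_add: "steps P (t1 + t2) s = steps P t2 (steps P t1 s)"
  by (simp add: steps_def add.commute[of t1] funpow_add)

lemma steps_0 [simp]: "steps P 0 s = s"
  by (simp add: steps_def)

lemma steps_1: "steps P 1 s = step P s"
  by (simp add: steps_def)

lemma step_at:
  assumes "P = pre @ x # post" "x \<noteq> Halt"
  shows "step P (length pre, m) = exec x (length pre, m)"
  using assms by (simp add: step_def halted_def)

lemma exec_straight: "straight x \<Longrightarrow> exec x (i, m) = (Suc i, ieff x m)"
  by (cases x) auto

lemma steps_straight:
  assumes "P = pre @ xs @ post" "\<forall>x\<in>set xs. straight x"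
  shows "steps P (length xs) (length pre, m) = (length pre + length xs, fold ieff xs m)"
  using assms
proof (induction xs arbitrary: pre m)
  case Nil
  then show ?case by simp
next
  case (Cons x xs)
  have "x \<noteq> Halt" using Cons.prems by auto
  then have 1: "step P (length pre, m) = (length (pre @ [x]), ieff x m)"
    using step_at[of P pre x "xs @ post"] Cons.prems exec_straight by simp
  have "steps P (length (x # xs)) (length pre, m)
      = steps P (length xs) (steps P 1 (length pre, m))"
    using steps_add[of P 1 "length xs"] by simp
  also have "\<dots> = (length (pre @ [x]) + length xs, fold ieff xs (ieff x m))"
    unfolding steps_1 1 by (rule Cons.IH) (use Cons.prems in auto)
  finally show ?case by simp
qed

text \<open>
  Above the base address, 32 cells hold the variables; array entry \<open>a f i\<close> follows with stride 32,
  so that an index is turned into an address by five doublings. Untouched cells cost nothing,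
  hence array indices may be quadratic in \<open>n\<close>.
\<close>

fun sim :: "nat \<Rightarrow> (nat \<Rightarrow> int) \<Rightarrow> state \<Rightarrow> bool" where
  "sim B m (v, a, r, t) \<longleftrightarrow> m 0 = int B \<and> 4 \<le> B \<and> (\<forall>x<32. m (B + x) = v x) \<and>
     (\<forall>f<32. \<forall>i. m (B + 32 + 32 * i + f) = a f i) \<and> (\<forall>i. 4 \<le> i \<and> i < B \<longrightarrow> m i = r i)"

text \<open>This keeps the interleaved arrays apart: a write to one field at one index leaves all
  other fields and indices alone.\<close>

lemma field_index:
  fixes i j f g :: nat
  assumes "f < 32" "g < 32"
  shows "32 * i + f = 32 * j + g \<longleftrightarrow> i = j \<and> f = g"
proof
  assume "32 * i + f = 32 * j + g"
  then have "(32 * i + f) div 32 = (32 * j + g) div 32" "(32 * i + f) mod 32 = (32 * j + g) mod 32"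
    by simp_all
  then show "i = j \<and> f = g" using assms by simp
qed simp

text \<open>Registers 1 to 3 are scratch: they lie below the raw cells and, as \<open>B\<close> is
  at least 4, below the variables.\<close>

lemma sim_reg: "sim B m s \<Longrightarrow> 1 \<le> r \<Longrightarrow> r < 4 \<Longrightarrow> sim B (m(r := c)) s"
  by (cases s) auto

lemma sim_tick: "sim B m s \<Longrightarrow> sim B m (tick s)"
  by (cases s) auto

lemma fold_rd:
  assumes "sim B m (v, a, r, t)" "x < 32" "1 \<le> q" "q < 4"
  shows "fold ieff (rd q x) m = m(q := v x)"
proof -
  have "nat (int x + int B) = B + x" by simp
  then show ?thesis using assms by (auto simp: rd_def fun_eq_iff)
qed

lemma fold_wr:
  assumes "sim B m (v, a, r, t)" "x < 32"
  shows "fold ieff (wr x) m = m(2 := int x + int B, B + x := m 1)"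
proof -
  have "nat (int x + int B) = B + x" by simp
  then show ?thesis using assms by (auto simp: wr_def fun_eq_iff)
qed

lemma sim_wr:
  assumes "sim B m (v, a, r, t)" "x < 32"
  shows "sim B (fold ieff (wr x) m) (v(x := m 1), a, r, t')"
  using assms unfolding fold_wr[OF assms] by auto

lemma fold_addr:
  assumes "sim B m (v, a, r, t)" "y < 32" "0 \<le> v y"
  shows "fold ieff (addr f y) m
     = m(1 := int (B + 32 + 32 * nat (v y) + f), 2 := int (32 + f))"
proof -
  have "fold ieff (rd 1 y) m = m(1 := v y)" using fold_rd[OF assms(1,2), of 1] by simp
  then show ?thesis using assms by (auto simp: addr_def fun_eq_iff)
qed

lemma fold_rd2:
  assumes "sim B m (v, a, r, t)" "y < 32" "z < 32"
  shows "fold ieff (rd 1 y @ rd 2 z @ xs) m = fold ieff xs (m(1 := v y, 2 := v z))"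
  using fold_rd[OF assms(1,2), of 1] fold_rd[OF sim_reg[OF assms(1)] assms(3), of 1 2 "v y"]
  by (simp del: sim.simps)

lemma sim_field:
  assumes "sim B m (v, a, r, t)" "f < 32"
  shows "sim B (m(B + 32 + 32 * i + f := c)) (v, a(f := (a f)(i := c)), r, t')"
proof -
  have "B + 32 + 32 * j + g = B + 32 + 32 * i + f \<longleftrightarrow> j = i \<and> g = f" if "g < 32" for j g
    using field_index[OF that assms(2), of j i] by linarith
  moreover have "B + x \<noteq> B + 32 + 32 * i + f" if "x < 32" for x using that by linarith
  moreover have "0 \<noteq> B + 32 + 32 * i + f" by linarith
  moreover have "j \<noteq> B + 32 + 32 * i + f" if "j < B" for j using that by linarith
  ultimately show ?thesis using assms by (simp only: sim.simps fun_upd_apply) simp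
qed

lemma sim_raw:
  assumes "sim B m (v, a, r, t)" "4 \<le> i" "i < B"
  shows "sim B (m(i := c)) (v, a, r(i := c), t')"
  using assms by auto

lemma sim_atom:
  assumes "sim B m s" "ok B x s" "wf_atom x"
  shows "sim B (fold ieff (atom_code x) m) (eff x s)"
proof -
  obtain v a r t where s: "s = (v, a, r, t)" by (cases s)
  have sm: "sim B m (v, a, r, t)" using assms s by simp
  show ?thesis
  proof (cases x)
    case (Cst y c)
    then show ?thesis using sim_wr[OF sim_reg[OF sm, of 1 c], of y] assms s
      by (simp del: sim.simps)
  next
    case (Pls y z w)
    have "sim B (m(1 := v z, 2 := v w, 1 := v z + v w)) (v, a, r, t)"
      by (intro sim_reg sm) auto
    from sim_wr[OF this, of y "Suc t"] fold_rd2[OF sm, of z w "Add 1 1 2 # wr y"] Pls assms s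
    show ?thesis by (simp add: fun_upd_twist del: sim.simps fold_append)
  next
    case (Mns y z w)
    have "sim B (m(1 := v z, 2 := v w, 1 := v z - v w)) (v, a, r, t)"
      by (intro sim_reg sm) auto
    from sim_wr[OF this, of y "Suc t"] fold_rd2[OF sm, of z w "Sub 1 1 2 # wr y"] Mns assms s
    show ?thesis by (simp add: fun_upd_twist del: sim.simps fold_append)
  next
    case (Ld y f z)
    let ?c = "a f (nat (v z))"
    let ?m = "m(1 := int (B + 32 + 32 * nat (v z) + f), 2 := int (32 + f))"
    have "sim B (?m(1 := ?c)) (v, a, r, t)"
      by (intro sim_reg sm) auto
    from sim_wr[OF this, of y "Suc t"]
    have 1: "sim B (fold ieff (wr y) (?m(1 := ?c))) (v(y := ?c), a, r, Suc t)"
      using Ld assms by (simp del: sim.simps)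
    have "?m (B + 32 + 32 * nat (v z) + f) = ?c"
      using sm Ld assms by auto
    then have "?m (nat (?m 1)) = ?c" by (simp del: of_nat_add)
    then have "ieff (LoadInd 1 1) ?m = ?m(1 := ?c)" unfolding ieff_simps by (rule arg_cong)
    moreover have "fold ieff (addr f z) m = ?m"
      using fold_addr[OF sm, of z f] Ld assms s by (simp del: sim.simps)
    ultimately have "fold ieff (atom_code x) m = fold ieff (wr y) (?m(1 := ?c))"
      unfolding Ld by (simp only: atom_code.simps fold_append fold_simps comp_apply)
    then show ?thesis using 1 Ld s by (simp del: sim.simps)
  next
    case (St f z y)
    let ?i = "B + 32 + 32 * nat (v z) + f"
    let ?m = "m(1 := int ?i, 2 := int (32 + f))"
    have fa: "fold ieff (addr f z) m = ?m"
      using fold_addr[OF sm, of z f] St assms s by (simp del: sim.simps)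
    have sm': "sim B ?m (v, a, r, t)" by (intro sim_reg sm) auto
    have rd: "fold ieff (rd 2 y) ?m = ?m(2 := v y)"
      using fold_rd[OF sm', of y 2] St assms by (simp del: sim.simps)
    have "fold ieff (atom_code x) m = ieff (StoreInd 1 2) (?m(2 := v y))"
      unfolding St by (simp only: atom_code.simps fold_append fold_simps comp_apply fa rd)
    also have "\<dots> = ?m(2 := v y, ?i := v y)"
      unfolding ieff_simps by (simp del: of_nat_add)
    finally have eq: "fold ieff (atom_code x) m = ?m(2 := v y, ?i := v y)" .
    have "sim B (?m(2 := v y, ?i := v y)) (v, a(f := (a f)(nat (v z) := v y)), r, Suc t)"
      by (rule sim_field[where t = t], intro sim_reg sm) (use St assms in auto)
    then show ?thesis unfolding eq using St s by (simp del: sim.simps)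
  next
    case (RLd y z)
    let ?c = "r (nat (v z))"
    let ?m = "m(1 := v z)"
    have 1: "fold ieff (rd 1 z) m = ?m"
      using fold_rd[OF sm, of z 1] RLd assms by (simp del: sim.simps)
    have bd: "4 \<le> nat (v z)" "nat (v z) < B" using RLd assms s by auto
    then have "m (nat (v z)) = ?c" using sm by auto
    then have "?m (nat (?m 1)) = ?c" using bd by simp
    then have "ieff (LoadInd 1 1) ?m = ?m(1 := ?c)" unfolding ieff_simps by (rule arg_cong)
    then have "fold ieff (atom_code x) m = fold ieff (wr y) (?m(1 := ?c))"
      unfolding RLd by (simp only: atom_code.simps fold_append fold_simps comp_apply 1)
    moreover have "sim B (?m(1 := ?c)) (v, a, r, t)"
      by (intro sim_reg sm) auto
    from sim_wr[OF this, of y "Suc t"]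
    have "sim B (fold ieff (wr y) (?m(1 := ?c))) (v(y := ?c), a, r, Suc t)"
      using RLd assms by (simp del: sim.simps)
    ultimately show ?thesis using RLd s by (simp del: sim.simps)
  next
    case (RSt z y)
    have bd: "4 \<le> nat (v z)" "nat (v z) < B" using RSt assms s by auto
    have "fold ieff (atom_code x) m = ieff (StoreInd 1 2) (m(1 := v z, 2 := v y))"
      using fold_rd2[OF sm, of z y "[StoreInd 1 2]"] RSt assms
      by (simp del: sim.simps fold_append)
    also have "\<dots> = m(1 := v z, 2 := v y, nat (v z) := v y)" by simp
    finally have eq: "fold ieff (atom_code x) m = m(1 := v z, 2 := v y, nat (v z) := v y)" .
    have "sim B (m(1 := v z, 2 := v y, nat (v z) := v y)) (v, a, r(nat (v z) := v y), Suc t)"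
      by (rule sim_raw[where t = t], intro sim_reg sm) (use bd in auto)
    then show ?thesis unfolding eq using RSt s by (simp del: sim.simps)
  qed
qed

lemma atom_code_straight: "\<forall>y\<in>set (atom_code x). straight y"
  by (cases x) (auto simp: rd_def wr_def addr_def)

lemma atom_code_length: "length (atom_code x) \<le> 40"
  by (cases x) (auto simp: rd_def wr_def addr_def)

lemma guard_code_straight: "\<forall>y\<in>set (guard_code x). straight y"
  by (cases x) (auto simp: rd_def wr_def addr_def)

lemma guard_code_length: "length (guard_code x) \<le> 20"
  by (cases x) (auto simp: rd_def wr_def addr_def)

lemma guard_code_eval:
  assumes "sim B m s" "wf_test b"
  shows "sim B (fold ieff (guard_code b) m) s \<and>
    exec (guard_jump b l) (i, fold ieff (guard_code b) m)
      = (if holds b s then Suc i else l, fold ieff (guard_code b) m)"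
proof -
  obtain v a r t where s: "s = (v, a, r, t)" by (cases s)
  have sm: "sim B m (v, a, r, t)" using assms s by simp
  show ?thesis
  proof (cases b)
    case (Neq x y)
    have "fold ieff (guard_code b) m = m(1 := v x, 2 := v y, 1 := v x - v y)"
      using fold_rd2[OF sm, of x y "[Sub 1 1 2]"] Neq assms by (simp del: sim.simps fold_append)
    moreover have "sim B (m(1 := v x, 2 := v y, 1 := v x - v y)) s"
      unfolding s by (intro sim_reg sm) auto
    ultimately show ?thesis using Neq s by (simp del: sim.simps)
  next
    case (Lt x y)
    have "fold ieff (guard_code b) m = m(1 := v x, 2 := v y, 1 := v y - v x, 2 := 1, 1 := v y - v x - 1)"
      using fold_rd2[OF sm, of x y "[Sub 1 2 1, LoadConst 2 1, Sub 1 1 2]"] Lt assms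
      by (simp del: sim.simps fold_append)
    moreover have "sim B (m(1 := v x, 2 := v y, 1 := v y - v x, 2 := 1, 1 := v y - v x - 1)) s"
      unfolding s by (intro sim_reg sm) auto
    ultimately show ?thesis using Lt s by (auto simp del: sim.simps)
  qed
qed

lemma steps_test:
  assumes "sim B m s" "wf_test b" "P = pre @ guard_code b @ guard_jump b l # post"
  shows "\<exists>m'. sim B m' s \<and> steps P (length (guard_code b) + 1) (length pre, m)
    = (if holds b s then length pre + length (guard_code b) + 1 else l, m')"
proof -
  let ?m = "fold ieff (guard_code b) m"
  have 1: "steps P (length (guard_code b)) (length pre, m) = (length (pre @ guard_code b), ?m)"
    using steps_straight[of P pre "guard_code b" "guard_jump b l # post"] assms(3) guard_code_straight by simp
  have "guard_jump b l \<noteq> Halt" by (cases b) auto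
  then have "step P (length (pre @ guard_code b), ?m) = exec (guard_jump b l) (length (pre @ guard_code b), ?m)"
    using step_at[of P "pre @ guard_code b" "guard_jump b l" post] assms(3) by simp
  then have "steps P (length (guard_code b) + 1) (length pre, m)
    = (if holds b s then length pre + length (guard_code b) + 1 else l, ?m)"
    using guard_code_eval[OF assms(1,2), of l] unfolding steps_add 1 steps_1 by simp
  then show ?thesis using guard_code_eval[OF assms(1,2)] by blast
qed

lemma ticks_tick [simp]: "ticks (tick s) = Suc (ticks s)"
  by (cases s) auto

lemma ticks_eff [simp]: "ticks (eff x s) = Suc (ticks s)"
  by (cases s; cases x) auto

text \<open>One tick pays for up to 40 instructions: an atom, or a test with its jump and the jump
  back. The bound is written as a sum so that the costs of consecutive commands telescope without
  subtraction of naturals. \<open>pre\<close> and \<open>post\<close> stay arbitrary because a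
  subcommand sits in a different context than the whole.\<close>

theorem compile_correct:
  assumes "big B c s s'" "wf_com c" "sim B m s"
    and "P = pre @ compile (length pre) c @ post"
  shows "\<exists>t m'. t + 40 * ticks s \<le> 40 * ticks s' \<and> sim B m' s' \<and>
    steps P t (length pre, m) = (length pre + length (compile (length pre) c), m')"
  using assms
proof (induction arbitrary: m pre post rule: big.induct)
  case (big_At x s)
  have "steps P (length (atom_code x)) (length pre, m)
      = (length pre + length (atom_code x), fold ieff (atom_code x) m)"
    by (rule steps_straight) (use big_At atom_code_straight in auto)
  moreover have "sim B (fold ieff (atom_code x) m) (eff x s)"
    using sim_atom big_At by simp
  ultimately show ?case using atom_code_length[of x]
    by (intro exI[of _ "length (atom_code x)"]) auto
next
  case (big_Sq c1 s s' c2 s'')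
  let ?p = "compile (length pre) c1"
  let ?q = "compile (length (pre @ ?p)) c2"
  obtain t1 m1 where 1: "t1 + 40 * ticks s \<le> 40 * ticks s'" "sim B m1 s'"
    "steps P t1 (length pre, m) = (length pre + length ?p, m1)"
    using big_Sq.IH(1)[of m pre "?q @ post"] big_Sq.prems by (auto simp: Let_def)
  obtain t2 m2 where 2: "t2 + 40 * ticks s' \<le> 40 * ticks s''" "sim B m2 s''"
    "steps P t2 (length (pre @ ?p), m1) = (length (pre @ ?p) + length ?q, m2)"
    using big_Sq.IH(2)[of m1 "pre @ ?p" post] big_Sq.prems 1 by (auto simp: Let_def)
  show ?case
    by (rule exI[of _ "t1 + t2"], rule exI[of _ m2]) (use 1 2 in \<open>auto simp: steps_add Let_def\<close>)
next
  case (big_CondF b s c)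
  let ?q = "guard_code b"
  let ?p = "compile (length pre + length ?q + 1) c"
  let ?l = "length pre + length ?q + 1 + length ?p"
  obtain m' where m': "sim B m' s" "steps P (length ?q + 1) (length pre, m) = (?l, m')"
    using steps_test[of B m s b P pre ?l "?p @ post"] big_CondF by (auto simp: Let_def)
  show ?case
    by (rule exI[of _ "length ?q + 1"], rule exI[of _ m'])
      (use m' guard_code_length[of b] sim_tick in \<open>auto simp: Let_def\<close>)
next
  case (big_CondT b s c s')
  let ?q = "guard_code b"
  let ?p = "compile (length pre + length ?q + 1) c"
  let ?l = "length pre + length ?q + 1 + length ?p"
  let ?pre = "pre @ ?q @ [guard_jump b ?l]"
  obtain m' where m': "sim B m' s" "steps P (length ?q + 1) (length pre, m) = (length ?pre, m')"
    using steps_test[of B m s b P pre ?l "?p @ post"] big_CondT by (auto simp: Let_def)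
  obtain t2 m2 where 2: "t2 + 40 * ticks (tick s) \<le> 40 * ticks s'" "sim B m2 s'"
    "steps P t2 (length ?pre, m') = (length ?pre + length ?p, m2)"
    using big_CondT.IH[of m' ?pre post] big_CondT.prems sim_tick[OF m'(1)] by (auto simp: Let_def)
  have "steps P (length ?q + 1 + t2) (length pre, m) = (length ?pre + length ?p, m2)"
    unfolding steps_add[of _ "length ?q + 1"] m'(2) 2(3) ..
  then show ?case
    by (intro exI[of _ "length ?q + 1 + t2"] exI[of _ m2])
      (use 2 guard_code_length[of b] in \<open>auto simp: Let_def\<close>)
next
  case (big_LoopF b s c)
  let ?q = "guard_code b"
  let ?p = "compile (length pre + length ?q + 1) c"
  let ?l = "length pre + length ?q + length ?p + 2"
  obtain m' where m': "sim B m' s" "steps P (length ?q + 1) (length pre, m) = (?l, m')"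
    using steps_test[of B m s b P pre ?l "?p @ Jmp (length pre) # post"] big_LoopF
    by (auto simp: Let_def)
  show ?case
    by (rule exI[of _ "length ?q + 1"], rule exI[of _ m'])
      (use m' guard_code_length[of b] sim_tick in \<open>auto simp: Let_def\<close>)
next
  case (big_LoopT b s c s' s'')
  let ?q = "guard_code b"
  let ?p = "compile (length pre + length ?q + 1) c"
  let ?l = "length pre + length ?q + length ?p + 2"
  let ?pre = "pre @ ?q @ [guard_jump b ?l]"
  obtain m' where m': "sim B m' s" "steps P (length ?q + 1) (length pre, m) = (length ?pre, m')"
    using steps_test[of B m s b P pre ?l "?p @ Jmp (length pre) # post"] big_LoopT
    by (auto simp: Let_def)
  obtain t2 m2 where 2: "t2 + 40 * ticks (tick s) \<le> 40 * ticks s'" "sim B m2 s'"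
    "steps P t2 (length ?pre, m') = (length (?pre @ ?p), m2)"
    using big_LoopT.IH(1)[of m' ?pre "Jmp (length pre) # post"] big_LoopT.prems sim_tick[OF m'(1)]
    by (auto simp: Let_def)
  have "step P (length (?pre @ ?p), m2) = exec (Jmp (length pre)) (length (?pre @ ?p), m2)"
    using step_at[of P "?pre @ ?p" "Jmp (length pre)" post] big_LoopT.prems by (auto simp: Let_def)
  then have j: "steps P 1 (length (?pre @ ?p), m2) = (length pre, m2)"
    unfolding steps_1 by simp
  obtain t3 m3 where 3: "t3 + 40 * ticks s' \<le> 40 * ticks s''" "sim B m3 s''"
    "steps P t3 (length pre, m2) = (length pre + length (compile (length pre) (Loop b c)), m3)"
    using big_LoopT.IH(2)[of m2 pre post] big_LoopT.prems 2 by blast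
  have "steps P (length ?q + 1 + (t2 + (1 + t3))) (length pre, m)
      = (length pre + length (compile (length pre) (Loop b c)), m3)"
    unfolding steps_add[of _ "length ?q + 1"] m'(2) steps_add[of _ t2] 2(3)
      steps_add[of _ 1] j 3(3) ..
  then show ?case
    by (intro exI[of _ "length ?q + 1 + (t2 + (1 + t3))"] exI[of _ m3])
      (use 2 3 guard_code_length[of b] in auto)
qed

section \<open>Weakest preconditions for total correctness\<close>

definition wp :: "nat \<Rightarrow> com \<Rightarrow> (state \<Rightarrow> bool) \<Rightarrow> state \<Rightarrow> bool" where
  "wp B c Q s \<longleftrightarrow> (\<exists>s'. big B c s s' \<and> Q s')"

inductive_cases big_AtE: "big B (At x) s s'"
inductive_cases big_SqE: "big B (c1 ;; c2) s s'"
inductive_cases big_CondE: "big B (Cond b c) s s'"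

lemma wp_At [simp]: "wp B (At x) Q s \<longleftrightarrow> ok B x s \<and> Q (eff x s)"
  unfolding wp_def by (metis big_At big_AtE)

lemma wp_Sq [simp]: "wp B (c1 ;; c2) Q s \<longleftrightarrow> wp B c1 (wp B c2 Q) s"
  unfolding wp_def by (metis big_Sq big_SqE)

lemma wp_Cond [simp]:
  "wp B (Cond b c) Q s \<longleftrightarrow> (if holds b s then wp B c Q (tick s) else Q (tick s))"
  unfolding wp_def by (smt (verit) big_CondF big_CondT big_CondE)

lemma wp_mono: "wp B c Q s \<Longrightarrow> (\<And>s'. Q s' \<Longrightarrow> R s') \<Longrightarrow> wp B c R s"
  unfolding wp_def by blast

text \<open>The invariant is indexed by ghost data \<open>k\<close>, such as a list cursor or the
  remaining part of a chain. The clock belongs to the state, so time bounds are simply part of the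
  invariant.\<close>

lemma wp_Loop:
  fixes I :: "'k \<Rightarrow> state \<Rightarrow> bool" and f :: "'k \<Rightarrow> nat"
  assumes "I k s"
    and step: "\<And>k s. I k s \<Longrightarrow> holds b s \<Longrightarrow> wp B c (\<lambda>s'. \<exists>k'. f k' < f k \<and> I k' s') (tick s)"
    and exit: "\<And>k s. I k s \<Longrightarrow> \<not> holds b s \<Longrightarrow> Q (tick s)"
  shows "wp B (Loop b c) Q s"
  using assms(1)
proof (induction "f k" arbitrary: k s rule: less_induct)
  case less
  show ?case
  proof (cases "holds b s")
    case True
    from step[OF less.prems True] obtain s' k' where
      "big B c (tick s) s'" "f k' < f k" "I k' s'" unfolding wp_def by blast
    moreover from less.hyps[OF this(2,3)] obtain s'' where "big B (Loop b c) s' s''" "Q s''"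
      unfolding wp_def by blast
    ultimately show ?thesis unfolding wp_def using big_LoopT[OF True] by blast
  next
    case False
    then show ?thesis unfolding wp_def using big_LoopF exit[OF less.prems False] by blast
  qed
qed

section \<open>Chains of inversions\<close>

locale permutation =
  fixes n :: nat and p :: "nat list"
  assumes perm: "is_perm n p"
begin

definition val :: "nat \<Rightarrow> nat" where
  "val x = p ! (x - 1)"

abbreviation ps :: "nat \<Rightarrow> nat" where
  "ps \<equiv> pos p"

lemma val_range:
  assumes "1 \<le> x" "x \<le> n"
  shows "1 \<le> val x \<and> val x \<le> n"
proof -
  have "p ! (x - 1) \<in> set p" using assms perm by (intro nth_mem) (auto simp: is_perm_def)
  then show ?thesis using perm by (simp add: val_def is_perm_def)
qed

lemma ps_val:
  assumes "1 \<le> x" "x \<le> n"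
  shows "ps (val x) = x"
  unfolding pos_def val_def
proof (rule the_equality)
  show "1 \<le> x \<and> x \<le> length p \<and> p ! (x - 1) = p ! (x - 1)" using assms perm by (simp add: is_perm_def)
next
  fix k assume "1 \<le> k \<and> k \<le> length p \<and> p ! (k - 1) = p ! (x - 1)"
  moreover from this have "k - 1 = x - 1"
    using assms perm nth_eq_iff_index_eq[of p "k - 1" "x - 1"] by (auto simp: is_perm_def)
  ultimately show "k = x" using assms by linarith
qed

lemma ex_val:
  assumes "1 \<le> u" "u \<le> n"
  obtains x where "1 \<le> x" "x \<le> n" "val x = u"
proof -
  have "u \<in> set p" using assms perm by (simp add: is_perm_def)
  then obtain i where "i < length p" "p ! i = u" by (auto simp: in_set_conv_nth)
  then show ?thesis using that[of "Suc i"] perm by (simp add: val_def is_perm_def)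
qed

lemma val_ps: "1 \<le> u \<Longrightarrow> u \<le> n \<Longrightarrow> val (ps u) = u"
  by (metis ex_val ps_val)

lemma ps_range: "1 \<le> u \<Longrightarrow> u \<le> n \<Longrightarrow> 1 \<le> ps u \<and> ps u \<le> n"
  by (metis ex_val ps_val)

lemma ps_inj: "1 \<le> u \<Longrightarrow> u \<le> n \<Longrightarrow> 1 \<le> v \<Longrightarrow> v \<le> n \<Longrightarrow> ps u = ps v \<longleftrightarrow> u = v"
  by (metis val_ps)

text \<open>Orients each edge, smaller value first, so that edges can be counted as pairs.\<close>

definition cross :: "nat \<Rightarrow> nat \<Rightarrow> bool" where
  "cross u v \<longleftrightarrow> 1 \<le> u \<and> u < v \<and> v \<le> n \<and> ps v < ps u"

lemma edge_iff:
  "{x, y} \<in> perm_edges n p \<longleftrightarrow> cross x y \<or> cross y x"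
proof -
  have "u \<in> {1..n} \<and> v \<in> {1..n} \<and> (int u - int v) * (int (ps u) - int (ps v)) < 0
    \<longleftrightarrow> cross u v \<or> cross v u" for u v
    unfolding cross_def mult_less_0_iff by auto
  then have "perm_edges n p = {{u, v} | u v. cross u v \<or> cross v u}"
    unfolding perm_edges_def by simp
  then show ?thesis by (auto simp: doubleton_eq_iff)
qed

lemma edges_eq: "perm_edges n p = (\<lambda>(u, v). {u, v}) ` {(u, v). cross u v}" (is "_ = ?R")
proof
  show "perm_edges n p \<subseteq> ?R"
  proof
    fix e assume e: "e \<in> perm_edges n p"
    then obtain u v where "e = {u, v}" unfolding perm_edges_def by auto
    then show "e \<in> ?R" using e edge_iff[of u v] by (auto simp: insert_commute)
  qed
  show "?R \<subseteq> perm_edges n p" using edge_iff by auto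
qed

lemma edge_inj: "inj_on (\<lambda>(u, v). {u, v}) {(u, v). cross u v}"
  by (auto simp: inj_on_def doubleton_eq_iff cross_def)

lemma finite_cross: "finite {(u, v). cross u v}"
  by (rule finite_subset[of _ "{..n} \<times> {..n}"]) (auto simp: cross_def)

lemma card_edges: "card (perm_edges n p) = card {(u, v). cross u v}"
  unfolding edges_eq by (rule card_image[OF edge_inj])

text \<open>In an inversion the smaller value stands further right. Thus \<open>ps (fst e)\<close>
  is the last position of \<open>e\<close> and \<open>ps (snd f)\<close> the first one of
  \<open>f\<close>: the condition puts \<open>e\<close> entirely below \<open>f\<close> in both
  coordinates.\<close>

definition below :: "nat \<times> nat \<Rightarrow> nat \<times> nat \<Rightarrow> bool" where
  "below e f \<longleftrightarrow> snd e < fst f \<and> ps (fst e) < ps (snd f)"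

text \<open>Once \<open>u < v'\<close> is known, the absence of an edge between them forces
  \<open>ps u < ps v'\<close>, so the first edge lies to the left of the second. Then
  \<open>u' < v\<close> would make \<open>u'\<close> and \<open>v\<close> an inversion.\<close>

lemma independent_below:
  assumes "cross u v" "cross u' v'" "u \<le> u'"
    and "\<forall>x\<in>{u, v}. \<forall>y\<in>{u', v'}. {x, y} \<notin> perm_edges n p"
  shows "below (u, v) (u', v')"
proof -
  have nc: "\<not> cross x y \<and> \<not> cross y x" if "x \<in> {u, v}" "y \<in> {u', v'}" for x y
    using assms(4) that edge_iff by blast
  have r: "1 \<le> u" "u < v" "v \<le> n" "ps v < ps u" "1 \<le> u'" "u' < v'" "v' \<le> n" "ps v' < ps u'"
    using assms(1,2) by (auto simp: cross_def)
  have "u \<noteq> u'" using nc[of u v'] r by (auto simp: cross_def)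
  then have "u < u'" using assms by simp
  then have "ps u < ps v'" 
    using nc[of u v'] r ps_inj[of u v'] by (auto simp: cross_def) 
  then have "v \<noteq> u'" using r by auto
  moreover have "\<not> u' < v" using nc[of v u'] r \<open>ps u < ps v'\<close> by (auto simp: cross_def)
  ultimately show ?thesis using \<open>ps u < ps v'\<close> by (simp add: below_def)
qed

lemma below_independent:
  assumes "cross u v" "cross u' v'" "below (u, v) (u', v')" "x \<in> {u, v}" "y \<in> {u', v'}"
  shows "\<not> cross x y \<and> \<not> cross y x"
  using assms by (auto simp: cross_def below_def)

section \<open>The recursion for the size of an optimal chain\<close>

fun F :: "nat \<Rightarrow> nat \<Rightarrow> nat" where
  "F a b = (if a = 0 \<or> b = 0 then 0
     else max (max (F (a - 1) b) (F a (b - 1)))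
       (if val b < a \<and> ps a < b then Suc (F (val b - 1) (ps a - 1)) else 0))"

declare F.simps [simp del]

lemma F_0 [simp]: "F 0 b = 0" "F a 0 = 0"
  by (simp_all add: F.simps)

lemma F_mono1: "F (a - 1) b \<le> F a b"
  by (cases "a = 0 \<or> b = 0") (auto simp: F.simps[of a b])

lemma F_mono2: "F a (b - 1) \<le> F a b"
  by (cases "a = 0 \<or> b = 0") (auto simp: F.simps[of a b])

text \<open>In column \<open>b\<close> the edge term does not occur up to row \<open>a\<close>. By
  induction on \<open>a\<close> the row below also agrees with column \<open>b - 1\<close>, and
  monotonicity in the row index does the rest.\<close>

lemma F_high_column:
  assumes "1 \<le> b" "b \<le> n" "a < val b"
  shows "F a b = F a (b - 1)"
  using assms
proof (induction a)
  case (Suc a)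
  then have "F a b = F a (b - 1)" by simp
  then show ?case using Suc.prems F_mono1[of "Suc a" "b - 1"] by (subst F.simps) auto
qed simp

text \<open>Mirror image of \<open>F_high_column\<close>: before its own position is passed, value
  \<open>a\<close> cannot be the upper end of a counted edge.\<close>

lemma F_late_row:
  assumes "1 \<le> a" "a \<le> n" "b < ps a"
  shows "F a b = F (a - 1) b"
  using assms
proof (induction b)
  case (Suc b)
  then have "F a b = F (a - 1) b" by simp
  then show ?case using Suc.prems F_mono2[of "a - 1" "Suc b"] by (subst F.simps) auto
qed simp

text \<open>Both the row step and the column step arrive at the point of \<open>a\<close> itself,
  where \<open>F_high_column\<close> and \<open>F_late_row\<close> apply. This gives the starting
  chain for the positions to the right of \<open>a\<close>.\<close>

lemma F_point:
  assumes "1 \<le> a" "a \<le> n"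
  shows "F a (ps a) = F (a - 1) (ps a - 1)"
proof -
  have r: "1 \<le> ps a" "ps a \<le> n" using ps_range assms by auto
  have "F (a - 1) (ps a) = F (a - 1) (ps a - 1)"
    using F_high_column[of "ps a" "a - 1"] r assms by (simp add: val_ps)
  moreover have "F a (ps a - 1) = F (a - 1) (ps a - 1)"
    using F_late_row[of a "ps a - 1"] r assms by simp
  ultimately show ?thesis using assms r by (subst F.simps) auto
qed

lemma F_cross:
  assumes "cross u a" "b = ps u"
  shows "F a b = max (max (F (a - 1) b) (F a (b - 1))) (Suc (F (u - 1) (ps a - 1)))"
proof -
  have "val b = u" "b \<noteq> 0" using assms val_ps[of u] ps_range[of u] by (auto simp: cross_def)
  then show ?thesis using assms by (subst F.simps) (auto simp: cross_def)
qed

definition chain_in :: "nat \<Rightarrow> nat \<Rightarrow> (nat \<times> nat) set \<Rightarrow> bool" where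
  "chain_in a b X \<longleftrightarrow> (\<forall>(u, v)\<in>X. cross u v \<and> v \<le> a \<and> ps u \<le> b) \<and>
     (\<forall>e\<in>X. \<forall>f\<in>X. e \<noteq> f \<longrightarrow> below e f \<or> below f e)"

lemma chain_in_finite: "chain_in a b X \<Longrightarrow> finite X"
  by (rule finite_subset[OF _ finite_cross]) (auto simp: chain_in_def)

lemma chain_in_mono: "chain_in a b X \<Longrightarrow> a \<le> a' \<Longrightarrow> b \<le> b' \<Longrightarrow> chain_in a' b' X"
  unfolding chain_in_def by fastforce

text \<open>Induction on the corner. If value \<open>a\<close> is no upper end, or position
  \<open>b\<close> no right end, of an edge in the chain, the corner can be moved inwards. Otherwise
  a single edge uses both, all others lie below it, and removing it leaves a chain for the corner in
  the edge term of \<open>F\<close>.\<close>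

theorem chain_card_le:
  assumes "chain_in a b X"
  shows "card X \<le> F a b"
  using assms
proof (induction "a + b" arbitrary: a b X rule: less_induct)
  case less
  note X = less.prems
  have cr: "cross u v \<and> v \<le> a \<and> ps u \<le> b" if "(u, v) \<in> X" for u v
    using X that by (auto simp: chain_in_def)
  have pu: "1 \<le> ps u \<and> 1 \<le> ps v" if "cross u v" for u v
    using that ps_range by (auto simp: cross_def)
  show ?case
  proof (cases "a = 0 \<or> b = 0")
    case True
    have "(u, v) \<notin> X" for u v
      using cr[of u v] pu[of u v] True by (auto simp: cross_def)
    then have "X = {}" by auto
    then show ?thesis by simp
  next
    case False
    consider "\<forall>(u, v)\<in>X. v \<noteq> a" | "\<forall>(u, v)\<in>X. ps u \<noteq> b"
      | u v u' v' where "(u, v) \<in> X" "v = a" "(u', v') \<in> X" "ps u' = b" by blast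
    then show ?thesis
    proof cases
      case 1
      then have "chain_in (a - 1) b X" using X unfolding chain_in_def by fastforce
      then show ?thesis using less.hyps[of "a - 1" b X] F_mono1[of a b] False by simp
    next
      case 2
      then have "chain_in a (b - 1) X" using X unfolding chain_in_def by fastforce
      then show ?thesis using less.hyps[of a "b - 1" X] F_mono2[of a b] False by simp
    next
      case 3
      note c = cr[OF 3(1)] cr[OF 3(3)]
      \<comment> \<open>Nothing lies above an edge with the largest value \<open>a\<close>, nor
        above an edge ending at the last position \<open>b\<close>. Being comparable if distinct,
        the two edges coincide.\<close>
      have "\<not> below (u, v) (u', v')"
        using 3(2) c by (auto simp: below_def cross_def)
      moreover have "\<not> below (u', v') (u, v)"
        using 3(4) c by (auto simp: below_def cross_def)
      ultimately have e: "(u', v') = (u, v)" using X 3 unfolding chain_in_def by blast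
      let ?Y = "X - {(u, v)}"
      have "chain_in (u - 1) (ps v - 1) ?Y"
        unfolding chain_in_def
      proof (intro conjI ballI impI)
        fix e assume e': "e \<in> ?Y"
        then have "\<not> below (u, v) e"
          using cr[of "fst e" "snd e"] c(1) 3(2) by (auto simp: below_def cross_def)
        then have "below e (u, v)" using X e' 3(1) unfolding chain_in_def by blast
        then show "case e of (u', v') \<Rightarrow> cross u' v' \<and> v' \<le> u - 1 \<and> ps u' \<le> ps v - 1"
          using e' cr by (auto simp: below_def)
      qed (use X in \<open>auto simp: chain_in_def\<close>)
      moreover have "u - 1 + (ps v - 1) < a + b"
        using c(1) pu[of u v] by (auto simp: cross_def)
      ultimately have "card ?Y \<le> F (u - 1) (ps v - 1)" using less.hyps by blast
      moreover have "card X = Suc (card ?Y)"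
        using card_Suc_Diff1[OF chain_in_finite[OF X] 3(1)] by simp
      moreover have "Suc (F (u - 1) (ps v - 1)) \<le> F a b"
        using F_cross[of u a b] c 3 e by simp
      ultimately show ?thesis by simp
    qed
  qed
qed

theorem induced_matching_card_le:
  assumes "induced_matching (perm_edges n p) M"
  shows "card M \<le> F n n"
proof -
  let ?g = "\<lambda>(u, v). {u, v}"
  define X where "X = {(u, v). cross u v \<and> {u, v} \<in> M}"
  have sub: "M \<subseteq> ?g ` {(u, v). cross u v}"
    using assms unfolding induced_matching_def edges_eq by simp
  have M: "M = ?g ` X"
  proof
    show "M \<subseteq> ?g ` X"
    proof
      fix e assume e: "e \<in> M"
      then obtain u v where "e = {u, v}" "cross u v" using sub by auto
      then show "e \<in> ?g ` X" using e by (intro image_eqI[of _ _ "(u, v)"]) (auto simp: X_def)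
    qed
  qed (auto simp: X_def)
  have "inj_on ?g X" by (rule inj_on_subset[OF edge_inj]) (auto simp: X_def)
  then have "card M = card X" by (rule trans[OF arg_cong[OF M, of card] card_image])
  moreover have "chain_in n n X"
    unfolding chain_in_def
  proof (intro conjI ballI impI)
    fix e f assume e: "e \<in> X" "f \<in> X" "e \<noteq> f"
    obtain u v where 1: "e = (u, v)" by (cases e)
    obtain u' v' where 2: "f = (u', v')" by (cases f)
    have c: "cross u v" "cross u' v'" "{u, v} \<in> M" "{u', v'} \<in> M" using e 1 2 by (auto simp: X_def)
    have "{u, v} \<noteq> {u', v'}" using inj_onD[OF edge_inj, of e f] c e 1 2 by auto
    then have ind: "\<forall>x\<in>{u, v}. \<forall>y\<in>{u', v'}. {x, y} \<notin> perm_edges n p"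
      using assms c unfolding induced_matching_def by simp
    have ind': "\<forall>x\<in>{u', v'}. \<forall>y\<in>{u, v}. {x, y} \<notin> perm_edges n p"
      using ind unfolding edge_iff by blast
    show "below e f \<or> below f e"
    proof (cases "u \<le> u'")
      case True
      show ?thesis using independent_below[OF c(1,2) True ind] 1 2 by simp
    next
      case False
      then have "u' \<le> u" by simp
      show ?thesis using independent_below[OF c(2,1) \<open>u' \<le> u\<close> ind'] 1 2 by simp
    qed
  next
    fix e assume "e \<in> X"
    then show "case e of (u, v) \<Rightarrow> cross u v \<and> v \<le> n \<and> ps u \<le> n"
      using ps_range[of "fst e"] by (auto simp: X_def cross_def)
  qed
  ultimately show ?thesis using chain_card_le[of n n X] by simp
qed

text \<open>Listed from the top. Comparing each edge with its predecessor suffices, because the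
  corner only moves inwards; the corners are the arguments occurring in the edge term of
  \<open>F\<close>.\<close>

fun descending :: "nat \<Rightarrow> nat \<Rightarrow> (nat \<times> nat) list \<Rightarrow> bool" where
  "descending a b [] = True"
| "descending a b ((u, v) # es) \<longleftrightarrow> cross u v \<and> v \<le> a \<and> ps u \<le> b \<and> descending (u - 1) (ps v - 1) es"

lemma descending_chain:
  "descending a b es \<Longrightarrow> chain_in a b (set es) \<and> distinct es"
proof (induction es arbitrary: a b)
  case (Cons e es)
  obtain u v where e: "e = (u, v)" by (cases e)
  have d: "cross u v" "v \<le> a" "ps u \<le> b" using Cons.prems e by auto
  have IH: "chain_in (u - 1) (ps v - 1) (set es)" "distinct es" using Cons e by auto
  have bl: "below f e" if "f \<in> set es" for f
  proof -
    have "case f of (u', v') \<Rightarrow> cross u' v' \<and> v' \<le> u - 1 \<and> ps u' \<le> ps v - 1"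
      using IH that unfolding chain_in_def by blast
    then show ?thesis using d ps_range[of v] e by (auto simp: below_def cross_def)
  qed
  then have "e \<notin> set es" using bl[of e] d e by (auto simp: below_def cross_def)
  moreover have "chain_in a b (set es)"
    by (rule chain_in_mono[OF IH(1)]) (use d in \<open>auto simp: cross_def\<close>)
  ultimately show ?case using IH(2) d e bl by (auto simp: chain_in_def)
qed (simp add: chain_in_def)

text \<open>The bound \<open>F n n\<close> covers every induced matching, so one chain attaining it
  is a certificate of optimality, and the algorithm has only to produce it.\<close>

theorem descending_maximum:
  assumes "descending n n es" "length es = F n n"
  shows "maximum_induced_matching (perm_edges n p) {{u, v} | u v. (u, v) \<in> set es}"
proof -
  let ?g = "\<lambda>(u, v). {u, v}"
  let ?M = "{{u, v} | u v. (u, v) \<in> set es}"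
  have ch: "chain_in n n (set es)" "distinct es" using descending_chain assms by auto
  have cr: "cross u v" if "(u, v) \<in> set es" for u v
    using ch(1) that by (auto simp: chain_in_def)
  have M: "?M = ?g ` set es" by auto
  have "inj_on ?g (set es)" by (rule inj_on_subset[OF edge_inj]) (use cr in auto)
  from card_image[OF this] have "card ?M = F n n"
    unfolding M distinct_card[OF ch(2)] assms(2) .
  moreover have "induced_matching (perm_edges n p) ?M"
    unfolding induced_matching_def
  proof (intro conjI ballI impI)
    show "?M \<subseteq> perm_edges n p" unfolding M edges_eq using cr by auto
  next
    fix e1 e2 x y assume h: "e1 \<in> ?M" "e2 \<in> ?M" "e1 \<noteq> e2" "x \<in> e1" "y \<in> e2"
    then obtain u v u' v' where uv: "e1 = {u, v}" "e2 = {u', v'}" "(u, v) \<in> set es" "(u', v') \<in> set es"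
      by blast
    then have "below (u, v) (u', v') \<or> below (u', v') (u, v)"
      using ch(1) h(3) unfolding chain_in_def by blast
    moreover have "x \<in> {u, v}" "y \<in> {u', v'}" using h(4,5) uv(1,2) by simp_all
    ultimately have "\<not> cross x y \<and> \<not> cross y x"
      using below_independent[OF cr[OF uv(3)] cr[OF uv(4)]]
        below_independent[OF cr[OF uv(4)] cr[OF uv(3)]] by metis
    then show "{x, y} \<notin> perm_edges n p" using edge_iff by blast
  qed
  ultimately show ?thesis
    unfolding maximum_induced_matching_def using induced_matching_card_le by presburger
qed

end

section \<open>The sweep over the values\<close>

lemma nat_int_pred [simp]: "nat (int x - 1) = x - 1"
  by linarith

text \<open>\<open>x\<close> need not belong to \<open>S\<close>; this admits the list head 0, which
  is not a position, as a starting point.\<close>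

definition succ_in :: "nat set \<Rightarrow> nat \<Rightarrow> nat \<Rightarrow> bool" where
  "succ_in S x y \<longleftrightarrow> y \<in> S \<and> x < y \<and> (\<forall>z\<in>S. x < z \<longrightarrow> y \<le> z)"

text \<open>Charges one unit per cursor move: the set of elements already passed grows by exactly
  the old cursor. \<open>S\<close> may contain sentinels that are not counted in
  \<open>A\<close>.\<close>

lemma succ_in_below:
  assumes "succ_in S x y" "x \<in> A" "A \<subseteq> S" "finite A"
  shows "card {z \<in> A. z < y} = Suc (card {z \<in> A. z < x})"
proof -
  have "z \<in> A \<and> z < y \<longleftrightarrow> z = x \<or> z \<in> A \<and> z < x" for z
  proof (cases "x < z")
    case True
    then have "z \<in> A \<Longrightarrow> \<not> z < y" using assms by (auto simp: succ_in_def)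
    then show ?thesis using True by auto
  next
    case False
    then have "z = x \<or> z < x" by linarith
    then show ?thesis using assms(1,2) by (auto simp: succ_in_def)
  qed
  then have "{z \<in> A. z < y} = insert x {z \<in> A. z < x}" by blast
  then show ?thesis using assms(4) by simp
qed

definition pred_in :: "nat set \<Rightarrow> nat \<Rightarrow> nat \<Rightarrow> bool" where
  "pred_in S x y \<longleftrightarrow> y \<in> S \<and> y < x \<and> (\<forall>z\<in>S. z < x \<longrightarrow> z \<le> y)"

text \<open>
  \<open>fNEXT\<close> links the positions of entries \<open>\<ge> u\<close> forwards, \<open>fPREV\<close> those of entries \<open>< u\<close>
  backwards; \<open>fUP\<close> is only valid on the part of the latter list scanned last. \<open>fBEST\<close> maps a position
  to a chain, given by the node of its topmost edge (0 for the empty chain). The node of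
  an edge \<open>uv\<close> with \<open>u < v\<close> has index \<open>(n + 2) * u + pos v\<close>, and \<open>fLINK\<close> leads to the node of the
  next edge below.
\<close>

abbreviation (input) "vBASE \<equiv> 3::nat"
abbreviation (input) "vONE \<equiv> 4::nat"
abbreviation (input) "vN \<equiv> 5::nat"
abbreviation (input) "vSTOP \<equiv> 6::nat"
abbreviation (input) "vWIDTH \<equiv> 7::nat"
abbreviation (input) "vU \<equiv> 8::nat"
abbreviation (input) "vROW \<equiv> 9::nat"
abbreviation (input) "vPOS \<equiv> 10::nat"
abbreviation (input) "vPREV \<equiv> 11::nat"
abbreviation (input) "vX \<equiv> 12::nat"
abbreviation (input) "vBEST \<equiv> 13::nat"
abbreviation (input) "vK \<equiv> 14::nat"
abbreviation (input) "vT \<equiv> 15::nat"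
abbreviation (input) "vY \<equiv> 16::nat"
abbreviation (input) "vZ \<equiv> 17::nat"
abbreviation (input) "vZERO \<equiv> 18::nat"
abbreviation (input) "vEIGHT \<equiv> 19::nat"
abbreviation (input) "vCOUNT \<equiv> 20::nat"
abbreviation (input) "vI \<equiv> 21::nat"
abbreviation (input) "vL \<equiv> 22::nat"
abbreviation (input) "vL2 \<equiv> 23::nat"
abbreviation (input) "vD \<equiv> 24::nat"

abbreviation (input) "fVAL \<equiv> 2::nat"
abbreviation (input) "fPOS \<equiv> 3::nat"
abbreviation (input) "fNEXT \<equiv> 4::nat"
abbreviation (input) "fPREV \<equiv> 5::nat"
abbreviation (input) "fUP \<equiv> 6::nat"
abbreviation (input) "fBEST \<equiv> 7::nat"
abbreviation (input) "fROW \<equiv> 8::nat"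
abbreviation (input) "fLINK \<equiv> 9::nat"
abbreviation (input) "fLEN \<equiv> 10::nat"
abbreviation (input) "fLO \<equiv> 11::nat"
abbreviation (input) "fHI \<equiv> 12::nat"
abbreviation (input) "fOUT \<equiv> 13::nat"

text \<open>\<open>vPREV\<close> trails the cursor; when the loop stops at the position of the
  current value, it is the predecessor needed to unlink that position. The new node is linked to the
  chain stored at \<open>x - 1\<close>, the best one below the edge.\<close>

definition high_body :: com where
  "high_body = At (Mns vT vX vONE) ;; At (Ld vBEST fBEST vT) ;; At (St fBEST vX vBEST) ;;
     At (Pls vK vROW vX) ;; At (St fLINK vK vBEST) ;; At (Ld vT fLEN vBEST) ;;
     At (Pls vT vT vONE) ;; At (St fLEN vK vT) ;; At (St fLO vK vU) ;; At (Ld vT fVAL vX) ;;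
     At (St fHI vK vT) ;; At (Pls vPREV vX vZERO) ;; At (Ld vX fNEXT vX)"

text \<open>Leaves \<open>fUP\<close> as a trail for the way back from left to right.\<close>

definition scan_body :: com where
  "scan_body = At (St fUP vZ vY) ;; At (Pls vY vZ vZERO) ;; At (Ld vZ fPREV vZ)"

text \<open>\<open>vBEST\<close> carries the chain for position \<open>y - 1\<close> of the current
  row. It competes with the chain of the previous row stored at \<open>y\<close> and with the node
  of the edge between the entry at \<open>y\<close> and the current value: the three terms in the
  recursion for \<open>F\<close>.\<close>

definition low_body :: com where
  "low_body = At (Ld vL fLEN vBEST) ;; At (Ld vD fBEST vY) ;; At (Ld vL2 fLEN vD) ;;
     Cond (Lt vL vL2) (At (Pls vBEST vD vZERO) ;; At (Pls vL vL2 vZERO)) ;;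
     At (Ld vK fROW vY) ;; At (Pls vK vK vPOS) ;; At (Ld vL2 fLEN vK) ;;
     Cond (Lt vL vL2) (At (Pls vBEST vK vZERO)) ;;
     At (St fBEST vY vBEST) ;; At (Ld vY fUP vY)"

context permutation
begin

section \<open>Chains stored as linked nodes\<close>

definition row :: "nat \<Rightarrow> nat" where
  "row u = (n + 2) * u"

lemma row_mono: "u \<le> w \<Longrightarrow> row u \<le> row w"
  unfolding row_def by (rule mult_le_mono2)

text \<open>Rows are wider than the range of positions, so nodes of different rows cannot overlap,
  and the order of rows is the order of addresses.\<close>

lemma row_lt: "u < w \<Longrightarrow> y \<le> n \<Longrightarrow> row u + y < row w"
proof -
  assume "u < w" "y \<le> n"
  then have "row (Suc u) \<le> row w" by (intro row_mono) simp
  then show ?thesis using \<open>y \<le> n\<close> by (simp add: row_def)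
qed

text \<open>Nodes are written in increasing order of index, so a chain stays intact as long as the
  table below some \<open>m\<close> is unchanged.\<close>

definition same_nodes :: "nat \<Rightarrow> (nat \<Rightarrow> nat \<Rightarrow> int) \<Rightarrow> (nat \<Rightarrow> nat \<Rightarrow> int) \<Rightarrow> bool" where
  "same_nodes m a a' \<longleftrightarrow> (\<forall>f\<in>{fLINK, fLEN, fLO, fHI}. \<forall>i<m. a' f i = a f i)"

text \<open>The index of a node is computed from its edge, so common tails of different chains are
  the same cells. The corner shrinks as in \<open>descending\<close>.\<close>

fun rep :: "(nat \<Rightarrow> nat \<Rightarrow> int) \<Rightarrow> nat \<Rightarrow> nat \<Rightarrow> nat \<Rightarrow> (nat \<times> nat) list \<Rightarrow> bool" where
  "rep a x y k [] \<longleftrightarrow> k = 0"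
| "rep a x y k ((u, v) # es) \<longleftrightarrow> cross u v \<and> v \<le> x \<and> ps u \<le> y \<and> k = row u + ps v \<and>
     a fLO k = int u \<and> a fHI k = int v \<and> a fLEN k = int (Suc (length es)) \<and>
     (\<exists>k'. a fLINK k = int k' \<and> rep a (u - 1) (ps v - 1) k' es)"

lemma rep_upd [simp]:
  "f < 9 \<or> 12 < f \<Longrightarrow> rep (a(f := g)) x y k es \<longleftrightarrow> rep a x y k es"
  by (induction es arbitrary: x y k) auto

lemma rep_mono: "rep a x y k es \<Longrightarrow> x \<le> x' \<Longrightarrow> y \<le> y' \<Longrightarrow> rep a x' y' k es"
  by (cases es) auto

text \<open>The topmost edge \<open>uv\<close> satisfies \<open>u < v\<close> and
  \<open>v \<le> x\<close>, so its node is in a row before \<open>x\<close>. Consequently, nodes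
  written while a value is processed cannot damage chains of smaller values.\<close>

lemma rep_bound: "rep a x y k es \<Longrightarrow> k = 0 \<or> k < row x"
proof (cases es)
  case (Cons e es')
  assume r: "rep a x y k es"
  obtain u v where "e = (u, v)" by (cases e)
  then have "u < x" "ps v \<le> n" "k = row u + ps v"
    using r Cons ps_range[of v] by (auto simp: cross_def)
  then show ?thesis using row_lt by blast
qed simp

text \<open>Links lead to smaller indices, by \<open>rep_bound\<close> for the next corner, so the
  whole chain stays below \<open>m\<close>.\<close>

lemma rep_frame:
  assumes "rep a x y k es" "k < m" "same_nodes m a a'"
  shows "rep a' x y k es"
  using assms(1,2)
proof (induction es arbitrary: x y k)
  case (Cons e es)
  obtain u v where e: "e = (u, v)" by (cases e)
  obtain k' where k': "a fLINK k = int k'" "rep a (u - 1) (ps v - 1) k' es"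
    using Cons.prems e by auto
  have "k = row u + ps v" "1 \<le> ps v" using Cons.prems e ps_range[of v] by (auto simp: cross_def)
  then have "k' < m" using rep_bound[OF k'(2)] row_mono[of "u - 1" u] Cons.prems(2) by auto
  then have "rep a' (u - 1) (ps v - 1) k' es" using Cons.IH k'(2) by blast
  then show ?case using Cons.prems e k' assms(3) by (auto simp: same_nodes_def)
qed simp

text \<open>With length 0 stored at node 0, the program can compare lengths without treating the
  empty chain separately.\<close>

lemma rep_len: "rep a x y k es \<Longrightarrow> a fLEN 0 = 0 \<Longrightarrow> a fLEN k = int (length es)"
  by (cases es) auto

lemma rep_descending: "rep a x y k es \<Longrightarrow> descending x y es"
  by (induction a x y k es rule: rep.induct) auto

definition opt :: "(nat \<Rightarrow> nat \<Rightarrow> int) \<Rightarrow> nat \<Rightarrow> nat \<Rightarrow> int \<Rightarrow> bool" where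
  "opt a x y c \<longleftrightarrow> (\<exists>k es. c = int k \<and> rep a x y k es \<and> length es = F x y)"

text \<open>The best chain with \<open>uv\<close> on top. Its length is the edge term of the
  recursion, which may be smaller than \<open>F v (ps u)\<close>.\<close>

definition node :: "(nat \<Rightarrow> nat \<Rightarrow> int) \<Rightarrow> nat \<Rightarrow> nat \<Rightarrow> bool" where
  "node a u v \<longleftrightarrow> (\<exists>es. rep a v (ps u) (row u + ps v) es \<and> length es = Suc (F (u - 1) (ps v - 1)))"

lemma optI: "rep a x y k es \<Longrightarrow> length es = F x y \<Longrightarrow> opt a x y (int k)"
  by (auto simp: opt_def)

lemma optE:
  assumes "opt a x y c"
  obtains k es where "c = int k" "rep a x y k es" "length es = F x y"
  using assms by (auto simp: opt_def)

lemma nodeI: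
  "rep a v (ps u) (row u + ps v) es \<Longrightarrow> length es = Suc (F (u - 1) (ps v - 1)) \<Longrightarrow> node a u v"
  by (auto simp: node_def)

lemma nodeE:
  assumes "node a u v"
  obtains es where "rep a v (ps u) (row u + ps v) es" "length es = Suc (F (u - 1) (ps v - 1))"
  using assms by (auto simp: node_def)

lemma opt_upd [simp]: "f < 9 \<or> 12 < f \<Longrightarrow> opt (a(f := g)) x y c \<longleftrightarrow> opt a x y c"
  by (simp add: opt_def)

lemma node_upd [simp]: "f < 9 \<or> 12 < f \<Longrightarrow> node (a(f := g)) u v \<longleftrightarrow> node a u v"
  by (simp add: node_def)

lemma opt_0: "opt a x 0 0"
  using optI[of a x 0 0 "[]"] by simp

lemma opt_nonneg: "opt a x y c \<Longrightarrow> 0 \<le> c"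
  by (auto elim: optE)

lemma opt_len: "opt a x y c \<Longrightarrow> a fLEN 0 = 0 \<Longrightarrow> a fLEN (nat c) = int (F x y)"
  by (erule optE) (simp add: rep_len)

lemma node_len: "node a u v \<Longrightarrow> a fLEN 0 = 0 \<Longrightarrow> a fLEN (row u + ps v) = int (Suc (F (u - 1) (ps v - 1)))"
  by (erule nodeE) (simp add: rep_len)

text \<open>Justifies every value that is kept or copied rather than recomputed: where
  \<open>F\<close> does not grow, a chain for the smaller corner is still optimal.\<close>

lemma opt_move:
  "opt a x y c \<Longrightarrow> x \<le> x' \<Longrightarrow> y \<le> y' \<Longrightarrow> F x' y' = F x y \<Longrightarrow> opt a x' y' c"
  by (erule optE) (auto intro: optI rep_mono)

lemma node_opt:
  assumes "node a u v" "F v (ps u) = Suc (F (u - 1) (ps v - 1))"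
  shows "opt a v (ps u) (int (row u + ps v))"
  using assms(1) by (rule nodeE) (rule optI, use assms(2) in simp_all)

text \<open>\<open>0 < m\<close> admits the empty chain, whose node 0 is not below
  \<open>row 0\<close>.\<close>

lemma opt_frame:
  assumes "opt a x y c" "row x \<le> m" "0 < m" "same_nodes m a a'"
  shows "opt a' x y c"
proof (rule optE[OF assms(1)])
  fix k es assume k: "c = int k" "rep a x y k es" "length es = F x y"
  have "k < m" using rep_bound[OF k(2)] assms by auto
  from optI[OF rep_frame[OF k(2) this assms(4)] k(3)] show ?thesis using k(1) by simp
qed

lemma node_frame:
  assumes "node a u v" "row u + ps v < m" "same_nodes m a a'"
  shows "node a' u v"
  using assms(1) by (rule nodeE) (rule nodeI[OF rep_frame[OF _ assms(2,3)]])

section \<open>Positions of larger and of smaller entries\<close>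

definition High :: "nat \<Rightarrow> nat set" where
  "High u = {x \<in> {1..n}. u \<le> val x}"

definition Low :: "nat \<Rightarrow> nat set" where
  "Low u = {x \<in> {1..n}. val x < u}"

lemma finite_High [simp]: "finite (High u)" and finite_Low [simp]: "finite (Low u)"
  by (simp_all add: High_def Low_def)

lemma val_eq_iff:
  assumes "1 \<le> x" "x \<le> n" "1 \<le> u" "u \<le> n"
  shows "val x = u \<longleftrightarrow> x = ps u"
proof
  assume "val x = u"
  then show "x = ps u" using ps_val[OF assms(1,2)] by simp
next
  assume "x = ps u"
  then show "val x = u" using val_ps[OF assms(3,4)] by simp
qed

lemma High_Suc:
  assumes "1 \<le> u" "u \<le> n"
  shows "ps u \<in> High u" "High (Suc u) = High u - {ps u}"
proof -
  show "ps u \<in> High u" using ps_range[OF assms] val_ps[OF assms] by (simp add: High_def)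
  have "x \<in> High (Suc u) \<longleftrightarrow> x \<in> High u \<and> x \<noteq> ps u" for x
    using val_eq_iff[OF _ _ assms, of x] unfolding High_def mem_Collect_eq atLeastAtMost_iff by linarith
  then show "High (Suc u) = High u - {ps u}" by blast
qed

lemma Low_Suc:
  assumes "1 \<le> u" "u \<le> n"
  shows "ps u \<notin> Low u" "Low (Suc u) = insert (ps u) (Low u)"
proof -
  show "ps u \<notin> Low u" using val_ps[OF assms] by (simp add: Low_def)
  have "x \<in> Low (Suc u) \<longleftrightarrow> x = ps u \<or> x \<in> Low u" for x
    using val_eq_iff[OF _ _ assms, of x] ps_range[OF assms] val_ps[OF assms]
    unfolding Low_def mem_Collect_eq atLeastAtMost_iff by (cases "x = ps u") (simp, linarith)
  then show "Low (Suc u) = insert (ps u) (Low u)" by blast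
qed

lemma High_iff_Low: "1 \<le> x \<Longrightarrow> x \<le> n \<Longrightarrow> x \<in> High u \<longleftrightarrow> x \<notin> Low u"
  by (auto simp: High_def Low_def)

text \<open>
  The state while value \<open>u\<close> is being processed and the positions \<open>< x\<close> have been visited: below \<open>x\<close>,
  \<open>fBEST\<close> is up to date also at positions with larger entries, where it is stale otherwise.
\<close>

definition scanned :: "nat \<Rightarrow> nat \<Rightarrow> (nat \<Rightarrow> nat \<Rightarrow> int) \<Rightarrow> bool" where
  "scanned u x a \<longleftrightarrow> a fLEN 0 = 0 \<and> (\<forall>y. y < x \<or> y \<in> Low u \<longrightarrow> opt a (u - 1) y (a fBEST y)) \<and>
     (\<forall>w w'. cross w w' \<and> (w < u \<or> w = u \<and> ps w' < x) \<longrightarrow> node a w w')"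

text \<open>The entry at \<open>x\<close> exceeds \<open>u\<close>, so copying from
  \<open>x - 1\<close> is correct by \<open>F_high_column\<close>, and the edge between
  \<open>u\<close> and that entry gets its node. Between \<open>x\<close> and \<open>x'\<close>
  there are only smaller entries, whose chains are valid anyway, so the scan may jump directly to
  \<open>x'\<close>.\<close>

lemma scanned_step:
  assumes u: "1 \<le> u" "u \<le> n" and sc: "scanned u x a" and x: "x \<in> High u" "x < ps u"
    and x': "succ_in (insert (n + 1) (High u)) x x'" "x' \<le> n + 1"
    and a': "a' = a(fBEST := (a fBEST)(x := a fBEST (x - 1)),
      fLINK := (a fLINK)(row u + x := a fBEST (x - 1)),
      fLEN := (a fLEN)(row u + x := a fLEN (nat (a fBEST (x - 1))) + 1),
      fLO := (a fLO)(row u + x := int u), fHI := (a fHI)(row u + x := int (val x)))"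
  shows "scanned u x' a'"
proof -
  have xr: "1 \<le> x" "x \<le> n" "u \<le> val x" using x by (auto simp: High_def)
  have pv: "ps (val x) = x" using ps_val xr by simp
  have "val x \<noteq> u" using pv x by auto
  then have cr: "cross u (val x)" using xr val_range[of x] u x pv by (auto simp: cross_def)
  let ?k = "row u + x"
  have fr: "same_nodes ?k a a'" unfolding same_nodes_def a' by auto
  have opt: "opt a' (u - 1) y c" if "opt a (u - 1) y c" for y c
    by (rule opt_frame[OF that, of ?k]) (use fr row_mono[of "u - 1" u] xr in auto)
  have l0: "a' fLEN 0 = 0" using sc xr a' by (simp add: scanned_def)
  have prev: "opt a (u - 1) (x - 1) (a fBEST (x - 1))" using sc xr unfolding scanned_def by auto
  have "node a' u (val x)"
  proof -
    obtain k es where k: "a fBEST (x - 1) = int k" "rep a (u - 1) (x - 1) k es"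
      "length es = F (u - 1) (x - 1)" using prev by (rule optE)
    have "k < ?k" using rep_bound[OF k(2)] row_mono[of "u - 1" u] xr by auto
    from rep_frame[OF k(2) this fr] have "rep a' (u - 1) (x - 1) k es" .
    moreover have "a fLEN k = int (length es)" using rep_len[OF k(2)] sc by (simp add: scanned_def)
    ultimately have "rep a' (val x) (ps u) ?k ((u, val x) # es)" using cr k a' pv by auto
    then show ?thesis using k(3) pv by (intro nodeI[of a' "val x" u "(u, val x) # es"]) auto
  qed
  moreover have "node a' w w'" if "cross w w'" "w < u \<or> w = u \<and> ps w' < x" for w w'
  proof (rule node_frame[OF _ _ fr])
    show "node a w w'" using sc that unfolding scanned_def by blast
    show "row w + ps w' < ?k"
      using that row_lt[of w u "ps w'"] ps_range[of w'] by (auto simp: cross_def)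
  qed
  \<comment> \<open>A larger value crossing \<open>u\<close> stands in \<open>High u\<close>, and no
    position of \<open>High u\<close> lies strictly between \<open>x\<close> and
    \<open>x'\<close>.\<close>
  moreover have "ps w' < x \<or> w' = val x" if "cross u w'" "ps w' < x'" for w'
  proof (rule ccontr)
    assume n: "\<not> ?thesis"
    have w': "1 \<le> w'" "w' \<le> n" "u \<le> w'" using that u by (auto simp: cross_def)
    then have "ps w' \<noteq> x" using n val_ps[of w'] by auto
    then have "x < ps w'" using n by simp
    moreover have "ps w' \<in> High u" using w' ps_range[of w'] val_ps[of w'] by (simp add: High_def)
    ultimately show False using x' that(2) unfolding succ_in_def by auto
  qed
  ultimately have nodes: "node a' w w'" if "cross w w'" "w < u \<or> w = u \<and> ps w' < x'" for w w'
    using that by metis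
  have "opt a' (u - 1) y (a' fBEST y)" if y: "y < x' \<or> y \<in> Low u" for y
  proof (cases "y = x")
    case True
    have "F (u - 1) x = F (u - 1) (x - 1)" using F_high_column[of x "u - 1"] xr u by simp
    then have "opt a (u - 1) x (a fBEST (x - 1))" using opt_move[OF prev, of "u - 1" x] by simp
    then show ?thesis using opt True a' by simp
  next
    case False
    have "y < x \<or> y \<in> Low u"
    proof (rule ccontr)
      assume "\<not> ?thesis"
      then have "x < y" "y < x'" "y \<notin> Low u" using y False by auto
      moreover from this have "y \<in> High u" using High_iff_Low[of y u] x'(2) xr by simp
      ultimately show False using x' unfolding succ_in_def by auto
    qed
    then have "opt a (u - 1) y (a fBEST y)" using sc unfolding scanned_def by blast
    then show ?thesis using opt False a' by simp
  qed
  then show ?thesis using l0 nodes unfolding scanned_def by blast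
qed

section \<open>The three inner loops\<close>

definition same_except :: "nat set \<Rightarrow> (nat \<Rightarrow> 'a) \<Rightarrow> (nat \<Rightarrow> 'a) \<Rightarrow> bool" where
  "same_except S f g \<longleftrightarrow> (\<forall>x. x \<notin> S \<longrightarrow> g x = f x)"

text \<open>The position of \<open>u\<close> is still in the forward list, so the cursor cannot jump
  over it and stops there. Per element passed, 20 ticks cover the 13 atoms of the body and the
  test.\<close>

lemma wp_high:
  assumes u: "1 \<le> u" "u \<le> n"
    and v: "v vU = int u" "v vROW = int (row u)" "v vPOS = int (ps u)" "v vONE = 1"
      "v vZERO = 0" "v vPREV = 0" "v vX = a fNEXT 0"
    and sc: "scanned u 0 a"
    and b0: "a fBEST 0 = 0"
    and vl: "\<forall>x\<in>{1..n}. a fVAL x = int (val x)"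
    and nx: "\<forall>x\<in>insert 0 (High u). \<exists>y. a fNEXT x = int y \<and> succ_in (insert (n + 1) (High u)) x y"
  shows "wp B (Loop (Neq vX vPOS) high_body) (\<lambda>(v', a', r', t').
    \<exists>q. same_except {vT, vBEST, vK, vPREV, vX} v v' \<and>
      same_except {fBEST, fLINK, fLEN, fLO, fHI} a a' \<and> r' = r \<and> v' vPREV = int q \<and>
      q \<in> insert 0 (High u) \<and> succ_in (insert (n + 1) (High u)) q (ps u) \<and> a' fBEST 0 = 0 \<and>
      scanned u (ps u) a' \<and> t' \<le> t + 1 + 20 * card {y \<in> High u. y < ps u}) (v, a, r, t)"
proof -
  define I where "I = (\<lambda>x (v', a', r', t').
    \<exists>q. same_except {vT, vBEST, vK, vPREV, vX} v v' \<and>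
      same_except {fBEST, fLINK, fLEN, fLO, fHI} a a' \<and> r' = r \<and> v' vPREV = int q \<and>
      q \<in> insert 0 (High u) \<and> succ_in (insert (n + 1) (High u)) q x \<and> a' fBEST 0 = 0 \<and>
      scanned u x a' \<and> t' \<le> t + 20 * card {y \<in> High u. y < x} \<and>
      v' vX = int x \<and> x \<in> High u \<and> x \<le> ps u)"
  have pu: "ps u \<in> High u" using High_Suc u by simp
  obtain x0 where x0: "a fNEXT 0 = int x0" "succ_in (insert (n + 1) (High u)) 0 x0"
    using bspec[OF nx, of 0] by auto
  have pr: "1 \<le> ps u" "ps u \<le> n" using ps_range u by auto
  have x0b: "x0 \<le> ps u" using x0(2) pu pr unfolding succ_in_def by auto
  then have x0H: "x0 \<in> High u" using x0(2) pr unfolding succ_in_def by auto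
  \<comment> \<open>Before the first list element \<open>x0\<close> there are only position 0 and
    smaller entries, so the claim for 0 extends to \<open>x0\<close>.\<close>
  have sc0: "scanned u x0 a"
    unfolding scanned_def
  proof (intro conjI allI impI)
    fix y assume y: "y < x0 \<or> y \<in> Low u"
    show "opt a (u - 1) y (a fBEST y)"
    proof (cases "y = 0 \<or> y \<in> Low u")
      case True
      then show ?thesis using sc opt_0 b0 unfolding scanned_def by auto
    next
      case False
      then have "y \<in> High u" using y x0b pr High_iff_Low[of y u] by simp
      then show ?thesis using x0(2) y False unfolding succ_in_def by auto
    qed
  next
    fix w w' assume c: "cross w w' \<and> (w < u \<or> w = u \<and> ps w' < x0)"
    have "ps w' \<in> High w" using c val_ps[of w'] ps_range[of w'] by (auto simp: High_def cross_def)
    then have "w < u" using c x0(2) unfolding succ_in_def High_def by auto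
    then show "node a w w'" using sc c unfolding scanned_def by blast
  qed (use sc in \<open>simp add: scanned_def\<close>)
  show ?thesis
  proof (rule wp_Loop[where I = I and f = "\<lambda>x. ps u - x" and k = x0])
    show "I x0 (v, a, r, t)"
      unfolding I_def using v x0 x0b x0H sc0 b0 by (auto simp: same_except_def)
  next
    fix x s assume I: "I x s" and h: "holds (Neq vX vPOS) s"
    obtain v' a' r' t' where s: "s = (v', a', r', t')" by (cases s)
    obtain q where q: "same_except {vT, vBEST, vK, vPREV, vX} v v'"
      "same_except {fBEST, fLINK, fLEN, fLO, fHI} a a'" "r' = r" "v' vPREV = int q"
      "q \<in> insert 0 (High u)" "succ_in (insert (n + 1) (High u)) q x" "a' fBEST 0 = 0"
      "scanned u x a'" "t' \<le> t + 20 * card {y \<in> High u. y < x}"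
      "v' vX = int x" "x \<in> High u" "x \<le> ps u"
      using I unfolding I_def s by auto
    have v': "v' vU = int u" "v' vROW = int (row u)" "v' vPOS = int (ps u)" "v' vONE = 1" "v' vZERO = 0"
      using q(1) v by (auto simp: same_except_def)
    have xlt: "x < ps u" using h s q v' by auto
    have xr: "1 \<le> x" "x \<le> n" using q(11) by (auto simp: High_def)
    have a'eq: "a' fVAL = a fVAL" "a' fNEXT = a fNEXT" using q(2) by (auto simp: same_except_def)
    obtain x' where x': "a fNEXT x = int x'" "succ_in (insert (n + 1) (High u)) x x'"
      using bspec[OF nx, of x] q(11) by auto
    have x'b: "x < x'" "x' \<le> ps u" using x'(2) pu xlt unfolding succ_in_def by auto
    then have x'H: "x' \<in> High u" using x'(2) pr unfolding succ_in_def by auto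
    have cd: "card {y \<in> High u. y < x'} = Suc (card {y \<in> High u. y < x})"
      by (rule succ_in_below[OF x'(2) q(11)]) auto
    have nn: "0 \<le> a' fBEST (x - 1)"
      using q(8) xr opt_nonneg[of a' "u - 1" "x - 1"] unfolding scanned_def by simp
    have vx: "a fVAL x = int (val x)" using vl xr by simp
    have "x' \<le> n + 1" using x'b pr by simp
    note step = scanned_step[OF u q(8,11) xlt x'(2) this refl]
    show "wp B high_body (\<lambda>s'. \<exists>k'. ps u - k' < ps u - x \<and> I k' s') (tick s)"
      unfolding s high_body_def
      using nn xr
      apply (simp add: v' q(10))
      apply (intro exI[of _ x'] conjI)
      subgoal using x'b xlt by simp
      unfolding I_def
      apply (simp add: v' a'eq same_except_def nat_int_add vx)
      apply (intro conjI)
      subgoal using q(1) by (simp add: same_except_def)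
      subgoal using q(2) by (simp add: same_except_def)
      subgoal using q(3) .
      subgoal using q(11) .
      subgoal using x'(2) by simp
      subgoal using q(7) .
      subgoal using step by simp
      subgoal using q(9) cd by simp
      subgoal using x'(1) .
      subgoal using x'H .
      subgoal using x'b by simp
      done
  next
    fix x s assume I: "I x s" and h: "\<not> holds (Neq vX vPOS) s"
    obtain v' a' r' t' where s: "s = (v', a', r', t')" by (cases s)
    have "v' vPOS = int (ps u)" "v' vX = int x" using I v(3) unfolding I_def s by (auto simp: same_except_def)
    then have "x = ps u" using h s by simp
    then show "case tick s of (v', a', r', t') \<Rightarrow>
      \<exists>q. same_except {vT, vBEST, vK, vPREV, vX} v v' \<and>
        same_except {fBEST, fLINK, fLEN, fLO, fHI} a a' \<and> r' = r \<and> v' vPREV = int q \<and>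
        q \<in> insert 0 (High u) \<and> succ_in (insert (n + 1) (High u)) q (ps u) \<and> a' fBEST 0 = 0 \<and>
        scanned u (ps u) a' \<and> t' \<le> t + 1 + 20 * card {y \<in> High u. y < ps u}"
      using I unfolding I_def s by auto
  qed
qed


lemma rep_cong:
  assumes "same_except S a a'" "S \<inter> {9, 10, 11, 12} = {}"
  shows "rep a' x y k es \<longleftrightarrow> rep a x y k es"
proof -
  have "a' fLINK = a fLINK" "a' fLEN = a fLEN" "a' fLO = a fLO" "a' fHI = a fHI"
    using assms by (auto simp: same_except_def)
  then show ?thesis by (induction es arbitrary: x y k) auto
qed

lemma opt_cong:
  "same_except S a a' \<Longrightarrow> S \<inter> {9, 10, 11, 12} = {} \<Longrightarrow> opt a' x y c \<longleftrightarrow> opt a x y c"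
  unfolding opt_def by (simp add: rep_cong)

text \<open>The sentinel 0 ends the scan at the latest. On exit \<open>z\<close> and
  \<open>y\<close> enclose the position of \<open>u\<close>, which is where it has to be inserted,
  and all list elements further right have return pointers.\<close>

lemma wp_scan:
  assumes u: "1 \<le> u" "u \<le> n"
    and v: "v vPOS = int (ps u)" "v vZERO = 0" "v vY = int (n + 1)" "v vZ = a fPREV (n + 1)"
    and pv: "\<forall>y\<in>insert (n + 1) (Low u). \<exists>z. a fPREV y = int z \<and> pred_in (insert 0 (Low u)) y z"
  shows "wp B (Loop (Lt vPOS vZ) scan_body) (\<lambda>(v', a', r', t').
    \<exists>y z. same_except {vY, vZ} v v' \<and> same_except {fUP} a a' \<and> r' = r \<and>
      v' vY = int y \<and> v' vZ = int z \<and> y \<in> insert (n + 1) (Low u) \<and>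
      pred_in (insert 0 (Low u)) y z \<and> z < ps u \<and> ps u < y \<and>
      (\<forall>w\<in>Low u. y \<le> w \<longrightarrow> (\<exists>w'. a' fUP w = int w' \<and> succ_in (insert (n + 1) (Low u)) w w')) \<and>
      t' \<le> t + 1 + 5 * card {w \<in> Low u. ps u < w}) (v, a, r, t)"
proof -
  define I where "I = (\<lambda>y (v', a', r', t').
    \<exists>z. same_except {vY, vZ} v v' \<and> same_except {fUP} a a' \<and> r' = r \<and>
      v' vY = int y \<and> v' vZ = int z \<and> y \<in> insert (n + 1) (Low u) \<and>
      pred_in (insert 0 (Low u)) y z \<and> ps u < y \<and>
      (\<forall>w\<in>Low u. y \<le> w \<longrightarrow> (\<exists>w'. a' fUP w = int w' \<and> succ_in (insert (n + 1) (Low u)) w w')) \<and>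
      t' \<le> t + 5 * card {w \<in> Low u. y \<le> w})"
  have pr: "1 \<le> ps u" "ps u \<le> n" using ps_range u by auto
  have low_le: "w \<le> n" if "w \<in> Low u" for w using that by (simp add: Low_def)
  show ?thesis
  proof (rule wp_Loop[where I = I and f = "\<lambda>y. y" and k = "n + 1"])
    obtain z where "a fPREV (n + 1) = int z" "pred_in (insert 0 (Low u)) (n + 1) z"
      using bspec[OF pv, of "n + 1"] by auto
    moreover have "\<not> n + 1 \<le> w" if "w \<in> Low u" for w using low_le[OF that] by simp
    ultimately show "I (n + 1) (v, a, r, t)"
      unfolding I_def using v pr by (auto simp: same_except_def)
  next
    fix y s assume I: "I y s" and h: "holds (Lt vPOS vZ) s"
    obtain v' a' r' t' where s: "s = (v', a', r', t')" by (cases s)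
    obtain z where z: "same_except {vY, vZ} v v'" "same_except {fUP} a a'" "r' = r"
      "v' vY = int y" "v' vZ = int z" "y \<in> insert (n + 1) (Low u)"
      "pred_in (insert 0 (Low u)) y z" "ps u < y"
      "\<forall>w\<in>Low u. y \<le> w \<longrightarrow> (\<exists>w'. a' fUP w = int w' \<and> succ_in (insert (n + 1) (Low u)) w w')"
      "t' \<le> t + 5 * card {w \<in> Low u. y \<le> w}"
      using I unfolding I_def s by auto
    have v': "v' vPOS = int (ps u)" "v' vZERO = 0" using z(1) v by (auto simp: same_except_def)
    have a': "a' fPREV = a fPREV" using z(2) by (auto simp: same_except_def)
    have zlt: "ps u < z" "z < y" using h s v' z(5,7) by (auto simp: pred_in_def)
    have zL: "z \<in> Low u" using z(7) zlt by (auto simp: pred_in_def)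
    obtain z' where z': "a fPREV z = int z'" "pred_in (insert 0 (Low u)) z z'"
      using bspec[OF pv, of z] zL by auto
    \<comment> \<open>The same adjacency read in the other direction, with the sentinel
      \<open>n + 1\<close> in place of 0.\<close>
    have sz: "succ_in (insert (n + 1) (Low u)) z y"
      unfolding succ_in_def
    proof (intro conjI ballI impI)
      fix w assume w: "w \<in> insert (n + 1) (Low u)" "z < w"
      show "y \<le> w"
      proof (cases "w = n + 1")
        case True
        then show ?thesis using z(6) low_le[of y] by auto
      next
        case False
        then have "w \<in> insert 0 (Low u)" using w by simp
        then have "w < y \<Longrightarrow> w \<le> z" using z(7) unfolding pred_in_def by blast
        then show ?thesis using w(2) by linarith
      qed
    qed (use z(6) zlt in auto)
    have nxt: "w = z \<or> y \<le> w" if "w \<in> Low u" "z \<le> w" for w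
    proof (cases "w = z")
      case False
      then have "z < w" using that by simp
      then show ?thesis using sz that(1) unfolding succ_in_def by simp
    qed simp
    have "w \<in> Low u \<and> z \<le> w \<longleftrightarrow> w = z \<or> w \<in> Low u \<and> y \<le> w" for w
      using nxt[of w] zL zlt by (cases "w = z") auto
    then have "{w \<in> Low u. z \<le> w} = insert z {w \<in> Low u. y \<le> w}" by blast
    then have cd: "card {w \<in> Low u. z \<le> w} = Suc (card {w \<in> Low u. y \<le> w})"
      using zlt by simp
    show "wp B scan_body (\<lambda>s'. \<exists>k'. k' < y \<and> I k' s') (tick s)"
      unfolding s scan_body_def
      apply (simp add: v' z(4,5) a' z'(1))
      apply (intro exI[of _ z] conjI)
      subgoal using zlt by simp
      unfolding I_def
      apply (simp add: same_except_def)
      apply (intro conjI)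
      subgoal using z(1) by (simp add: same_except_def)
      subgoal using z(2) by (simp add: same_except_def)
      subgoal using z(3) .
      subgoal using zL by simp
      subgoal using z'(2) .
      subgoal using zlt by simp
      subgoal using sz z(9) nxt by auto
      subgoal using z(10) cd by simp
      done
  next
    fix y s assume I: "I y s" and h: "\<not> holds (Lt vPOS vZ) s"
    obtain v' a' r' t' where s: "s = (v', a', r', t')" by (cases s)
    obtain z where z: "same_except {vY, vZ} v v'" "same_except {fUP} a a'" "r' = r"
      "v' vY = int y" "v' vZ = int z" "y \<in> insert (n + 1) (Low u)"
      "pred_in (insert 0 (Low u)) y z" "ps u < y"
      "\<forall>w\<in>Low u. y \<le> w \<longrightarrow> (\<exists>w'. a' fUP w = int w' \<and> succ_in (insert (n + 1) (Low u)) w w')"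
      "t' \<le> t + 5 * card {w \<in> Low u. y \<le> w}"
      using I unfolding I_def s by auto
    have "v' vPOS = int (ps u)" using z(1) v by (auto simp: same_except_def)
    then have "z \<le> ps u" using h s z(5) by simp
    moreover have "z \<noteq> ps u" using z(7) Low_Suc(1)[OF u] pr by (auto simp: pred_in_def)
    ultimately have zlt: "z < ps u" by simp
    have "card {w \<in> Low u. y \<le> w} \<le> card {w \<in> Low u. ps u < w}"
      by (rule card_mono) (use z(8) in auto)
    then have "Suc t' \<le> t + 1 + 5 * card {w \<in> Low u. ps u < w}" using z(10) by linarith
    then show "case tick s of (v', a', r', t') \<Rightarrow>
      \<exists>y z. same_except {vY, vZ} v v' \<and> same_except {fUP} a a' \<and> r' = r \<and>
        v' vY = int y \<and> v' vZ = int z \<and> y \<in> insert (n + 1) (Low u) \<and>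
        pred_in (insert 0 (Low u)) y z \<and> z < ps u \<and> ps u < y \<and>
        (\<forall>w\<in>Low u. y \<le> w \<longrightarrow> (\<exists>w'. a' fUP w = int w' \<and> succ_in (insert (n + 1) (Low u)) w w')) \<and>
        t' \<le> t + 1 + 5 * card {w \<in> Low u. ps u < w}"
      unfolding s tick.simps prod.case using z zlt by (intro exI[of _ y] exI[of _ z] conjI)
  qed
qed

lemma F_const_run:
  assumes "b \<le> b'" "\<And>x. b < x \<Longrightarrow> x \<le> b' \<Longrightarrow> x \<le> n \<and> a < val x"
  shows "F a b' = F a b"
  using assms
proof (induction b' rule: dec_induct)
  case (step m)
  then have "F a (Suc m) = F a m" using F_high_column[of "Suc m" a] by simp
  then show ?case using step by simp
qed simp

text \<open>Stored lengths are values of \<open>F\<close>, so comparing them evaluates the maximum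
  in the recursion. The nested conditional is the outcome of the two strict tests in
  \<open>low_body\<close>, where ties keep the earlier candidate.\<close>

lemma best_update:
  assumes y: "y \<in> Low u" "ps u < y" and u: "1 \<le> u" "u \<le> n"
    and l0: "a fLEN 0 = 0"
    and c: "opt a u (y - 1) c" and d: "opt a (u - 1) y d" and nd: "node a (val y) u"
  shows "opt a u y (if max (a fLEN (nat c)) (a fLEN (nat d)) < a fLEN (row (val y) + ps u)
      then int (row (val y) + ps u) else if a fLEN (nat c) < a fLEN (nat d) then d else c)"
proof -
  have yr: "1 \<le> y" "y \<le> n" "val y < u" using y by (auto simp: Low_def)
  have py: "ps (val y) = y" using ps_val yr by simp
  have cr: "cross (val y) u" using val_range[of y] yr y py u by (auto simp: cross_def)
  have Fy: "F u y = max (max (F (u - 1) y) (F u (y - 1))) (Suc (F (val y - 1) (ps u - 1)))"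
    using F_cross[OF cr py[symmetric]] .
  have len: "a fLEN (nat c) = int (F u (y - 1))" "a fLEN (nat d) = int (F (u - 1) y)"
    "a fLEN (row (val y) + ps u) = int (Suc (F (val y - 1) (ps u - 1)))"
    using opt_len[OF c l0] opt_len[OF d l0] node_len[OF nd l0] by auto
  consider (1) "max (F u (y - 1)) (F (u - 1) y) < Suc (F (val y - 1) (ps u - 1))"
    | (2) "\<not> max (F u (y - 1)) (F (u - 1) y) < Suc (F (val y - 1) (ps u - 1))"
        "F u (y - 1) < F (u - 1) y"
    | (3) "\<not> max (F u (y - 1)) (F (u - 1) y) < Suc (F (val y - 1) (ps u - 1))"
        "\<not> F u (y - 1) < F (u - 1) y" by blast
  then show ?thesis
  proof cases
    case 1
    then have "F u y = Suc (F (val y - 1) (ps u - 1))" using Fy by simp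
    then have "opt a u y (int (row (val y) + ps u))"
      using node_opt[OF nd] py by simp
    then show ?thesis using 1 len by (simp add: max_def split: if_splits)
  next
    case 2
    then have "F u y = F (u - 1) y" using Fy by linarith
    then have "opt a u y d" using opt_move[OF d, of u y] by simp
    then show ?thesis using 2 len by (simp add: max_def split: if_splits)
  next
    case 3
    then have "F u y = F u (y - 1)" using Fy by linarith
    then have "opt a u y c" using opt_move[OF c, of u y] by simp
    then show ?thesis using 3 len by (simp add: max_def split: if_splits)
  qed
qed

text \<open>To the left of \<open>u\<close>, row \<open>u\<close> equals row \<open>u - 1\<close>
  and the stored chains remain valid. To the right, smaller entries are visited in increasing order,
  and the larger entries in between leave the running chain optimal.\<close>

lemma wp_low:
  assumes u: "1 \<le> u" "u \<le> n"
    and v: "v vPOS = int (ps u)" "v vZERO = 0" "v vSTOP = int (n + 1)" "v vY = int y0"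
    and y0: "y0 \<in> insert (n + 1) (Low u)" "ps u < y0" "\<forall>w\<in>Low u. ps u < w \<longrightarrow> y0 \<le> w"
    and up: "\<forall>w\<in>Low u. y0 \<le> w \<longrightarrow> (\<exists>w'. a fUP w = int w' \<and> succ_in (insert (n + 1) (Low u)) w w')"
    and l0: "a fLEN 0 = 0"
    and c0: "opt a u (ps u) (v vBEST)" "a fBEST (ps u) = v vBEST"
    and d: "\<forall>y\<in>Low u. opt a (u - 1) y (a fBEST y)"
    and nd: "\<forall>w. cross w u \<longrightarrow> node a w u"
    and rw: "\<forall>y\<in>Low u. a fROW y = int (row (val y))"
  shows "wp B (Loop (Neq vY vSTOP) low_body) (\<lambda>(v', a', r', t').
      same_except {vL, vD, vL2, vBEST, vK, vY} v v' \<and> same_except {fBEST} a a' \<and> r' = r \<and>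
      a' fBEST 0 = a fBEST 0 \<and> (\<forall>y\<in>insert (ps u) (Low u). opt a' u y (a' fBEST y)) \<and>
      t' \<le> t + 1 + 25 * card {w \<in> Low u. ps u < w}) (v, a, r, t)"
proof -
  \<comment> \<open>\<open>opt\<close> refers to \<open>a\<close> throughout: it reads only node
    fields, and the loop changes only \<open>fBEST\<close>.\<close>
  define I where "I = (\<lambda>y (v', a', r', t').
      same_except {vL, vD, vL2, vBEST, vK, vY} v v' \<and> same_except {fBEST} a a' \<and> r' = r \<and>
      a' fBEST 0 = a fBEST 0 \<and> a' fBEST (ps u) = v vBEST \<and>
      (\<forall>w\<in>Low u. w < y \<longrightarrow> opt a u w (a' fBEST w)) \<and>
      (\<forall>w\<in>Low u. y \<le> w \<longrightarrow> a' fBEST w = a fBEST w) \<and>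
      opt a u (y - 1) (v' vBEST) \<and> v' vY = int y \<and> y \<in> insert (n + 1) (Low u) \<and> y0 \<le> y \<and>
      t' \<le> t + 25 * card {w \<in> {w \<in> Low u. ps u < w}. w < y})"
  have pr: "1 \<le> ps u" "ps u \<le> n" using ps_range u by auto
  have low: "1 \<le> w" "w \<le> n" "val w < u" if "w \<in> Low u" for w using that by (auto simp: Low_def)
  have y0n: "y0 \<le> n + 1" using y0(1) low(2)[of y0] by auto
  have high: "u < val x" if "ps u < x" "x \<le> n" "x \<notin> Low u" for x
    using that pr val_eq_iff[of x u] u by (auto simp: Low_def)
  have run: "F u (y - 1) = F u b" if "b < y" "y \<le> n + 1" "ps u \<le> b" "\<forall>w\<in>Low u. b < w \<longrightarrow> y \<le> w" for b y
  proof (rule F_const_run)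
    fix x assume x: "b < x" "x \<le> y - 1"
    then have "x \<le> n" "ps u < x" using that by auto
    moreover have "x \<notin> Low u" using that(1,4) x by auto
    ultimately show "x \<le> n \<and> u < val x" using high by simp
  qed (use that in simp)
  have fin: "{w \<in> {w \<in> Low u. ps u < w}. w < n + 1} = {w \<in> Low u. ps u < w}"
    using low(2) by fastforce
  show ?thesis
  proof (rule wp_Loop[where I = I and f = "\<lambda>y. n + 1 - y" and k = y0])
    have "opt a u (y0 - 1) (v vBEST)"
      using run[OF y0(2) y0n order_refl y0(3)] y0(2) opt_move[OF c0(1), of u "y0 - 1"] by simp
    moreover have "opt a u w (a fBEST w)" if "w \<in> Low u" "w < y0" for w
    proof -
      have "w \<noteq> ps u" using Low_Suc(1)[OF u] that by auto
      then have "w < ps u" using y0(3) that by force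
      then show ?thesis using F_late_row[OF u] bspec[OF d that(1)] opt_move[of a "u - 1" w _ u w] by simp
    qed
    ultimately show "I y0 (v, a, r, t)"
      unfolding I_def using v y0 c0 by (simp add: same_except_def)
  next
    fix y s assume I: "I y s" and h: "holds (Neq vY vSTOP) s"
    obtain v' a' r' t' where s: "s = (v', a', r', t')" by (cases s)
    have z: "same_except {vL, vD, vL2, vBEST, vK, vY} v v'" "same_except {fBEST} a a'" "r' = r"
      "a' fBEST 0 = a fBEST 0" "a' fBEST (ps u) = v vBEST"
      "\<forall>w\<in>Low u. w < y \<longrightarrow> opt a u w (a' fBEST w)"
      "\<forall>w\<in>Low u. y \<le> w \<longrightarrow> a' fBEST w = a fBEST w"
      "opt a u (y - 1) (v' vBEST)" "v' vY = int y" "y \<in> insert (n + 1) (Low u)" "y0 \<le> y"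
      "t' \<le> t + 25 * card {w \<in> {w \<in> Low u. ps u < w}. w < y}"
      using I unfolding I_def s by auto
    have v': "v' vPOS = int (ps u)" "v' vZERO = 0" "v' vSTOP = int (n + 1)"
      using z(1) v by (auto simp: same_except_def)
    have a': "a' fUP = a fUP" "a' fROW = a fROW" "a' fLEN = a fLEN"
      using z(2) by (auto simp: same_except_def)
    have yL: "y \<in> Low u" using h s z(9,10) v' by auto
    have yp: "ps u < y" using z(11) y0(2) by simp
    obtain y' where y': "a fUP y = int y'" "succ_in (insert (n + 1) (Low u)) y y'"
      using bspec[OF up yL] z(11) by auto
    have y'n: "y < y'" "y' \<le> n + 1" using y'(2) low(2)[of y'] by (auto simp: succ_in_def)
    have y'w: "\<forall>w\<in>Low u. y < w \<longrightarrow> y' \<le> w" using y'(2) by (auto simp: succ_in_def)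
    define d where "d = a fBEST y"
    have dy: "a' fBEST y = d" using z(7) yL by (simp add: d_def)
    have od: "opt a (u - 1) y d" using assms(14) yL by (simp add: d_def)
    have cr: "cross (val y) u"
      using val_range[of y] low[OF yL] yp ps_val[of y] u by (auto simp: cross_def)
    define k where "k = row (val y) + ps u"
    define c where "c = v' vBEST"
    define b where "b = (if max (a fLEN (nat c)) (a fLEN (nat d)) < a fLEN k
      then int k else if a fLEN (nat c) < a fLEN (nat d) then d else c)"
    have ob: "opt a u y b"
      using best_update[OF yL yp u l0 z(8) od] nd cr unfolding b_def c_def k_def by simp
    have nn: "0 \<le> c" "0 \<le> d" using opt_nonneg[OF z(8)] opt_nonneg[OF od] by (auto simp: c_def)
    have rk: "a fROW y + int (ps u) = int k" using rw yL by (simp add: k_def)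
    have ob': "opt a u (y' - 1) b"
      using run[OF y'n _ y'w] yp y'n opt_move[OF ob, of u "y' - 1"] by simp
    have cd: "card {w \<in> {w \<in> Low u. ps u < w}. w < y'} = Suc (card {w \<in> {w \<in> Low u. ps u < w}. w < y})"
      by (rule succ_in_below[OF y'(2)]) (use yL yp in auto)
    have main: "I y' (v'', a'', r', t'')"
      if "same_except {vL, vD, vL2, vBEST, vK, vY} v' v''" "a'' = a'(fBEST := (a' fBEST)(y := b))"
        "v'' vBEST = b" "v'' vY = int y'" "t'' \<le> t' + 25" for v'' a'' t''
      unfolding I_def prod.case
    proof (intro conjI ballI impI)
      show "same_except {vL, vD, vL2, vBEST, vK, vY} v v''" "same_except {fBEST} a a''"
        using z(1,2) that by (auto simp: same_except_def)
      show "a'' fBEST 0 = a fBEST 0" "a'' fBEST (ps u) = v vBEST"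
        using that z(4,5) yp by auto
      fix w assume w: "w \<in> Low u"
      show "opt a u w (a'' fBEST w)" if "w < y'"
      proof (cases "w = y")
        case True
        then show ?thesis using ob \<open>a'' = _\<close> by simp
      next
        case False
        have "\<not> y < w" using y'w w that by auto
        then have "w < y" using False by simp
        then show ?thesis using z(6) w False \<open>a'' = _\<close> by simp
      qed
      show "a'' fBEST w = a fBEST w" if "y' \<le> w"
        using z(7) w that y'n \<open>a'' = _\<close> by simp
    next
      show "t'' \<le> t + 25 * card {w \<in> {w \<in> Low u. ps u < w}. w < y'}"
        using that(5) z(12) unfolding cd by simp
      show "opt a u (y' - 1) (v'' vBEST)" using ob' that by simp
      show "y' \<in> insert (n + 1) (Low u)" using y'(2) by (simp add: succ_in_def)
      show "y0 \<le> y'" using z(11) y'n by simp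
    qed (use that z(3) in auto)
    show "wp B low_body (\<lambda>s'. \<exists>k'. n + 1 - k' < n + 1 - y \<and> I k' s') (tick s)"
      unfolding s low_body_def
      apply (simp add: v' z(9) a' y'(1) dy rk nn c_def[symmetric])
      apply (intro conjI impI; rule exI[of _ y']; rule conjI)
      using y'n apply simp_all
      \<comment> \<open>Every path through the two conditionals ends with the chain
        \<open>b\<close>.\<close>
      by (rule main; simp add: same_except_def b_def c_def[symmetric])+
  next
    fix y s assume I: "I y s" and h: "\<not> holds (Neq vY vSTOP) s"
    obtain v' a' r' t' where s: "s = (v', a', r', t')" by (cases s)
    have z: "same_except {vL, vD, vL2, vBEST, vK, vY} v v'" "same_except {fBEST} a a'" "r' = r"
      "a' fBEST 0 = a fBEST 0" "a' fBEST (ps u) = v vBEST"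
      "\<forall>w\<in>Low u. w < y \<longrightarrow> opt a u w (a' fBEST w)" "v' vY = int y"
      "t' \<le> t + 25 * card {w \<in> {w \<in> Low u. ps u < w}. w < y}"
      using I unfolding I_def s by auto
    have "v' vSTOP = int (n + 1)" using z(1) v by (auto simp: same_except_def)
    then have y: "y = n + 1" using h s z(7) by simp
    have "opt a' u w (a' fBEST w)" if "w \<in> insert (ps u) (Low u)" for w
    proof (cases "w = ps u")
      case True
      then show ?thesis using c0(1) z(5) opt_cong[OF z(2)] by simp
    next
      case False
      then have w: "w \<in> Low u" using that by simp
      then show ?thesis using z(6) low(2)[OF w] y opt_cong[OF z(2)] by simp
    qed
    moreover have "Suc t' \<le> t + 1 + 25 * card {w \<in> Low u. ps u < w}"
      using z(8) unfolding y fin by simp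
    ultimately show "case tick s of (v', a', r', t') \<Rightarrow>
      same_except {vL, vD, vL2, vBEST, vK, vY} v v' \<and> same_except {fBEST} a a' \<and> r' = r \<and>
      a' fBEST 0 = a fBEST 0 \<and> (\<forall>y\<in>insert (ps u) (Low u). opt a' u y (a' fBEST y)) \<and>
      t' \<le> t + 1 + 25 * card {w \<in> Low u. ps u < w}"
      unfolding s tick.simps prod.case using z by (intro conjI ballI)
  qed
qed

end


section \<open>Processing one value\<close>

definition high_part :: com where
  "high_part = At (Ld vPOS fPOS vU) ;; At (St fROW vPOS vROW) ;; At (Cst vPREV 0) ;;
     At (Ld vX fNEXT vZERO) ;; Loop (Neq vX vPOS) high_body"

text \<open>Before the backward scan starts, the current position is unlinked from the forward list
  and receives the chain of the position before it, which is optimal by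
  \<open>F_point\<close>.\<close>

definition scan_part :: com where
  "scan_part = At (Ld vT fNEXT vPOS) ;; At (St fNEXT vPREV vT) ;;
     At (Mns vT vPOS vONE) ;; At (Ld vBEST fBEST vT) ;; At (St fBEST vPOS vBEST) ;;
     At (Pls vY vSTOP vZERO) ;; At (Ld vZ fPREV vY) ;; Loop (Lt vPOS vZ) scan_body"

text \<open>The current position enters the backward list between \<open>vZ\<close> and
  \<open>vY\<close>. The row offset is advanced by addition, the machine having no
  multiplication.\<close>

definition low_part :: com where
  "low_part = At (St fPREV vPOS vZ) ;; At (St fPREV vY vPOS) ;;
     Loop (Neq vY vSTOP) low_body ;; At (Pls vU vU vONE) ;; At (Pls vROW vROW vWIDTH)"

context permutation
begin

definition consts_ok :: "nat \<Rightarrow> (nat \<Rightarrow> int) \<Rightarrow> bool" where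
  "consts_ok u v \<longleftrightarrow> v vONE = 1 \<and> v vN = int n \<and> v vSTOP = int (n + 1) \<and>
     v vWIDTH = int (n + 2) \<and> v vZERO = 0 \<and> v vCOUNT = 0 \<and> v vI = 0 \<and> v vU = int u \<and>
     v vROW = int (row u)"

definition input_ok :: "(nat \<Rightarrow> nat \<Rightarrow> int) \<Rightarrow> bool" where
  "input_ok a \<longleftrightarrow> (\<forall>x\<in>{1..n}. a fVAL x = int (val x)) \<and> (\<forall>w\<in>{1..n}. a fPOS w = int (ps w)) \<and>
     a fBEST 0 = 0"

definition next_ok :: "nat \<Rightarrow> (nat \<Rightarrow> nat \<Rightarrow> int) \<Rightarrow> bool" where
  "next_ok u a \<longleftrightarrow> (\<forall>x\<in>insert 0 (High u). \<exists>y. a fNEXT x = int y \<and> succ_in (insert (n + 1) (High u)) x y)"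

definition prev_ok :: "nat \<Rightarrow> (nat \<Rightarrow> nat \<Rightarrow> int) \<Rightarrow> bool" where
  "prev_ok u a \<longleftrightarrow> (\<forall>y\<in>insert (n + 1) (Low u). \<exists>z. a fPREV y = int z \<and> pred_in (insert 0 (Low u)) y z)"

definition row_ok :: "nat \<Rightarrow> (nat \<Rightarrow> nat \<Rightarrow> int) \<Rightarrow> bool" where
  "row_ok u a \<longleftrightarrow> (\<forall>y\<in>Low u. a fROW y = int (row (val y)))"

text \<open>Invariant of the sweep before \<open>u\<close> is processed; \<open>high_done\<close>
  and \<open>scan_done\<close> describe the stages in between. With bound 0, \<open>scanned\<close>
  claims nothing about stale positions.\<close>

definition ready :: "nat \<Rightarrow> (nat \<Rightarrow> int) \<Rightarrow> (nat \<Rightarrow> nat \<Rightarrow> int) \<Rightarrow> bool" where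
  "ready u v a \<longleftrightarrow> consts_ok u v \<and> input_ok a \<and> next_ok u a \<and> prev_ok u a \<and> row_ok u a \<and> scanned u 0 a"

definition high_done :: "nat \<Rightarrow> (nat \<Rightarrow> int) \<Rightarrow> (nat \<Rightarrow> nat \<Rightarrow> int) \<Rightarrow> bool" where
  "high_done u v a \<longleftrightarrow> consts_ok u v \<and> input_ok a \<and> next_ok u a \<and> prev_ok u a \<and>
     row_ok (Suc u) a \<and> scanned u (ps u) a \<and> v vPOS = int (ps u) \<and>
     (\<exists>q. v vPREV = int q \<and> q \<in> insert 0 (High u) \<and> succ_in (insert (n + 1) (High u)) q (ps u))"

definition scan_done :: "nat \<Rightarrow> (nat \<Rightarrow> int) \<Rightarrow> (nat \<Rightarrow> nat \<Rightarrow> int) \<Rightarrow> bool" where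
  "scan_done u v a \<longleftrightarrow> consts_ok u v \<and> input_ok a \<and> next_ok (Suc u) a \<and> prev_ok u a \<and>
     row_ok (Suc u) a \<and> scanned u (ps u) a \<and> v vPOS = int (ps u) \<and>
     opt a u (ps u) (v vBEST) \<and> a fBEST (ps u) = v vBEST \<and>
     (\<exists>y z. v vY = int y \<and> v vZ = int z \<and> y \<in> insert (n + 1) (Low u) \<and>
       pred_in (insert 0 (Low u)) y z \<and> z < ps u \<and> ps u < y \<and>
       (\<forall>w\<in>Low u. y \<le> w \<longrightarrow> (\<exists>w'. a fUP w = int w' \<and> succ_in (insert (n + 1) (Low u)) w w')))"

lemma scanned_upd [simp]:
  assumes "f < 7 \<or> f = 8 \<or> 12 < f"
  shows "scanned u x (a(f := g)) \<longleftrightarrow> scanned u x a"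
proof -
  have "f < 9 \<or> 12 < f" "f \<noteq> fBEST" "f \<noteq> fLEN" using assms by auto
  then show ?thesis by (simp add: scanned_def)
qed

lemma scanned_cong:
  assumes "same_except S a a'" "S \<inter> {7, 9, 10, 11, 12} = {}"
  shows "scanned u x a' \<longleftrightarrow> scanned u x a"
proof -
  have "a' fBEST = a fBEST" "a' fLEN = a fLEN" using assms by (auto simp: same_except_def)
  moreover have "S \<inter> {9, 10, 11, 12} = {}" using assms(2) by auto
  ultimately show ?thesis unfolding scanned_def node_def
    by (simp add: opt_cong[OF assms(1)] rep_cong[OF assms(1)])
qed

lemma consts_ok_cong:
  "same_except S v v' \<Longrightarrow> S \<inter> {4, 5, 6, 7, 8, 9, 18, 20, 21} = {} \<Longrightarrow> consts_ok u v' \<longleftrightarrow> consts_ok u v"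
  by (auto simp: consts_ok_def same_except_def)

lemma row_ok_Suc:
  assumes "1 \<le> u" "u \<le> n" "row_ok u a"
  shows "row_ok (Suc u) (a(fROW := (a fROW)(ps u := int (row u))))"
  using assms Low_Suc[OF assms(1,2)] val_ps by (auto simp: row_ok_def)

lemma wp_high_part:
  assumes u: "1 \<le> u" "u \<le> n" and rd: "ready u v a"
  shows "wp B high_part (\<lambda>(v', a', r', t'). high_done u v' a' \<and>
    t' \<le> t + 5 + 20 * card {y \<in> High u. y < ps u}) (v, a, r, t)"
proof -
  define v1 where "v1 = v(vPOS := int (ps u), vPREV := 0, vX := a fNEXT 0)"
  define t1 where "t1 = Suc (Suc (Suc (Suc t)))"
  define a1 where "a1 = a(fROW := (a fROW)(ps u := int (row u)))"
  have c: "consts_ok u v" "input_ok a" "next_ok u a" "prev_ok u a" "row_ok u a" "scanned u 0 a"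
    using rd by (auto simp: ready_def)
  have c1: "consts_ok u v1" using c(1) by (simp add: v1_def consts_ok_def)
  have i1: "input_ok a1" "next_ok u a1" "prev_ok u a1" "scanned u 0 a1"
    using c by (auto simp: a1_def input_ok_def next_ok_def prev_ok_def)
  have r1: "row_ok (Suc u) a1" unfolding a1_def by (rule row_ok_Suc[OF u c(5)])
  have "a fPOS u = int (ps u)" using c(2) u by (simp add: input_ok_def)
  then have "wp B high_part Q (v, a, r, t)
      \<longleftrightarrow> wp B (Loop (Neq vX vPOS) high_body) Q (v1, a1, r, t1)" for Q
    using c(1) unfolding high_part_def
    by (simp add: consts_ok_def v1_def a1_def t1_def fun_upd_twist)
  moreover have "wp B (Loop (Neq vX vPOS) high_body) (\<lambda>(v', a', r', t'). high_done u v' a' \<and>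
    t' \<le> t + 5 + 20 * card {y \<in> High u. y < ps u}) (v1, a1, r, t1)"
  proof (rule wp_mono[OF wp_high[OF u]])
    show "v1 vU = int u" "v1 vROW = int (row u)" "v1 vONE = 1" "v1 vZERO = 0"
      using c1 by (auto simp: consts_ok_def)
    show "v1 vPOS = int (ps u)" "v1 vPREV = 0" "v1 vX = a1 fNEXT 0"
      by (auto simp: v1_def a1_def)
    show "scanned u 0 a1" "a1 fBEST 0 = 0" "\<forall>x\<in>{1..n}. a1 fVAL x = int (val x)"
      "\<forall>x\<in>insert 0 (High u). \<exists>y. a1 fNEXT x = int y \<and> succ_in (insert (n + 1) (High u)) x y"
      using i1 by (simp_all add: input_ok_def next_ok_def)
  next
    fix s' :: state
    obtain v' a' r' t' where s': "s' = (v', a', r', t')" by (cases s')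
    assume "case s' of (v', a', r', t') \<Rightarrow> \<exists>q. same_except {vT, vBEST, vK, vPREV, vX} v1 v' \<and>
      same_except {fBEST, fLINK, fLEN, fLO, fHI} a1 a' \<and> r' = r \<and> v' vPREV = int q \<and>
      q \<in> insert 0 (High u) \<and> succ_in (insert (n + 1) (High u)) q (ps u) \<and> a' fBEST 0 = 0 \<and>
      scanned u (ps u) a' \<and> t' \<le> t1 + 1 + 20 * card {y \<in> High u. y < ps u}"
    then obtain q where q: "same_except {vT, vBEST, vK, vPREV, vX} v1 v'"
      "same_except {fBEST, fLINK, fLEN, fLO, fHI} a1 a'" "v' vPREV = int q"
      "q \<in> insert 0 (High u)" "succ_in (insert (n + 1) (High u)) q (ps u)" "a' fBEST 0 = 0"
      "scanned u (ps u) a'" "t' \<le> t1 + 1 + 20 * card {y \<in> High u. y < ps u}"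
      unfolding s' by auto
    have "consts_ok u v'" using consts_ok_cong[OF q(1)] c1 by simp
    moreover have "input_ok a'" "next_ok u a'" "prev_ok u a'" "row_ok (Suc u) a'"
      using i1 r1 q(2,6) by (auto simp: input_ok_def next_ok_def prev_ok_def row_ok_def same_except_def)
    moreover have "v' vPOS = int (ps u)" using q(1) by (auto simp: same_except_def v1_def)
    ultimately show "case s' of (v', a', r', t') \<Rightarrow> high_done u v' a' \<and>
      t' \<le> t + 5 + 20 * card {y \<in> High u. y < ps u}"
      unfolding s' prod.case high_done_def using q(3-8) by (auto simp: t1_def)
  qed
  ultimately show ?thesis by simp
qed

lemma succ_in_le: "succ_in S x y \<Longrightarrow> z \<in> S \<Longrightarrow> x < z \<Longrightarrow> y \<le> z"
  by (simp add: succ_in_def)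

lemma succ_in_mem: "succ_in S x y \<Longrightarrow> y \<in> S" and succ_in_less: "succ_in S x y \<Longrightarrow> x < y"
  by (simp_all add: succ_in_def)

lemma succ_in_delete:
  assumes "succ_in S x y" "y \<noteq> c"
  shows "succ_in (S - {c}) x y"
  using assms by (simp add: succ_in_def)

lemma succ_in_skip:
  assumes "succ_in S x c" "succ_in S c y"
  shows "succ_in (S - {c}) x y"
  unfolding succ_in_def
proof (intro conjI ballI impI)
  show "y \<in> S - {c}" using succ_in_mem[OF assms(2)] succ_in_less[OF assms(2)] by simp
  show "x < y" using succ_in_less[OF assms(1)] succ_in_less[OF assms(2)] by simp
  fix z assume z: "z \<in> S - {c}" "x < z"
  then have "c < z" using succ_in_le[OF assms(1), of z] by simp
  then show "y \<le> z" using succ_in_le[OF assms(2), of z] z(1) by simp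
qed

text \<open>Only one pointer leads to an element that is deleted, so redirecting the pointer of its
  predecessor repairs the list.\<close>

lemma succ_in_inj:
  assumes "succ_in S x y" "succ_in S x' y" "x = 0 \<or> x \<in> S" "x' = 0 \<or> x' \<in> S"
  shows "x = x'"
proof (rule ccontr)
  assume "x \<noteq> x'"
  then consider "x < x'" | "x' < x" by linarith
  then show False
  proof cases
    case 1
    then have "y \<le> x'" using succ_in_le[OF assms(1), of x'] assms(4) by simp
    then show False using succ_in_less[OF assms(2)] by simp
  next
    case 2
    then have "y \<le> x" using succ_in_le[OF assms(2), of x] assms(3) by simp
    then show False using succ_in_less[OF assms(1)] by simp
  qed
qed

lemma next_ok_Suc:
  assumes u: "1 \<le> u" "u \<le> n" and nx: "next_ok u a"
    and q: "q \<in> insert 0 (High u)" "succ_in (insert (n + 1) (High u)) q (ps u)"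
  shows "next_ok (Suc u) (a(fNEXT := (a fNEXT)(q := a fNEXT (ps u))))"
  unfolding next_ok_def
proof
  have pr: "1 \<le> ps u" "ps u \<le> n" using ps_range u by auto
  note H = High_Suc[OF u]
  have S: "insert (n + 1) (High (Suc u)) = insert (n + 1) (High u) - {ps u}"
    using pr by (simp add: H(2) insert_Diff_if)
  fix x assume x: "x \<in> insert 0 (High (Suc u))"
  show "\<exists>y. (a(fNEXT := (a fNEXT)(q := a fNEXT (ps u)))) fNEXT x = int y \<and>
    succ_in (insert (n + 1) (High (Suc u))) x y"
  proof (cases "x = q")
    case True
    obtain y where y: "a fNEXT (ps u) = int y" "succ_in (insert (n + 1) (High u)) (ps u) y"
      using bspec[OF nx[unfolded next_ok_def], of "ps u"] H(1) by auto
    then show ?thesis using succ_in_skip[OF q(2) y(2)] True unfolding S by simp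
  next
    case False
    have xH: "x = 0 \<or> x \<in> High u" using x H(2) by auto
    obtain y where y: "a fNEXT x = int y" "succ_in (insert (n + 1) (High u)) x y"
      using bspec[OF nx[unfolded next_ok_def], of x] xH by auto
    have "y \<noteq> ps u"
    proof
      assume "y = ps u"
      with y(2) have "succ_in (insert (n + 1) (High u)) x (ps u)" by simp
      from succ_in_inj[OF this q(2)] have "x = q" using xH q(1) by auto
      then show False using False by simp
    qed
    then show ?thesis using succ_in_delete[OF y(2)] False y(1) unfolding S by simp
  qed
qed

lemma wp_scan_part:
  assumes u: "1 \<le> u" "u \<le> n" and hd: "high_done u v a"
  shows "wp B scan_part (\<lambda>(v', a', r', t'). scan_done u v' a' \<and>
    t' \<le> t + 8 + 5 * card {w \<in> Low u. ps u < w}) (v, a, r, t)"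
proof -
  have pr: "1 \<le> ps u" "ps u \<le> n" using ps_range u by auto
  have c: "consts_ok u v" "input_ok a" "next_ok u a" "prev_ok u a" "row_ok (Suc u) a"
    "scanned u (ps u) a" "v vPOS = int (ps u)"
    using hd by (auto simp: high_done_def)
  obtain q where q: "v vPREV = int q" "q \<in> insert 0 (High u)"
    "succ_in (insert (n + 1) (High u)) q (ps u)"
    using hd by (auto simp: high_done_def)
  define b where "b = a fBEST (ps u - 1)"
  define v1 where "v1 = v(vT := int (ps u) - 1, vBEST := b, vY := int (n + 1), vZ := a fPREV (n + 1))"
  define t1 where "t1 = Suc (Suc (Suc (Suc (Suc (Suc (Suc t))))))"
  define a1 where "a1 = a(fNEXT := (a fNEXT)(q := a fNEXT (ps u)), fBEST := (a fBEST)(ps u := b))"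
  have c1: "consts_ok u v1" using c(1) by (simp add: v1_def consts_ok_def)
  \<comment> \<open>\<open>scanned\<close> speaks of positions before \<open>ps u\<close> and of
    \<open>Low u\<close>; the overwritten cell belongs to neither.\<close>
  have sc1: "scanned u (ps u) a1"
    using c(6) Low_Suc(1)[OF u] pr unfolding scanned_def a1_def by auto
  have i1: "input_ok a1" "prev_ok u a1" "row_ok (Suc u) a1"
    using c pr by (auto simp: a1_def input_ok_def prev_ok_def row_ok_def)
  have n1: "next_ok (Suc u) a1"
    using next_ok_Suc[OF u c(3) q(2,3)] by (simp add: a1_def next_ok_def)
  have "opt a (u - 1) (ps u - 1) b" using c(6) pr unfolding scanned_def b_def by simp
  then have "opt a u (ps u) b" using opt_move[of a "u - 1" "ps u - 1" b u "ps u"] F_point[OF u] by simp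
  then have o1: "opt a1 u (ps u) b" by (simp add: a1_def)
  have "wp B scan_part Q (v, a, r, t)
      \<longleftrightarrow> wp B (Loop (Lt vPOS vZ) scan_body) Q (v1, a1, r, t1)" for Q
    using c(1,7) q(1) pr unfolding scan_part_def
    by (simp add: consts_ok_def v1_def a1_def t1_def b_def fun_upd_twist nat_int_add
        del: of_nat_Suc of_nat_add)
  moreover have "wp B (Loop (Lt vPOS vZ) scan_body) (\<lambda>(v', a', r', t'). scan_done u v' a' \<and>
    t' \<le> t + 8 + 5 * card {w \<in> Low u. ps u < w}) (v1, a1, r, t1)"
  proof (rule wp_mono[OF wp_scan[OF u]])
    show "v1 vZERO = 0" using c1 by (simp add: consts_ok_def)
    show "v1 vPOS = int (ps u)" "v1 vY = int (n + 1)" "v1 vZ = a1 fPREV (n + 1)"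
      using c(7) by (auto simp: v1_def a1_def)
    show "\<forall>y\<in>insert (n + 1) (Low u). \<exists>z. a1 fPREV y = int z \<and> pred_in (insert 0 (Low u)) y z"
      using i1(2) by (simp add: prev_ok_def)
  next
    fix s' :: state
    obtain v' a' r' t' where s': "s' = (v', a', r', t')" by (cases s')
    assume "case s' of (v', a', r', t') \<Rightarrow> \<exists>y z. same_except {vY, vZ} v1 v' \<and>
      same_except {fUP} a1 a' \<and> r' = r \<and>
      v' vY = int y \<and> v' vZ = int z \<and> y \<in> insert (n + 1) (Low u) \<and>
      pred_in (insert 0 (Low u)) y z \<and> z < ps u \<and> ps u < y \<and>
      (\<forall>w\<in>Low u. y \<le> w \<longrightarrow> (\<exists>w'. a' fUP w = int w' \<and> succ_in (insert (n + 1) (Low u)) w w')) \<and>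
      t' \<le> t1 + 1 + 5 * card {w \<in> Low u. ps u < w}"
    then obtain y z where y: "same_except {vY, vZ} v1 v'" "same_except {fUP} a1 a'"
      "v' vY = int y" "v' vZ = int z" "y \<in> insert (n + 1) (Low u)"
      "pred_in (insert 0 (Low u)) y z" "z < ps u" "ps u < y"
      "\<forall>w\<in>Low u. y \<le> w \<longrightarrow> (\<exists>w'. a' fUP w = int w' \<and> succ_in (insert (n + 1) (Low u)) w w')"
      "t' \<le> t1 + 1 + 5 * card {w \<in> Low u. ps u < w}"
      unfolding s' prod.case by (elim exE conjE)
    have "consts_ok u v'" using consts_ok_cong[OF y(1)] c1 by simp
    moreover have "input_ok a'" "next_ok (Suc u) a'" "prev_ok u a'" "row_ok (Suc u) a'"
      using i1 n1 y(2) by (auto simp: input_ok_def next_ok_def prev_ok_def row_ok_def same_except_def)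
    moreover have "v' vPOS = int (ps u)" "v' vBEST = b" using y(1) c(7) by (auto simp: same_except_def v1_def)
    moreover have "a' fBEST (ps u) = b" using y(2) by (auto simp: same_except_def a1_def)
    moreover have "opt a' u (ps u) b" using o1 opt_cong[OF y(2)] by simp
    moreover have "scanned u (ps u) a'" using sc1 scanned_cong[OF y(2)] by simp
    ultimately have "scan_done u v' a'"
      unfolding scan_done_def
      by (intro conjI exI[of _ y] exI[of _ z] y(3-9)) simp_all
    then show "case s' of (v', a', r', t') \<Rightarrow> scan_done u v' a' \<and>
      t' \<le> t + 8 + 5 * card {w \<in> Low u. ps u < w}"
      unfolding s' prod.case using y(10) by (simp add: t1_def)
  qed
  ultimately show ?thesis by simp
qed

text \<open>Only the new element and its right neighbour \<open>y\<close> get new predecessors: any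
  other element to the right of \<open>ps u\<close> lies beyond \<open>y\<close>, so its predecessor
  is at least \<open>y\<close>.\<close>

lemma prev_ok_Suc:
  assumes u: "1 \<le> u" "u \<le> n" and pv: "prev_ok u a"
    and y: "y \<in> insert (n + 1) (Low u)" "pred_in (insert 0 (Low u)) y z" "z < ps u" "ps u < y"
  shows "prev_ok (Suc u) (a(fPREV := (a fPREV)(ps u := int z, y := int (ps u))))"
  unfolding prev_ok_def
proof
  have pr: "1 \<le> ps u" "ps u \<le> n" using ps_range u by auto
  note L = Low_Suc[OF u]
  fix w assume w: "w \<in> insert (n + 1) (Low (Suc u))"
  show "\<exists>z'. (a(fPREV := (a fPREV)(ps u := int z, y := int (ps u)))) fPREV w = int z' \<and>
    pred_in (insert 0 (Low (Suc u))) w z'"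
  proof (cases "w = y \<or> w = ps u")
    case True
    then show ?thesis
    proof
      assume wy: "w = y"
      have "pred_in (insert 0 (Low (Suc u))) y (ps u)"
        using y unfolding pred_in_def L(2) by fastforce
      then show ?thesis using wy by auto
    next
      assume wp: "w = ps u"
      have "pred_in (insert 0 (Low (Suc u))) (ps u) z"
        using y unfolding pred_in_def L(2) by fastforce
      then show ?thesis using wp y(4) by auto
    qed
  next
    case False
    then have wL: "w \<in> insert (n + 1) (Low u)" using w L(2) by auto
    obtain z' where z': "a fPREV w = int z'" "pred_in (insert 0 (Low u)) w z'"
      using pv wL unfolding prev_ok_def by auto
    have "ps u \<le> z'" if "ps u < w"
    proof -
      consider "w < y" | "y < w" using False by linarith
      then show ?thesis
      proof cases
        case 1
        then have "w \<in> Low u" using wL y(1) by (auto simp: Low_def)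
        then have "w \<le> z" using y(2) 1 by (auto simp: pred_in_def)
        then show ?thesis using y(3) that by simp
      next
        case 2
        then have "y \<in> Low u" using wL y(1) by (auto simp: Low_def)
        then have "y \<le> z'" using z'(2) 2 by (auto simp: pred_in_def)
        then show ?thesis using y(4) by simp
      qed
    qed
    then have "pred_in (insert 0 (Low (Suc u))) w z'"
      using z'(2) unfolding pred_in_def L(2) by auto
    then show ?thesis using False z'(1) by auto
  qed
qed

lemma wp_low_part:
  assumes u: "1 \<le> u" "u \<le> n" and sd: "scan_done u v a"
  shows "wp B low_part (\<lambda>(v', a', r', t'). ready (Suc u) v' a' \<and>
    t' \<le> t + 5 + 25 * card {w \<in> Low u. ps u < w}) (v, a, r, t)"
proof -
  have pr: "1 \<le> ps u" "ps u \<le> n" using ps_range u by auto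
  note L = Low_Suc[OF u]
  have c: "consts_ok u v" "input_ok a" "next_ok (Suc u) a" "prev_ok u a" "row_ok (Suc u) a"
    "scanned u (ps u) a" "v vPOS = int (ps u)" "opt a u (ps u) (v vBEST)" "a fBEST (ps u) = v vBEST"
    using sd by (auto simp: scan_done_def)
  obtain y z where y: "v vY = int y" "v vZ = int z" "y \<in> insert (n + 1) (Low u)"
      "pred_in (insert 0 (Low u)) y z" "z < ps u" "ps u < y"
      "\<forall>w\<in>Low u. y \<le> w \<longrightarrow> (\<exists>w'. a fUP w = int w' \<and> succ_in (insert (n + 1) (Low u)) w w')"
    using sd unfolding scan_done_def by (elim exE conjE)
  define a1 where "a1 = a(fPREV := (a fPREV)(ps u := int z, y := int (ps u)))"
  have i1: "input_ok a1" "next_ok (Suc u) a1" "row_ok (Suc u) a1" "scanned u (ps u) a1"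
    using c by (auto simp: a1_def input_ok_def next_ok_def row_ok_def)
  have p1: "prev_ok (Suc u) a1" unfolding a1_def by (rule prev_ok_Suc[OF u c(4) y(3-6)])
  have y0: "y \<le> w" if "w \<in> Low u" "ps u < w" for w
  proof (rule ccontr)
    assume "\<not> y \<le> w"
    then have "w \<le> z" using y(4) that by (auto simp: pred_in_def)
    then show False using y(5) that by simp
  qed
  have "wp B low_part Q (v, a, r, t)
      \<longleftrightarrow> wp B (Loop (Neq vY vSTOP) low_body) (wp B (At (Pls vU vU vONE) ;; At (Pls vROW vROW vWIDTH)) Q)
        (v, a1, r, t + 2)" for Q
    using c(1,7) y(1,2) unfolding low_part_def by (simp add: a1_def)
  moreover have "wp B (Loop (Neq vY vSTOP) low_body)
    (wp B (At (Pls vU vU vONE) ;; At (Pls vROW vROW vWIDTH))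
      (\<lambda>(v', a', r', t'). ready (Suc u) v' a' \<and> t' \<le> t + 5 + 25 * card {w \<in> Low u. ps u < w}))
    (v, a1, r, t + 2)"
  proof (rule wp_mono[OF wp_low[OF u]])
    show "v vPOS = int (ps u)" "v vZERO = 0" "v vSTOP = int (n + 1)" "v vY = int y"
      using c(1,7) y(1) by (auto simp: consts_ok_def)
    show "y \<in> insert (n + 1) (Low u)" "ps u < y" "\<forall>w\<in>Low u. ps u < w \<longrightarrow> y \<le> w" using y y0 by auto
    show "\<forall>w\<in>Low u. y \<le> w \<longrightarrow> (\<exists>w'. a1 fUP w = int w' \<and> succ_in (insert (n + 1) (Low u)) w w')"
      using y(7) by (simp add: a1_def)
    show "a1 fLEN 0 = 0" using i1(4) by (simp add: scanned_def)
    show "opt a1 u (ps u) (v vBEST)" "a1 fBEST (ps u) = v vBEST" using c(8,9) by (auto simp: a1_def)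
    show "\<forall>y\<in>Low u. opt a1 (u - 1) y (a1 fBEST y)" "\<forall>w. cross w u \<longrightarrow> node a1 w u"
      using i1(4) unfolding scanned_def cross_def by simp_all
    show "\<forall>y\<in>Low u. a1 fROW y = int (row (val y))" using i1(3) L(2) by (simp add: row_ok_def)
  next
    fix s' :: state
    obtain v' a' r' t' where s': "s' = (v', a', r', t')" by (cases s')
    assume "case s' of (v', a', r', t') \<Rightarrow> same_except {vL, vD, vL2, vBEST, vK, vY} v v' \<and>
      same_except {fBEST} a1 a' \<and> r' = r \<and>
      a' fBEST 0 = a1 fBEST 0 \<and> (\<forall>y\<in>insert (ps u) (Low u). opt a' u y (a' fBEST y)) \<and>
      t' \<le> t + 2 + 1 + 25 * card {w \<in> Low u. ps u < w}"
    then have q: "same_except {vL, vD, vL2, vBEST, vK, vY} v v'" "same_except {fBEST} a1 a'"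
      "a' fBEST 0 = a1 fBEST 0" "\<forall>y\<in>insert (ps u) (Low u). opt a' u y (a' fBEST y)"
      "t' \<le> t + 2 + 1 + 25 * card {w \<in> Low u. ps u < w}"
      unfolding s' by simp_all
    have c': "consts_ok u v'" using consts_ok_cong[OF q(1)] c by simp
    have "input_ok a'" "next_ok (Suc u) a'" "prev_ok (Suc u) a'" "row_ok (Suc u) a'"
      using i1 p1 q(2,3) by (auto simp: input_ok_def next_ok_def prev_ok_def row_ok_def same_except_def)
    moreover have "scanned (Suc u) 0 a'"
      unfolding scanned_def
    proof (intro conjI allI impI)
      show "a' fLEN 0 = 0" using i1(4) q(2) by (auto simp: scanned_def same_except_def)
      show "opt a' (Suc u - 1) w (a' fBEST w)" if "w < 0 \<or> w \<in> Low (Suc u)" for w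
        using bspec[OF q(4), of w] that unfolding L(2) by simp
      show "node a' w w'" if "cross w w' \<and> (w < Suc u \<or> w = Suc u \<and> ps w' < 0)" for w w'
      proof -
        have "w < u \<or> w = u" using that by auto
        \<comment> \<open>Every larger value crossing \<open>u\<close> stands to the left of it, so
          the nodes built before reaching \<open>ps u\<close> complete row \<open>u\<close>.\<close>
        then have "w < u \<or> w = u \<and> ps w' < ps u" using that by (auto simp: cross_def)
        then have "node a1 w w'" using i1(4) that unfolding scanned_def by simp
        then show ?thesis unfolding node_def by (simp add: rep_cong[OF q(2)])
      qed
    qed
    moreover have "consts_ok (Suc u) (v'(vU := v' vU + v' vONE, vROW := v' vROW + v' vWIDTH))"
      using c' by (simp add: consts_ok_def row_def)
    ultimately have "ready (Suc u) (v'(vU := v' vU + v' vONE, vROW := v' vROW + v' vWIDTH)) a'"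
      unfolding ready_def by blast
    then show "wp B (At (Pls vU vU vONE) ;; At (Pls vROW vROW vWIDTH))
      (\<lambda>(v', a', r', t'). ready (Suc u) v' a' \<and> t' \<le> t + 5 + 25 * card {w \<in> Low u. ps u < w}) s'"
      unfolding s' using q(5) by simp
  qed
  ultimately show ?thesis by simp
qed

definition degree :: "nat \<Rightarrow> nat" where
  "degree u = card {y \<in> High u. y < ps u} + card {w \<in> Low u. ps u < w}"

text \<open>18 is the sum of the three fixed costs. 30 covers the 20 ticks per larger entry on the
  left as well as the 5 + 25 per smaller entry on the right, which is visited once in each
  direction.\<close>

lemma wp_parts:
  assumes u: "1 \<le> u" "u \<le> n" and rd: "ready u v a"
  shows "wp B (high_part ;; scan_part ;; low_part) (\<lambda>(v', a', r', t'). ready (Suc u) v' a' \<and>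
    t' \<le> t + 18 + 30 * degree u) (v, a, r, t)"
  unfolding wp_Sq
proof (rule wp_mono[OF wp_high_part[OF u rd]])
  fix s1 :: state
  obtain v1 a1 r1 t1 where s1: "s1 = (v1, a1, r1, t1)" by (cases s1)
  assume "case s1 of (v', a', r', t') \<Rightarrow> high_done u v' a' \<and> t' \<le> t + 5 + 20 * card {y \<in> High u. y < ps u}"
  then have h1: "high_done u v1 a1" "t1 \<le> t + 5 + 20 * card {y \<in> High u. y < ps u}"
    unfolding s1 by auto
  show "wp B scan_part (wp B low_part (\<lambda>(v', a', r', t'). ready (Suc u) v' a' \<and>
    t' \<le> t + 18 + 30 * degree u)) s1"
    unfolding s1
  proof (rule wp_mono[OF wp_scan_part[OF u h1(1)]])
    fix s2 :: state
    obtain v2 a2 r2 t2 where s2: "s2 = (v2, a2, r2, t2)" by (cases s2)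
    assume "case s2 of (v', a', r', t') \<Rightarrow> scan_done u v' a' \<and> t' \<le> t1 + 8 + 5 * card {w \<in> Low u. ps u < w}"
    then have h2: "scan_done u v2 a2" "t2 \<le> t1 + 8 + 5 * card {w \<in> Low u. ps u < w}"
      unfolding s2 by auto
    show "wp B low_part (\<lambda>(v', a', r', t'). ready (Suc u) v' a' \<and> t' \<le> t + 18 + 30 * degree u) s2"
      unfolding s2
    proof (rule wp_mono[OF wp_low_part[OF u h2(1)]])
      fix s3 :: state
      assume "case s3 of (v', a', r', t') \<Rightarrow> ready (Suc u) v' a' \<and> t' \<le> t2 + 5 + 25 * card {w \<in> Low u. ps u < w}"
      then show "case s3 of (v', a', r', t') \<Rightarrow> ready (Suc u) v' a' \<and> t' \<le> t + 18 + 30 * degree u"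
        using h1(2) h2(2) unfolding degree_def by (auto split: prod.splits)
    qed
  qed
qed

text \<open>Handshake argument: \<open>val\<close> maps the visited positions injectively to
  neighbours, and each edge is seen once from its lower and once from its upper end.\<close>

lemma sum_degree: "(\<Sum>u\<in>{1..n}. degree u) \<le> 2 * card (perm_edges n p)"
proof -
  have fin: "finite {v. cross u v}" "finite {w. cross w u}" for u
    by (rule finite_subset[of _ "{..n}"]; auto simp: cross_def)+
  have inj: "inj_on val S" if "S \<subseteq> {1..n}" for S
    using that ps_val by (intro inj_on_inverseI[of _ ps]) auto
  have hi: "card {y \<in> High u. y < ps u} \<le> card {v. cross u v}" if u: "u \<in> {1..n}" for u
  proof (rule card_inj_on_le[OF inj _ fin(1)])
    show "val ` {y \<in> High u. y < ps u} \<subseteq> {v. cross u v}"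
    proof
      fix v assume "v \<in> val ` {y \<in> High u. y < ps u}"
      then obtain y where y: "v = val y" "1 \<le> y" "y \<le> n" "u \<le> val y" "y < ps u"
        by (auto simp: High_def)
      then have "val y \<noteq> u" using val_eq_iff[of y u] u by auto
      then show "v \<in> {v. cross u v}" using y val_range[of y] ps_val[of y] u by (auto simp: cross_def)
    qed
  qed (auto simp: High_def)
  have lo: "card {w \<in> Low u. ps u < w} \<le> card {w. cross w u}" if u: "u \<in> {1..n}" for u
  proof (rule card_inj_on_le[OF inj _ fin(2)])
    show "val ` {w \<in> Low u. ps u < w} \<subseteq> {w. cross w u}"
    proof
      fix v assume "v \<in> val ` {w \<in> Low u. ps u < w}"
      then obtain y where y: "v = val y" "1 \<le> y" "y \<le> n" "val y < u" "ps u < y"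
        by (auto simp: Low_def)
      then show "v \<in> {v. cross v u}" using val_range[of y] ps_val[of y] u by (auto simp: cross_def)
    qed
  qed (auto simp: Low_def)
  have "{(u, v). cross u v} = Sigma {1..n} (\<lambda>u. {v. cross u v})" by (auto simp: cross_def)
  then have s1: "card {(u, v). cross u v} = (\<Sum>u\<in>{1..n}. card {v. cross u v})"
    using fin by simp
  have "prod.swap ` {(u, v). cross u v} = Sigma {1..n} (\<lambda>u. {w. cross w u})"
    by (auto simp: cross_def image_iff)
  then have s2: "card {(u, v). cross u v} = (\<Sum>u\<in>{1..n}. card {w. cross w u})"
    using fin card_image[of prod.swap "{(u, v). cross u v}"] by simp
  have "(\<Sum>u\<in>{1..n}. degree u) \<le> (\<Sum>u\<in>{1..n}. card {v. cross u v} + card {w. cross w u})"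
    unfolding degree_def by (intro sum_mono add_mono hi lo)
  then show ?thesis unfolding sum.distrib card_edges using s1 s2 by simp
qed

end


section \<open>Reading the input and writing the output\<close>

definition count_part :: com where
  "count_part = At (Cst vONE 1) ;; At (Cst vEIGHT 8) ;;
     Loop (Neq vT vBASE) (At (Pls vT vT vEIGHT) ;; At (Pls vN vN vONE)) ;;
     At (Pls vSTOP vN vONE) ;; At (Pls vWIDTH vSTOP vONE)"

text \<open>Variables 0 to 2 hold the saved input registers 1 to 3; the rest of the input is still
  in place. If \<open>n < 3\<close>, indices above \<open>n\<close> are filled as well, but the
  invariants speak of positions up to \<open>n\<close> only.\<close>

definition copy_part :: com where
  "copy_part = At (St fVAL vONE 0) ;; At (Cst vT 2) ;; At (St fVAL vT 1) ;; At (Cst vT 3) ;;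
     At (St fVAL vT 2) ;; At (Cst vT 4) ;;
     Loop (Lt vT vSTOP) (At (RLd vX vT) ;; At (St fVAL vT vX) ;; At (Pls vT vT vONE))"

text \<open>Inverts the permutation and puts all positions into the forward list. The empty backward
  list is already there: in blank memory \<open>n + 1\<close> points to the sentinel 0.\<close>

definition link_part :: com where
  "link_part = At (Cst vT 1) ;; At (Cst vPREV 0) ;;
     Loop (Lt vT vSTOP) (At (Ld vX fVAL vT) ;; At (St fPOS vX vT) ;; At (St fNEXT vPREV vT) ;;
       At (Pls vPREV vT vZERO) ;; At (Pls vT vT vONE)) ;;
     At (St fNEXT vPREV vSTOP) ;; At (Cst vU 1) ;; At (Pls vROW vWIDTH vZERO)"

text \<open>After the sweep no position is stale, so the chain stored at \<open>n\<close> is optimal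
  for the whole permutation. It is buffered in \<open>fOUT\<close> because the first output cells
  are registers that compiled code still uses.\<close>

definition walk_part :: com where
  "walk_part = At (Ld vK fBEST vN) ;;
     Loop (Neq vK vZERO) (At (Pls vI vI vONE) ;; At (Ld vT fLO vK) ;; At (St fOUT vI vT) ;;
       At (Pls vI vI vONE) ;; At (Ld vT fHI vK) ;; At (St fOUT vI vT) ;;
       At (Pls vCOUNT vCOUNT vONE) ;; At (Ld vK fLINK vK))"

text \<open>Output cells from 4 on are raw memory. The contents of registers 1, 2, 3 and 0 are left
  in variables 0, 1, 2 and 3 for the epilogue.\<close>

definition out_part :: com where
  "out_part = At (Pls vY vI vONE) ;; At (Cst vT 4) ;;
     Loop (Lt vT vY) (At (Ld vX fOUT vT) ;; At (RSt vT vX) ;; At (Pls vT vT vONE)) ;;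
     At (Ld 0 fOUT vONE) ;; At (Cst vT 2) ;; At (Ld 1 fOUT vT) ;; At (Cst vT 3) ;;
     At (Ld 2 fOUT vT) ;; At (Pls vBASE vCOUNT vZERO)"

definition main_loop :: com where
  "main_loop = Loop (Lt vU vSTOP) (high_part ;; scan_part ;; low_part)"

context permutation
begin

text \<open>Counting in steps of 8 replaces a division, which the machine does not offer.\<close>

lemma wp_count_part:
  assumes "v vBASE = int (8 * n)" "\<And>x. 4 \<le> x \<Longrightarrow> v x = 0"
  shows "wp B count_part (\<lambda>(v', a', r', t').
    v' = v(vONE := 1, vEIGHT := 8, vT := int (8 * n), vN := int n, vSTOP := int (n + 1),
      vWIDTH := int (n + 2)) \<and> a' = a \<and> r' = r \<and> t' \<le> t + 5 + 3 * n) (v, a, r, t)"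
proof -
  define v1 where "v1 = v(vONE := 1, vEIGHT := 8)"
  have z: "v vT = 0" "v vN = 0" using assms(2) by auto
  have "wp B (Loop (Neq vT vBASE) (At (Pls vT vT vEIGHT) ;; At (Pls vN vN vONE)))
    (wp B (At (Pls vSTOP vN vONE) ;; At (Pls vWIDTH vSTOP vONE)) (\<lambda>(v', a', r', t').
    v' = v(vONE := 1, vEIGHT := 8, vT := int (8 * n), vN := int n, vSTOP := int (n + 1),
      vWIDTH := int (n + 2)) \<and> a' = a \<and> r' = r \<and> t' \<le> t + 5 + 3 * n)) (v1, a, r, Suc (Suc t))"
  proof (rule wp_Loop[where k = 0 and f = "\<lambda>k. n - k" and I = "\<lambda>k (v', a', r', t').
      k \<le> n \<and> v' = v1(vT := int (8 * k), vN := int k) \<and> a' = a \<and> r' = r \<and> t' \<le> t + 2 + 3 * k"])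
    show "case (v1, a, r, Suc (Suc t)) of (v', a', r', t') \<Rightarrow> 0 \<le> n \<and>
      v' = v1(vT := int (8 * 0), vN := int 0) \<and> a' = a \<and> r' = r \<and> t' \<le> t + 2 + 3 * 0"
      using z by (auto simp: v1_def fun_eq_iff)
  next
    fix k s assume I: "case s of (v', a', r', t') \<Rightarrow> k \<le> n \<and> v' = v1(vT := int (8 * k), vN := int k) \<and>
      a' = a \<and> r' = r \<and> t' \<le> t + 2 + 3 * k" and h: "holds (Neq vT vBASE) s"
    obtain v' a' r' t' where s: "s = (v', a', r', t')" by (cases s)
    have q: "k \<le> n" "v' = v1(vT := int (8 * k), vN := int k)" "a' = a" "r' = r" "t' \<le> t + 2 + 3 * k"
      using I unfolding s by auto
    have "k \<noteq> n" using h assms(1) unfolding s q(2) by (auto simp: v1_def)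
    then have "k < n" using q(1) by simp
    then show "wp B (At (Pls vT vT vEIGHT) ;; At (Pls vN vN vONE))
      (\<lambda>s'. \<exists>k'. n - k' < n - k \<and> (case s' of (v', a', r', t') \<Rightarrow> k' \<le> n \<and>
        v' = v1(vT := int (8 * k'), vN := int k') \<and> a' = a \<and> r' = r \<and> t' \<le> t + 2 + 3 * k')) (tick s)"
      unfolding s q(2) using q(3-5)
      by (simp add: v1_def) (intro exI[of _ "Suc k"], auto simp: fun_eq_iff)
  next
    fix k s assume I: "case s of (v', a', r', t') \<Rightarrow> k \<le> n \<and> v' = v1(vT := int (8 * k), vN := int k) \<and>
      a' = a \<and> r' = r \<and> t' \<le> t + 2 + 3 * k" and h: "\<not> holds (Neq vT vBASE) s"
    obtain v' a' r' t' where s: "s = (v', a', r', t')" by (cases s)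
    have q: "k \<le> n" "v' = v1(vT := int (8 * k), vN := int k)" "a' = a" "r' = r" "t' \<le> t + 2 + 3 * k"
      using I unfolding s by auto
    have "k = n" using h assms(1) unfolding s q(2) by (auto simp: v1_def)
    then show "wp B (At (Pls vSTOP vN vONE) ;; At (Pls vWIDTH vSTOP vONE)) (\<lambda>(v', a', r', t').
      v' = v(vONE := 1, vEIGHT := 8, vT := int (8 * n), vN := int n, vSTOP := int (n + 1),
        vWIDTH := int (n + 2)) \<and> a' = a \<and> r' = r \<and> t' \<le> t + 5 + 3 * n) (tick s)"
      unfolding s q(2) using q(3-5) by (auto simp: v1_def fun_eq_iff)
  qed
  then show ?thesis unfolding count_part_def v1_def by simp
qed

lemma input_mem_val: "1 \<le> x \<Longrightarrow> x \<le> n \<Longrightarrow> input_mem p x = int (val x)"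
  using perm by (simp add: input_mem_def val_def is_perm_def)

lemma wp_copy_part:
  assumes n: "1 \<le> n" and v: "v vONE = 1" "v vSTOP = int (n + 1)"
    "v 0 = input_mem p 1" "v 1 = input_mem p 2" "v 2 = input_mem p 3"
    and r: "\<And>i. 4 \<le> i \<Longrightarrow> i < 8 * n \<Longrightarrow> r i = input_mem p i"
  shows "wp (8 * n) copy_part (\<lambda>(v', a', r', t').
    same_except {vT, vX} v v' \<and> same_except {fVAL} a a' \<and> r' = r \<and>
    (\<forall>x\<in>{1..n}. a' fVAL x = int (val x)) \<and> t' \<le> t + 7 + 4 * n) (v, a, r, t)"
proof -
  define v1 where "v1 = v(vT := 4)"
  define a1 where "a1 = a(fVAL := (a fVAL)(1 := input_mem p 1, 2 := input_mem p 2, 3 := input_mem p 3))"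
  \<comment> \<open>The alternative \<open>k = 4\<close> covers \<open>n < 3\<close>, where the
    cursor starts beyond \<open>n + 1\<close>.\<close>
  define I where "I = (\<lambda>k (v', a', r', t'). same_except {vT, vX} v v' \<and> same_except {fVAL} a a' \<and>
    r' = r \<and> v' vT = int k \<and> 4 \<le> k \<and> (\<forall>x. 1 \<le> x \<and> x < k \<longrightarrow> a' fVAL x = input_mem p x) \<and>
    t' \<le> t + 6 + 4 * (k - 4) \<and> (k = 4 \<or> k \<le> n + 1))"
  have "wp (8 * n) (Loop (Lt vT vSTOP) (At (RLd vX vT) ;; At (St fVAL vT vX) ;; At (Pls vT vT vONE)))
    (\<lambda>(v', a', r', t').
    same_except {vT, vX} v v' \<and> same_except {fVAL} a a' \<and> r' = r \<and>
    (\<forall>x\<in>{1..n}. a' fVAL x = int (val x)) \<and> t' \<le> t + 7 + 4 * n)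
    (v1, a1, r, Suc (Suc (Suc (Suc (Suc (Suc t))))))"
  proof (rule wp_Loop[where I = I and k = 4 and f = "\<lambda>k. n + 1 - k"])
    have "a1 fVAL x = input_mem p x" if "1 \<le> x" "x < 4" for x
    proof -
      have "x = 1 \<or> x = 2 \<or> x = 3" using that by linarith
      then show ?thesis by (auto simp: a1_def)
    qed
    then show "I 4 (v1, a1, r, Suc (Suc (Suc (Suc (Suc (Suc t))))))"
      unfolding I_def by (auto simp: v1_def same_except_def) (auto simp: a1_def)
  next
    fix k s assume I: "I k s" and h: "holds (Lt vT vSTOP) s"
    obtain v' a' r' t' where s: "s = (v', a', r', t')" by (cases s)
    have q: "same_except {vT, vX} v v'" "same_except {fVAL} a a'" "r' = r" "v' vT = int k" "4 \<le> k"
      "\<forall>x. 1 \<le> x \<and> x < k \<longrightarrow> a' fVAL x = input_mem p x" "t' \<le> t + 6 + 4 * (k - 4)"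
      using I unfolding I_def s by auto
    have v': "v' vONE = 1" "v' vSTOP = int (n + 1)" using q(1) v by (auto simp: same_except_def)
    have kn: "k \<le> n" using h s q(4) v' by simp
    have rk: "r k = input_mem p k" using r[of k] kn q(5) n by simp
    show "wp (8 * n) (At (RLd vX vT) ;; At (St fVAL vT vX) ;; At (Pls vT vT vONE))
      (\<lambda>s'. \<exists>k'. n + 1 - k' < n + 1 - k \<and> I k' s') (tick s)"
      unfolding s
      using kn q(5) n
      apply (simp add: q(3,4) v' rk)
      apply (intro exI[of _ "Suc k"] conjI)
      subgoal by simp
      unfolding I_def
      using q(1,2,6,7)
      by (auto simp: same_except_def less_Suc_eq)
  next
    fix k s assume I: "I k s" and h: "\<not> holds (Lt vT vSTOP) s"
    obtain v' a' r' t' where s: "s = (v', a', r', t')" by (cases s)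
    have q: "same_except {vT, vX} v v'" "same_except {fVAL} a a'" "r' = r" "v' vT = int k" "4 \<le> k"
      "\<forall>x. 1 \<le> x \<and> x < k \<longrightarrow> a' fVAL x = input_mem p x" "t' \<le> t + 6 + 4 * (k - 4)"
      "k = 4 \<or> k \<le> n + 1"
      using I unfolding I_def s by auto
    have "v' vSTOP = int (n + 1)" using q(1) v by (auto simp: same_except_def)
    then have "n < k" using h s q(4) by simp
    then have "\<forall>x\<in>{1..n}. a' fVAL x = int (val x)" using q(6) input_mem_val by auto
    moreover have "Suc t' \<le> t + 7 + 4 * n" using q(7,8) by auto
    ultimately show "case tick s of (v', a', r', t') \<Rightarrow>
      same_except {vT, vX} v v' \<and> same_except {fVAL} a a' \<and> r' = r \<and>
      (\<forall>x\<in>{1..n}. a' fVAL x = int (val x)) \<and> t' \<le> t + 7 + 4 * n"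
      unfolding s tick.simps prod.case using q(1-3) by (intro conjI)
  qed
  then show ?thesis using v unfolding copy_part_def v1_def a1_def by simp
qed

lemma wp_link_part:
  assumes n: "1 \<le> n" and v: "v vONE = 1" "v vN = int n" "v vSTOP = int (n + 1)"
    "v vWIDTH = int (n + 2)" "v vZERO = 0" "v vCOUNT = 0" "v vI = 0"
    and vl: "\<forall>x\<in>{1..n}. a fVAL x = int (val x)"
    and a: "a fBEST 0 = 0" "a fLEN 0 = 0" "a fPREV (n + 1) = 0"
  shows "wp B link_part (\<lambda>(v', a', r', t'). ready 1 v' a' \<and> t' \<le> t + 6 + 6 * n) (v, a, r, t)"
proof -
  define v1 where "v1 = v(vT := 1, vPREV := 0)"
  define I where "I = (\<lambda>k (v', a', r' :: nat \<Rightarrow> int, t'). same_except {vT, vX, vPREV} v v' \<and>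
    same_except {fPOS, fNEXT} a a' \<and> v' vT = int k \<and> v' vPREV = int (k - 1) \<and> 1 \<le> k \<and> k \<le> n + 1 \<and>
    (\<forall>x. 1 \<le> x \<and> x < k \<longrightarrow> a' fPOS (val x) = int x \<and> a' fNEXT (x - 1) = int x) \<and>
    t' \<le> t + 2 + 6 * (k - 1))"
  have "wp B (Loop (Lt vT vSTOP) (At (Ld vX fVAL vT) ;; At (St fPOS vX vT) ;; At (St fNEXT vPREV vT) ;;
       At (Pls vPREV vT vZERO) ;; At (Pls vT vT vONE)))
    (wp B (At (St fNEXT vPREV vSTOP) ;; At (Cst vU 1) ;; At (Pls vROW vWIDTH vZERO))
      (\<lambda>(v', a', r', t'). ready 1 v' a' \<and> t' \<le> t + 6 + 6 * n)) (v1, a, r, Suc (Suc t))"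
  proof (rule wp_Loop[where I = I and k = 1 and f = "\<lambda>k. n + 1 - k"])
    show "I 1 (v1, a, r, Suc (Suc t))"
      unfolding I_def by (auto simp: v1_def same_except_def)
  next
    fix k s assume I: "I k s" and h: "holds (Lt vT vSTOP) s"
    obtain v' a' r' t' where s: "s = (v', a', r', t')" by (cases s)
    have q: "same_except {vT, vX, vPREV} v v'"
      "same_except {fPOS, fNEXT} a a'" "v' vT = int k" "v' vPREV = int (k - 1)" "1 \<le> k" "k \<le> n + 1"
      "\<forall>x. 1 \<le> x \<and> x < k \<longrightarrow> a' fPOS (val x) = int x \<and> a' fNEXT (x - 1) = int x"
      "t' \<le> t + 2 + 6 * (k - 1)"
      using I unfolding I_def s by auto
    have v': "v' vONE = 1" "v' vSTOP = int (n + 1)" "v' vZERO = 0"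
      using q(1) v by (auto simp: same_except_def)
    have kn: "k \<le> n" using h s q(3) v' by simp
    have a': "a' fVAL k = int (val k)" using q(2,5) vl kn by (auto simp: same_except_def)
    have new: "I (Suc k) (v'', a'(fPOS := (a' fPOS)(val k := int k),
        fNEXT := (a' fNEXT)(k - 1 := int k)), r', t' + 6)"
      if "same_except {vT, vX, vPREV} v' v''" "v'' vT = int (Suc k)" "v'' vPREV = int k" for v''
      unfolding I_def prod.case
    proof (intro conjI allI impI)
      show "same_except {vT, vX, vPREV} v v''" using that(1) q(1) by (auto simp: same_except_def)
      show "same_except {fPOS, fNEXT} a (a'(fPOS := (a' fPOS)(val k := int k),
        fNEXT := (a' fNEXT)(k - 1 := int k)))" using q(2) by (auto simp: same_except_def)
      show "t' + 6 \<le> t + 2 + 6 * (Suc k - 1)" using q(5,8) by simp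
      fix x assume x: "1 \<le> x \<and> x < Suc k"
      have "val x \<noteq> val k" if "x < k" using ps_val[of x] ps_val[of k] x kn that by auto
      then show "(a'(fPOS := (a' fPOS)(val k := int k), fNEXT := (a' fNEXT)(k - 1 := int k))) fPOS (val x) = int x"
        using q(7) x by (cases "x = k") auto
      show "(a'(fPOS := (a' fPOS)(val k := int k), fNEXT := (a' fNEXT)(k - 1 := int k))) fNEXT (x - 1) = int x"
        using q(7) x by (cases "x = k") auto
    qed (use that kn in auto)
    have t6: "Suc (Suc (Suc (Suc (Suc (Suc t'))))) = t' + 6" by simp
    show "wp B (At (Ld vX fVAL vT) ;; At (St fPOS vX vT) ;; At (St fNEXT vPREV vT) ;;
       At (Pls vPREV vT vZERO) ;; At (Pls vT vT vONE)) (\<lambda>s'. \<exists>k'. n + 1 - k' < n + 1 - k \<and> I k' s') (tick s)"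
      unfolding s
      apply (simp add: q(3,4) v' a')
      apply (intro exI[of _ "Suc k"] conjI)
      subgoal using kn by simp
      unfolding t6
      using new[of "v'(vX := int (val k), vPREV := int k, vT := int k + 1)"]
      by (simp add: same_except_def)
  next
    fix k s assume I: "I k s" and h: "\<not> holds (Lt vT vSTOP) s"
    obtain v' a' r' t' where s: "s = (v', a', r', t')" by (cases s)
    have q: "same_except {vT, vX, vPREV} v v'"
      "same_except {fPOS, fNEXT} a a'" "v' vT = int k" "v' vPREV = int (k - 1)" "1 \<le> k" "k \<le> n + 1"
      "\<forall>x. 1 \<le> x \<and> x < k \<longrightarrow> a' fPOS (val x) = int x \<and> a' fNEXT (x - 1) = int x"
      "t' \<le> t + 2 + 6 * (k - 1)"
      using I unfolding I_def s by auto
    have "v' vSTOP = int (n + 1)" using q(1) v by (auto simp: same_except_def)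
    then have k: "k = n + 1" using h s q(3,6) by simp
    have pos_val: "0 < val x" if "1 \<le> x" "x \<le> n" for x using val_range[of x] that by simp
    have H: "High 1 = {1..n}" using pos_val by (auto simp: High_def Suc_le_eq)
    have L: "Low 1 = {}" using pos_val by (auto simp: Low_def)
    define v2 where "v2 = v'(vU := 1, vROW := v' vWIDTH)"
    define a2 where "a2 = a'(fNEXT := (a' fNEXT)(n := int (n + 1)))"
    have "consts_ok 1 v2" using q(1) v by (auto simp: consts_ok_def v2_def same_except_def row_def)
    moreover have "input_ok a2"
      unfolding input_ok_def
    proof (intro conjI ballI)
      fix w assume "w \<in> {1..n}"
      then have "1 \<le> ps w" "ps w < k" "val (ps w) = w" using ps_range[of w] val_ps[of w] k by auto
      then have "a' fPOS w = int (ps w)" using q(7) by metis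
      then show "a2 fPOS w = int (ps w)" by (simp add: a2_def)
    qed (use q(2) vl a in \<open>auto simp: a2_def same_except_def\<close>)
    moreover have "next_ok 1 a2"
      unfolding next_ok_def
    proof
      fix x assume "x \<in> insert 0 (High 1)"
      then have x: "x \<le> n" using H by auto
      have "a2 fNEXT x = int (x + 1)"
      proof (cases "x = n")
        case False
        then have "1 \<le> x + 1" "x + 1 < k" using x k by auto
        then have "a' fNEXT (x + 1 - 1) = int (x + 1)" using q(7) by blast
        then show ?thesis using False by (simp add: a2_def)
      qed (simp add: a2_def)
      moreover have "succ_in (insert (n + 1) (High 1)) x (x + 1)"
        using x unfolding H succ_in_def by auto
      ultimately show "\<exists>y. a2 fNEXT x = int y \<and> succ_in (insert (n + 1) (High 1)) x y" by blast
    qed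
    moreover have "prev_ok 1 a2"
      unfolding prev_ok_def L using q(2) a by (auto simp: a2_def same_except_def pred_in_def)
    moreover have "row_ok 1 a2" unfolding row_ok_def L by simp
    \<comment> \<open>Vacuous but for \<open>fLEN 0\<close>: there is no entry below 1 and no edge
      with a lower end below 1.\<close>
    moreover have "scanned 1 0 a2"
      unfolding scanned_def L using q(2) a by (auto simp: a2_def same_except_def cross_def)
    ultimately have "ready 1 v2 a2" unfolding ready_def by simp
    moreover have "Suc (Suc (Suc (Suc t'))) \<le> t + 6 + 6 * n" using q(8) k by simp
    moreover have "v' vSTOP = int (n + 1)" "v' vZERO = 0" using q(1) v by (auto simp: same_except_def)
    ultimately show "wp B (At (St fNEXT vPREV vSTOP) ;; At (Cst vU 1) ;; At (Pls vROW vWIDTH vZERO))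
      (\<lambda>(v', a', r', t'). ready 1 v' a' \<and> t' \<le> t + 6 + 6 * n) (tick s)"
      unfolding s v2_def a2_def using q(4) k by simp
  qed
  then show ?thesis unfolding link_part_def v1_def by simp
qed

text \<open>19 is 18 plus the loop test, and 60 is 30 times the factor 2 of
  \<open>sum_degree\<close>.\<close>

lemma wp_main_loop:
  assumes "1 \<le> n" "ready 1 v a"
  shows "wp B main_loop (\<lambda>(v', a', r', t'). ready (n + 1) v' a' \<and>
    t' \<le> t + 1 + 19 * n + 60 * card (perm_edges n p)) (v, a, r, t)"
  unfolding main_loop_def
proof (rule wp_Loop[where k = 1 and f = "\<lambda>u. n + 1 - u" and I = "\<lambda>u (v', a', r', t').
    1 \<le> u \<and> u \<le> n + 1 \<and> ready u v' a' \<and> t' \<le> t + 19 * (u - 1) + 30 * (\<Sum>w\<in>{1..<u}. degree w)"])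
  show "case (v, a, r, t) of (v', a', r', t') \<Rightarrow> 1 \<le> (1::nat) \<and> 1 \<le> n + 1 \<and> ready 1 v' a' \<and>
    t' \<le> t + 19 * (1 - 1) + 30 * (\<Sum>w\<in>{1..<1}. degree w)" using assms by simp
next
  fix u s
  assume I: "case s of (v', a', r', t') \<Rightarrow> 1 \<le> u \<and> u \<le> n + 1 \<and> ready u v' a' \<and>
    t' \<le> t + 19 * (u - 1) + 30 * (\<Sum>w\<in>{1..<u}. degree w)" and h: "holds (Lt vU vSTOP) s"
  obtain v' a' r' t' where s: "s = (v', a', r', t')" by (cases s)
  have q: "1 \<le> u" "ready u v' a'" "t' \<le> t + 19 * (u - 1) + 30 * (\<Sum>w\<in>{1..<u}. degree w)"
    using I unfolding s by auto
  then have un: "u \<le> n" using h s by (auto simp: ready_def consts_ok_def)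
  have sm: "(\<Sum>w\<in>{1..<Suc u}. degree w) = (\<Sum>w\<in>{1..<u}. degree w) + degree u"
    using q(1) by simp
  show "wp B (high_part ;; scan_part ;; low_part) (\<lambda>s'. \<exists>k'. n + 1 - k' < n + 1 - u \<and>
    (case s' of (v', a', r', t') \<Rightarrow> 1 \<le> k' \<and> k' \<le> n + 1 \<and> ready k' v' a' \<and>
      t' \<le> t + 19 * (k' - 1) + 30 * (\<Sum>w\<in>{1..<k'}. degree w))) (tick s)"
    unfolding s tick.simps
  proof (rule wp_mono[OF wp_parts[OF q(1) un q(2)]])
    fix s' :: state
    obtain v2 a2 r2 t2 where s': "s' = (v2, a2, r2, t2)" by (cases s')
    assume "case s' of (v'', a'', r'', t'') \<Rightarrow> ready (Suc u) v'' a'' \<and> t'' \<le> Suc t' + 18 + 30 * degree u"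
    then have "ready (Suc u) v2 a2" "t2 \<le> Suc t' + 18 + 30 * degree u" unfolding s' by auto
    then show "\<exists>k'. n + 1 - k' < n + 1 - u \<and>
      (case s' of (v', a', r', t') \<Rightarrow> 1 \<le> k' \<and> k' \<le> n + 1 \<and> ready k' v' a' \<and>
      t' \<le> t + 19 * (k' - 1) + 30 * (\<Sum>w\<in>{1..<k'}. degree w))"
      unfolding s' prod.case
      by (intro exI[of _ "Suc u"]) (use sm q un in auto)
  qed
next
  fix u s
  assume I: "case s of (v', a', r', t') \<Rightarrow> 1 \<le> u \<and> u \<le> n + 1 \<and> ready u v' a' \<and>
    t' \<le> t + 19 * (u - 1) + 30 * (\<Sum>w\<in>{1..<u}. degree w)" and h: "\<not> holds (Lt vU vSTOP) s"
  obtain v' a' r' t' where s: "s = (v', a', r', t')" by (cases s)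
  have q: "u \<le> n + 1" "ready u v' a'" "t' \<le> t + 19 * (u - 1) + 30 * (\<Sum>w\<in>{1..<u}. degree w)"
    using I unfolding s by auto
  then have u: "u = n + 1" using h s by (auto simp: ready_def consts_ok_def)
  have "{1..<u} = {1..n}" using u by auto
  then have "Suc t' \<le> t + 1 + 19 * n + 60 * card (perm_edges n p)"
    using q(3) sum_degree u by simp
  then show "case tick s of (v', a', r', t') \<Rightarrow> ready (n + 1) v' a' \<and>
    t' \<le> t + 1 + 19 * n + 60 * card (perm_edges n p)" using q(2) u s by simp
qed

text \<open>The lower ends of the edges strictly decrease. The resulting bound \<open>n\<close>
  limits the time of the output loops and keeps the output below the base address.\<close>

lemma descending_length: "descending x y es \<Longrightarrow> length es \<le> x"
proof (induction es arbitrary: x y)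
  case (Cons e es)
  obtain u v where "e = (u, v)" by (cases e)
  then have "length es \<le> u - 1" "1 \<le> u" "u < x" using Cons by (auto simp: cross_def)
  then show ?case by simp
qed simp

definition listed :: "(nat \<Rightarrow> int) \<Rightarrow> (nat \<times> nat) list \<Rightarrow> bool" where
  "listed g es \<longleftrightarrow> (\<forall>j<length es. g (2 * j + 1) = int (fst (es ! j)) \<and> g (2 * j + 2) = int (snd (es ! j)))"

lemma listed_snoc:
  assumes "listed g es"
  shows "listed (g(2 * length es + 1 := int u, 2 * length es + 2 := int v)) (es @ [(u, v)])"
  unfolding listed_def
proof (intro allI impI)
  fix j assume j: "j < length (es @ [(u, v)])"
  show "(g(2 * length es + 1 := int u, 2 * length es + 2 := int v)) (2 * j + 1) = int (fst ((es @ [(u, v)]) ! j)) \<and>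
    (g(2 * length es + 1 := int u, 2 * length es + 2 := int v)) (2 * j + 2) = int (snd ((es @ [(u, v)]) ! j))"
  proof (cases "j = length es")
    case False
    then have "j < length es" using j by simp
    moreover have "2 * j + 1 \<noteq> 2 * length es + 2" "2 * j + 2 \<noteq> 2 * length es + 1" by presburger+
    ultimately show ?thesis using assms by (simp add: listed_def nth_append)
  qed simp
qed

lemma wp_walk_part:
  assumes n: "1 \<le> n" and rd: "ready (n + 1) v a"
  shows "wp B walk_part (\<lambda>(v', a', r', t'). \<exists>es. descending n n es \<and> length es = F n n \<and> r' = r \<and>
    v' vONE = 1 \<and> v' vZERO = 0 \<and> v' vCOUNT = int (length es) \<and> v' vI = int (2 * length es) \<and>
    listed (a' fOUT) es \<and> t' \<le> t + 2 + 9 * n) (v, a, r, t)"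
proof -
  have c: "consts_ok (n + 1) v" "scanned (n + 1) 0 a" using rd by (auto simp: ready_def)
  have "n \<in> Low (n + 1)" using n val_range[of n] by (simp add: Low_def)
  then have "opt a n n (a fBEST n)" using c(2) by (simp add: scanned_def)
  then obtain k0 es where k0: "a fBEST n = int k0" "rep a n n k0 es" "length es = F n n" by (rule optE)
  have ds: "descending n n es" by (rule rep_descending[OF k0(2)])
  have ln: "length es \<le> n" by (rule descending_length[OF ds])
  \<comment> \<open>The ghost is the part \<open>xs\<close> of the chain still to be written. Its
    corner is quantified away, as the walk only follows links.\<close>
  define I where "I = (\<lambda>xs (v', a', r', t'). \<exists>zs x y k. es = zs @ xs \<and> rep a x y k xs \<and>
    same_except {vK, vI, vT, vCOUNT} v v' \<and> same_except {fOUT} a a' \<and> r' = r \<and> v' vK = int k \<and>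
    v' vCOUNT = int (length zs) \<and> v' vI = int (2 * length zs) \<and> listed (a' fOUT) zs \<and>
    t' \<le> t + 1 + 9 * length zs)"
  have "wp B (Loop (Neq vK vZERO) (At (Pls vI vI vONE) ;; At (Ld vT fLO vK) ;; At (St fOUT vI vT) ;;
       At (Pls vI vI vONE) ;; At (Ld vT fHI vK) ;; At (St fOUT vI vT) ;;
       At (Pls vCOUNT vCOUNT vONE) ;; At (Ld vK fLINK vK)))
   (\<lambda>(v', a', r', t'). \<exists>es. descending n n es \<and> length es = F n n \<and> r' = r \<and>
    v' vONE = 1 \<and> v' vZERO = 0 \<and> v' vCOUNT = int (length es) \<and> v' vI = int (2 * length es) \<and>
    listed (a' fOUT) es \<and> t' \<le> t + 2 + 9 * n) (v(vK := int k0), a, r, Suc t)"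
  proof (rule wp_Loop[where I = I and k = es and f = length])
    show "I es (v(vK := int k0), a, r, Suc t)"
      unfolding I_def prod.case using c(1) k0
      by (intro exI[of _ "[]"] exI[of _ n] exI[of _ k0]) (simp add: same_except_def consts_ok_def listed_def)
  next
    fix xs s assume I: "I xs s" and h: "holds (Neq vK vZERO) s"
    obtain v' a' r' t' where s: "s = (v', a', r', t')" by (cases s)
    obtain zs x y k where q: "es = zs @ xs" "rep a x y k xs"
      "same_except {vK, vI, vT, vCOUNT} v v'" "same_except {fOUT} a a'" "r' = r" "v' vK = int k"
      "v' vCOUNT = int (length zs)" "v' vI = int (2 * length zs)" "listed (a' fOUT) zs"
      "t' \<le> t + 1 + 9 * length zs"
      using I unfolding I_def s prod.case by (elim exE conjE)
    have v': "v' vONE = 1" "v' vZERO = 0" using q(3) c(1) by (auto simp: same_except_def consts_ok_def)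
    have "k \<noteq> 0" using h s q(6) v' by simp
    then obtain u w xs' where xs: "xs = (u, w) # xs'" using q(2) by (cases xs) auto
    obtain k' where k': "a fLINK k = int k'" "rep a (u - 1) (ps w - 1) k' xs'"
      "a fLO k = int u" "a fHI k = int w" using q(2) xs by auto
    have a': "a' fLINK = a fLINK" "a' fLO = a fLO" "a' fHI = a fHI"
      using q(4) by (auto simp: same_except_def)
    let ?g = "(a' fOUT)(2 * length zs + 1 := int u, 2 * length zs + 2 := int w)"
    have new: "I xs' (v'', a'(fOUT := ?g), r, t' + 9)"
      if "same_except {vK, vI, vT, vCOUNT} v' v''" "v'' vK = int k'" "v'' vCOUNT = int (Suc (length zs))"
        "v'' vI = int (2 * length zs + 2)" for v''
      unfolding I_def prod.case
    proof (intro exI conjI)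
      show "es = (zs @ [(u, w)]) @ xs'" using q(1) xs by simp
      show "rep a (u - 1) (ps w - 1) k' xs'" by (rule k'(2))
      show "listed ((a'(fOUT := ?g)) fOUT) (zs @ [(u, w)])" using listed_snoc[OF q(9)] by simp
      show "same_except {vK, vI, vT, vCOUNT} v v''" using q(3) that(1) by (simp add: same_except_def)
      show "same_except {fOUT} a (a'(fOUT := ?g))" using q(4) by (simp add: same_except_def)
    qed (use that q(10) in auto)
    have n1: "nat (2 * int (length zs) + 1) = 2 * length zs + 1"
      "nat (2 + 2 * int (length zs)) = 2 * length zs + 2" by simp_all
    have t9: "Suc (Suc (Suc (Suc (Suc (Suc (Suc (Suc (Suc t')))))))) = t' + 9" by simp
    show "wp B (At (Pls vI vI vONE) ;; At (Ld vT fLO vK) ;; At (St fOUT vI vT) ;;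
       At (Pls vI vI vONE) ;; At (Ld vT fHI vK) ;; At (St fOUT vI vT) ;;
       At (Pls vCOUNT vCOUNT vONE) ;; At (Ld vK fLINK vK))
       (\<lambda>s'. \<exists>k'. length k' < length xs \<and> I k' s') (tick s)"
      unfolding s
      apply (simp add: q(5-8) v' a' k'(1,3,4) n1)
      apply (intro exI[of _ xs'] conjI)
      subgoal using xs by simp
      unfolding t9
      using new[of "v'(vI := 2 + 2 * int (length zs), vT := int w, vCOUNT := int (length zs) + 1,
        vK := int k')"]
      by (simp add: same_except_def)
  next
    fix xs s assume I: "I xs s" and h: "\<not> holds (Neq vK vZERO) s"
    obtain v' a' r' t' where s: "s = (v', a', r', t')" by (cases s)
    obtain zs x y k where q: "es = zs @ xs" "rep a x y k xs"
      "same_except {vK, vI, vT, vCOUNT} v v'" "same_except {fOUT} a a'" "r' = r" "v' vK = int k"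
      "v' vCOUNT = int (length zs)" "v' vI = int (2 * length zs)" "listed (a' fOUT) zs"
      "t' \<le> t + 1 + 9 * length zs"
      using I unfolding I_def s prod.case by (elim exE conjE)
    have v': "v' vONE = 1" "v' vZERO = 0" using q(3) c(1) by (auto simp: same_except_def consts_ok_def)
    have "k = 0" using h s q(6) v' by simp
    \<comment> \<open>The node of a nonempty chain is \<open>row u + ps w\<close>, and positions
      start at 1, so 0 unambiguously marks the end.\<close>
    have "xs = []"
    proof (cases xs)
      case (Cons e xs')
      then obtain u w where "cross u w" "k = row u + ps w" using q(2) by (cases e) auto
      then have "1 \<le> k" using ps_range[of w] by (auto simp: cross_def)
      then show ?thesis using \<open>k = 0\<close> by simp
    qed
    then have "es = zs" using q(1) by simp
    then show "case tick s of (v', a', r', t') \<Rightarrow> \<exists>es. descending n n es \<and> length es = F n n \<and> r' = r \<and>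
      v' vONE = 1 \<and> v' vZERO = 0 \<and> v' vCOUNT = int (length es) \<and> v' vI = int (2 * length es) \<and>
      listed (a' fOUT) es \<and> t' \<le> t + 2 + 9 * n"
      unfolding s tick.simps prod.case using q v' ds k0(3) ln by (intro exI[of _ es]) simp
  qed
  then show ?thesis unfolding walk_part_def using c(1) k0(1) by (simp add: consts_ok_def)
qed

lemma wp_out_part:
  assumes n: "1 \<le> n" and v: "v vONE = 1" "v vZERO = 0" "v vCOUNT = int l" "v vI = int (2 * l)" "l \<le> n"
  shows "wp (8 * n) out_part (\<lambda>(v', a', r', t'). v' 0 = a fOUT 1 \<and> v' 1 = a fOUT 2 \<and> v' 2 = a fOUT 3 \<and>
    v' vBASE = int l \<and> (\<forall>i. 4 \<le> i \<and> i \<le> 2 * l \<longrightarrow> r' i = a fOUT i) \<and> t' \<le> t + 9 + 8 * n) (v, a, r, t)"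
proof -
  define v1 where "v1 = v(vY := int (2 * l) + 1, vT := 4)"
  \<comment> \<open>As in the copy loop, \<open>k = 4\<close> covers a short range, here that of
    fewer than two edges.\<close>
  define I where "I = (\<lambda>k (v', a', r', t'). same_except {vY, vT, vX} v v' \<and> a' = a \<and>
    v' vY = int (2 * l + 1) \<and> v' vT = int k \<and> 4 \<le> k \<and> (k = 4 \<or> k \<le> 2 * l + 1) \<and>
    (\<forall>i. 4 \<le> i \<and> i < k \<longrightarrow> r' i = a fOUT i) \<and> t' \<le> t + 2 + 4 * (k - 4))"
  have "wp (8 * n) (Loop (Lt vT vY) (At (Ld vX fOUT vT) ;; At (RSt vT vX) ;; At (Pls vT vT vONE)))
    (wp (8 * n) (At (Ld 0 fOUT vONE) ;; At (Cst vT 2) ;; At (Ld 1 fOUT vT) ;; At (Cst vT 3) ;;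
     At (Ld 2 fOUT vT) ;; At (Pls vBASE vCOUNT vZERO)) (\<lambda>(v', a', r', t'). v' 0 = a fOUT 1 \<and> v' 1 = a fOUT 2 \<and>
     v' 2 = a fOUT 3 \<and>
    v' vBASE = int l \<and> (\<forall>i. 4 \<le> i \<and> i \<le> 2 * l \<longrightarrow> r' i = a fOUT i) \<and> t' \<le> t + 9 + 8 * n))
    (v1, a, r, Suc (Suc t))"
  proof (rule wp_Loop[where I = I and k = 4 and f = "\<lambda>k. 2 * l + 1 - k"])
    show "I 4 (v1, a, r, Suc (Suc t))" unfolding I_def by (auto simp: v1_def same_except_def)
  next
    fix k s assume I: "I k s" and h: "holds (Lt vT vY) s"
    obtain v' a' r' t' where s: "s = (v', a', r', t')" by (cases s)
    have q: "same_except {vY, vT, vX} v v'" "a' = a"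
      "v' vY = int (2 * l + 1)" "v' vT = int k" "4 \<le> k"
      "\<forall>i. 4 \<le> i \<and> i < k \<longrightarrow> r' i = a fOUT i" "t' \<le> t + 2 + 4 * (k - 4)"
      using I unfolding I_def s by auto
    have v': "v' vONE = 1" using q(1) v by (auto simp: same_except_def)
    have kl: "k \<le> 2 * l" using h s q(3,4) by simp
    have new: "I (Suc k) (v'(vX := c, vT := int k + 1), a, r'(k := a fOUT k), t' + 4)" for c
      unfolding I_def prod.case
    proof (intro conjI allI impI)
      fix i assume "4 \<le> i \<and> i < Suc k"
      then show "(r'(k := a fOUT k)) i = a fOUT i" using q(6) by (cases "i = k") auto
    qed (use q(1,3,5,7) kl in \<open>auto simp: same_except_def\<close>)
    have t4: "Suc (Suc (Suc (Suc t'))) = t' + 4" by simp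
    show "wp (8 * n) (At (Ld vX fOUT vT) ;; At (RSt vT vX) ;; At (Pls vT vT vONE))
      (\<lambda>s'. \<exists>k'. 2 * l + 1 - k' < 2 * l + 1 - k \<and> I k' s') (tick s)"
      unfolding s using kl v(5) n q(5)
      apply (simp add: q(2,4) v')
      apply (intro exI[of _ "Suc k"] conjI)
      subgoal by simp
      unfolding t4 by (rule new)
  next
    fix k s assume I: "I k s" and h: "\<not> holds (Lt vT vY) s"
    obtain v' a' r' t' where s: "s = (v', a', r', t')" by (cases s)
    have q: "same_except {vY, vT, vX} v v'" "a' = a"
      "v' vY = int (2 * l + 1)" "v' vT = int k" "k = 4 \<or> k \<le> 2 * l + 1"
      "\<forall>i. 4 \<le> i \<and> i < k \<longrightarrow> r' i = a fOUT i" "t' \<le> t + 2 + 4 * (k - 4)"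
      using I unfolding I_def s by auto
    have v': "v' vONE = 1" "v' vCOUNT = int l" "v' vZERO = 0" using q(1) v by (auto simp: same_except_def)
    have "2 * l < k" using h s q(3,4) by simp
    then have "\<forall>i. 4 \<le> i \<and> i \<le> 2 * l \<longrightarrow> r' i = a fOUT i" using q(6) by simp
    moreover have "t' \<le> t + 2 + 8 * n" using q(5,7) v(5) by auto
    ultimately show "wp (8 * n) (At (Ld 0 fOUT vONE) ;; At (Cst vT 2) ;; At (Ld 1 fOUT vT) ;; At (Cst vT 3) ;;
     At (Ld 2 fOUT vT) ;; At (Pls vBASE vCOUNT vZERO)) (\<lambda>(v', a', r', t'). v' 0 = a fOUT 1 \<and> v' 1 = a fOUT 2 \<and>
     v' 2 = a fOUT 3 \<and>
    v' vBASE = int l \<and> (\<forall>i. 4 \<le> i \<and> i \<le> 2 * l \<longrightarrow> r' i = a fOUT i) \<and> t' \<le> t + 9 + 8 * n) (tick s)"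
      unfolding s using q(2) v' by simp
  qed
  then show ?thesis unfolding out_part_def v1_def using v by simp
qed

end


section \<open>The complete machine program\<close>

definition program :: com where
  "program = count_part ;; copy_part ;; link_part ;; main_loop ;; walk_part ;; out_part"

text \<open>
  Initially only register 0 can be overwritten without losing input, and it contains \<open>n\<close>. Replacing
  it by the base address \<open>8 * n\<close> allows us to save registers 1 to 3 behind the input; \<open>n\<close> is
  recovered from the base address later.
\<close>

definition prologue :: "instr list" where
  "prologue = [Add 0 0 0, Add 0 0 0, Add 0 0 0, StoreInd 0 1, LoadConst 1 1, Add 0 0 1,
     StoreInd 0 2, Add 0 0 1, StoreInd 0 3, LoadConst 1 2, Sub 0 0 1, LoadConst 1 3, Add 1 1 0,
     StoreInd 1 0]"

text \<open>Each of the four registers is loaded through the address that it holds itself.\<close>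

definition epilogue :: "instr list" where
  "epilogue = [LoadConst 1 3, Add 0 0 1, LoadConst 2 3, Sub 1 0 2, LoadConst 2 1, Add 2 2 1,
     LoadConst 3 2, Add 3 3 1, LoadInd 0 0, LoadInd 1 1, LoadInd 2 2, LoadInd 3 3]"

definition body_code :: "instr list" where
  "body_code = prologue @ compile (1 + length prologue) program @ epilogue"

text \<open>For \<open>n = 0\<close> the base address would be 0 and collide with the registers. The
  program then jumps to its end at once, blank memory already encoding the empty matching.\<close>

definition machine_code :: "instr list" where
  "machine_code = Jz 0 (1 + length body_code) # body_code"

lemma wf_program: "wf_com program"
  by (simp add: program_def count_part_def copy_part_def link_part_def main_loop_def walk_part_def
      out_part_def high_part_def scan_part_def low_part_def high_body_def scan_body_def low_body_def)

text \<open>Three doublings give a base of at least 8, so the saved cells differ from the registers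
  in use; it also exceeds both \<open>n\<close> and \<open>2 * n\<close>, leaving room for input and
  output below it. The last cell written is the variable \<open>vBASE\<close>.\<close>

lemma fold_prologue:
  assumes "m 0 = int n" "1 \<le> n"
  shows "fold ieff prologue m = m(8 * n := m 1, 8 * n + 1 := m 2, 8 * n + 2 := m 3,
    8 * n + 3 := int (8 * n), 0 := int (8 * n), 1 := int (8 * n + 3))"
proof -
  define b where "b = 8 * n"
  have b: "b \<noteq> 0" "b \<noteq> 1" "b \<noteq> 2" "b \<noteq> 3" using assms(2) by (auto simp: b_def)
  have 1: "fold ieff [Add 0 0 0, Add 0 0 0, Add 0 0 0] m = m(0 := int b)"
    using assms(1) by (simp add: b_def)
  have 2: "fold ieff [StoreInd 0 1, LoadConst 1 1, Add 0 0 1] (m(0 := int b))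
      = m(b := m 1, 1 := 1, 0 := int (b + 1))"
    using b by (simp add: fun_eq_iff)
  have 3: "fold ieff [StoreInd 0 2, Add 0 0 1] (m(b := m 1, 1 := 1, 0 := int (b + 1)))
      = m(b := m 1, 1 := 1, b + 1 := m 2, 0 := int (b + 2))"
    using b by (simp add: fun_eq_iff nat_int_add del: of_nat_add of_nat_Suc)
  let ?m = "m(b := m 1, 1 := 1, b + 1 := m 2, 0 := int (b + 2))"
  have 4: "fold ieff [StoreInd 0 3, LoadConst 1 2, Sub 0 0 1, LoadConst 1 3, Add 1 1 0] ?m
      = ?m(b + 2 := m 3, 0 := int b, 1 := int (b + 3))"
  proof -
    have "nat (int (b + 2)) = b + 2" "?m 3 = m 3" using b by simp_all
    then show ?thesis using b by (simp add: fun_eq_iff)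
  qed
  have 5: "fold ieff [StoreInd 1 0] (?m(b + 2 := m 3, 0 := int b, 1 := int (b + 3)))
      = ?m(b + 2 := m 3, 0 := int b, 1 := int (b + 3), b + 3 := int b)"
  proof -
    have "nat (int (b + 3)) = b + 3" by simp
    then show ?thesis by simp
  qed
  have "prologue = [Add 0 0 0, Add 0 0 0, Add 0 0 0] @ [StoreInd 0 1, LoadConst 1 1, Add 0 0 1] @
      [StoreInd 0 2, Add 0 0 1] @ [StoreInd 0 3, LoadConst 1 2, Sub 0 0 1, LoadConst 1 3, Add 1 1 0] @
      [StoreInd 1 0]"
    by (simp add: prologue_def)
  then have "fold ieff prologue m = ?m(b + 2 := m 3, 0 := int b, 1 := int (b + 3), b + 3 := int b)"
    unfolding \<open>prologue = _\<close> fold_append comp_apply 1 2 3 4 5 by simp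
  also have "\<dots> = m(b := m 1, b + 1 := m 2, b + 2 := m 3, b + 3 := int b, 0 := int b, 1 := int (b + 3))"
    using b by (simp add: fun_eq_iff)
  finally show ?thesis unfolding b_def .
qed

lemma fold_epilogue:
  assumes "m 0 = int b" "4 \<le> b"
  shows "fold ieff epilogue m = m(0 := m (b + 3), 1 := m b, 2 := m (b + 1), 3 := m (b + 2))"
proof -
  have "nat (int b + 3) = b + 3" "nat (int b) = b" "nat (1 + int b) = b + 1" "nat (2 + int b) = b + 2"
    by simp_all
  then show ?thesis using assms by (auto simp: epilogue_def fun_eq_iff)
qed

context permutation
begin

lemma wp_program:
  assumes n: "1 \<le> n" and v: "v 0 = input_mem p 1" "v 1 = input_mem p 2" "v 2 = input_mem p 3"
    "v vBASE = int (8 * n)" "\<And>x. 4 \<le> x \<Longrightarrow> v x = 0"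
    and a: "\<And>f i. a f i = 0"
    and r: "\<And>i. 4 \<le> i \<Longrightarrow> i < 8 * n \<Longrightarrow> r i = input_mem p i"
  shows "wp (8 * n) program (\<lambda>(v', a', r', t'). \<exists>es. descending n n es \<and> length es = F n n \<and>
    v' vBASE = int (length es) \<and>
    listed (r'(1 := v' 0, 2 := v' 1, 3 := v' 2)) es \<and>
    t' \<le> 30 + 50 * n + 60 * card (perm_edges n p)) (v, a, r, 0)"
  unfolding program_def wp_Sq
proof (rule wp_mono[OF wp_count_part[where v = v, OF v(4,5)]])
  fix s1 :: state
  obtain v1 a1 r1 t1 where s1: "s1 = (v1, a1, r1, t1)" by (cases s1)
  assume "case s1 of (v', a', r', t') \<Rightarrow>
    v' = v(vONE := 1, vEIGHT := 8, vT := int (8 * n), vN := int n, vSTOP := int (n + 1),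
      vWIDTH := int (n + 2)) \<and> a' = a \<and> r' = r \<and> t' \<le> 0 + 5 + 3 * n"
  then have h1: "v1 = v(vONE := 1, vEIGHT := 8, vT := int (8 * n), vN := int n, vSTOP := int (n + 1),
      vWIDTH := int (n + 2))" "a1 = a" "r1 = r" "t1 \<le> 5 + 3 * n" unfolding s1 by auto
  let ?Q = "\<lambda>(v', a', r', t'). \<exists>es. descending n n es \<and> length es = F n n \<and>
    v' vBASE = int (length es) \<and>
    listed (r'(1 := v' 0, 2 := v' 1, 3 := v' 2)) es \<and>
    t' \<le> 30 + 50 * n + 60 * card (perm_edges n p)"
  have c1: "v1 vONE = 1" "v1 vSTOP = int (n + 1)" "v1 0 = input_mem p 1" "v1 1 = input_mem p 2"
    "v1 2 = input_mem p 3" using h1 v(1-3) by auto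
  show "wp (8 * n) copy_part (wp (8 * n) link_part (wp (8 * n) main_loop
    (wp (8 * n) walk_part (wp (8 * n) out_part ?Q)))) s1"
    unfolding s1
  proof (rule wp_mono[OF wp_copy_part[where v = v1, OF n c1]])
    show "r1 i = input_mem p i" if "4 \<le> i" "i < 8 * n" for i using r that h1 by simp
  next
    fix s2 :: state
    obtain v2 a2 r2 t2 where s2: "s2 = (v2, a2, r2, t2)" by (cases s2)
    assume "case s2 of (v', a', r', t') \<Rightarrow> same_except {vT, vX} v1 v' \<and> same_except {fVAL} a1 a' \<and>
      r' = r1 \<and> (\<forall>x\<in>{1..n}. a' fVAL x = int (val x)) \<and> t' \<le> t1 + 7 + 4 * n"
    then have h2: "same_except {vT, vX} v1 v2" "same_except {fVAL} a1 a2"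
      "\<forall>x\<in>{1..n}. a2 fVAL x = int (val x)" "t2 \<le> t1 + 7 + 4 * n" unfolding s2 by auto
    have c2: "v2 vONE = 1" "v2 vN = int n" "v2 vSTOP = int (n + 1)" "v2 vWIDTH = int (n + 2)"
      "v2 vZERO = 0" "v2 vCOUNT = 0" "v2 vI = 0"
      using h2(1) h1(1) v(5) by (auto simp: same_except_def)
    have a2: "a2 fBEST 0 = 0" "a2 fLEN 0 = 0" "a2 fPREV (n + 1) = 0"
      using h2(2) h1(2) a by (auto simp: same_except_def)
    show "wp (8 * n) link_part (wp (8 * n) main_loop
      (wp (8 * n) walk_part (wp (8 * n) out_part ?Q))) s2"
      unfolding s2
    proof (rule wp_mono[OF wp_link_part[where v = v2 and a = a2, OF n c2 h2(3) a2]])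
      fix s3 :: state
      obtain v3 a3 r3 t3 where s3: "s3 = (v3, a3, r3, t3)" by (cases s3)
      assume "case s3 of (v', a', r', t') \<Rightarrow> ready 1 v' a' \<and> t' \<le> t2 + 6 + 6 * n"
      then have h3: "ready 1 v3 a3" "t3 \<le> t2 + 6 + 6 * n" unfolding s3 by auto
      show "wp (8 * n) main_loop (wp (8 * n) walk_part (wp (8 * n) out_part ?Q)) s3"
        unfolding s3
      proof (rule wp_mono[OF wp_main_loop[OF n h3(1)]])
        fix s4 :: state
        obtain v4 a4 r4 t4 where s4: "s4 = (v4, a4, r4, t4)" by (cases s4)
        assume "case s4 of (v', a', r', t') \<Rightarrow> ready (n + 1) v' a' \<and>
          t' \<le> t3 + 1 + 19 * n + 60 * card (perm_edges n p)"
        then have h4: "ready (n + 1) v4 a4" "t4 \<le> t3 + 1 + 19 * n + 60 * card (perm_edges n p)"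
          unfolding s4 by auto
        show "wp (8 * n) walk_part (wp (8 * n) out_part ?Q) s4"
          unfolding s4
        proof (rule wp_mono[OF wp_walk_part[OF n h4(1)]])
          fix s5 :: state
          obtain v5 a5 r5 t5 where s5: "s5 = (v5, a5, r5, t5)" by (cases s5)
          assume "case s5 of (v', a', r', t') \<Rightarrow> \<exists>es. descending n n es \<and> length es = F n n \<and> r' = r4 \<and>
            v' vONE = 1 \<and> v' vZERO = 0 \<and> v' vCOUNT = int (length es) \<and> v' vI = int (2 * length es) \<and>
            listed (a' fOUT) es \<and> t' \<le> t4 + 2 + 9 * n"
          then obtain es where es: "descending n n es" "length es = F n n" "v5 vONE = 1" "v5 vZERO = 0"
            "v5 vCOUNT = int (length es)" "v5 vI = int (2 * length es)" "listed (a5 fOUT) es"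
            "t5 \<le> t4 + 2 + 9 * n" unfolding s5 by auto
          show "wp (8 * n) out_part ?Q s5"
            unfolding s5
          proof (rule wp_mono[OF wp_out_part[where v = v5, OF n es(3-6) descending_length[OF es(1)]]])
            fix s6 :: state
            obtain v6 a6 r6 t6 where s6: "s6 = (v6, a6, r6, t6)" by (cases s6)
            assume "case s6 of (v', a', r', t') \<Rightarrow> v' 0 = a5 fOUT 1 \<and> v' 1 = a5 fOUT 2 \<and> v' 2 = a5 fOUT 3 \<and>
              v' vBASE = int (length es) \<and> (\<forall>i. 4 \<le> i \<and> i \<le> 2 * length es \<longrightarrow> r' i = a5 fOUT i) \<and>
              t' \<le> t5 + 9 + 8 * n"
            then have h6: "v6 0 = a5 fOUT 1" "v6 1 = a5 fOUT 2" "v6 2 = a5 fOUT 3"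
              "v6 vBASE = int (length es)" "\<forall>i. 4 \<le> i \<and> i \<le> 2 * length es \<longrightarrow> r6 i = a5 fOUT i"
              "t6 \<le> t5 + 9 + 8 * n" unfolding s6 by auto
            have o: "(r6(1 := v6 0, 2 := v6 1, 3 := v6 2)) i = a5 fOUT i" if "1 \<le> i" "i \<le> 2 * length es" for i
            proof -
              have "i = 1 \<or> i = 2 \<or> i = 3 \<or> 4 \<le> i" using that(1) by linarith
      then consider "i = 1" | "i = 2" | "i = 3" | "4 \<le> i" by blast
              then show ?thesis using h6(1-3,5) that(2) by cases auto
            qed
            have "listed (r6(1 := v6 0, 2 := v6 1, 3 := v6 2)) es"
              unfolding listed_def
            proof (intro allI impI)
              fix j assume j: "j < length es"
              have "(r6(1 := v6 0, 2 := v6 1, 3 := v6 2)) (2 * j + 1) = a5 fOUT (2 * j + 1)"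
                "(r6(1 := v6 0, 2 := v6 1, 3 := v6 2)) (2 * j + 2) = a5 fOUT (2 * j + 2)"
                by (rule o; use j in simp)+
              then show "(r6(1 := v6 0, 2 := v6 1, 3 := v6 2)) (2 * j + 1) = int (fst (es ! j)) \<and>
                (r6(1 := v6 0, 2 := v6 1, 3 := v6 2)) (2 * j + 2) = int (snd (es ! j))"
                using es(7) j unfolding listed_def by simp
            qed
            \<comment> \<open>The constants of the six parts add up to 30 and their factors of
              \<open>n\<close> to 49.\<close>
            moreover have "t6 \<le> 30 + 50 * n + 60 * card (perm_edges n p)"
              using h6(6) es(8) h4(2) h3(2) h2(4) h1(4) by linarith
            ultimately show "?Q s6" unfolding s6 prod.case using es(1,2) h6(4) by blast
          qed
        qed
      qed
    qed
  qed
qed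

lemma output_listed:
  assumes "m 0 = int (length es)" "listed m es"
  shows "output_matching m = {{u, v} | u v. (u, v) \<in> set es}"
proof -
  have m: "nat (m (2 * j + 1)) = fst (es ! j)" "nat (m (2 * j + 2)) = snd (es ! j)" if "j < length es" for j
    using assms(2) that unfolding listed_def by simp_all
  have "output_matching m = {{fst (es ! j), snd (es ! j)} | j. j < length es}"
    unfolding output_matching_def assms(1) nat_int using m by (intro Collect_cong) (metis m)
  also have "\<dots> = {{u, v} | u v. (u, v) \<in> set es}"
  proof (intro set_eqI iffI)
    fix e assume "e \<in> {{fst (es ! j), snd (es ! j)} | j. j < length es}"
    then obtain j where "e = {fst (es ! j), snd (es ! j)}" "j < length es" by blast
    moreover from this have "(fst (es ! j), snd (es ! j)) \<in> set es" by simp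
    ultimately show "e \<in> {{u, v} | u v. (u, v) \<in> set es}" by blast
  next
    fix e assume "e \<in> {{u, v} | u v. (u, v) \<in> set es}"
    then obtain u v where "e = {u, v}" "(u, v) \<in> set es" by blast
    moreover from this obtain j where "j < length es" "es ! j = (u, v)" by (auto simp: in_set_conv_nth)
    ultimately show "e \<in> {{fst (es ! j), snd (es ! j)} | j. j < length es}"
      by (intro CollectI exI[of _ j]) simp
  qed
  finally show ?thesis .
qed

lemma machine_correct:
  assumes n: "1 \<le> n"
  shows "\<exists>t. t \<le> 3000 * (card (perm_edges n p) + n + 1) \<and>
    halted machine_code (steps machine_code t (0, input_mem p)) \<and>
    maximum_induced_matching (perm_edges n p)
      (output_matching (snd (steps machine_code t (0, input_mem p))))"
proof -
  let ?m0 = "input_mem p"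
  let ?P = machine_code
  let ?j = "Jz 0 (1 + length body_code)"
  let ?C = "compile (1 + length prologue) program"
  have m0: "?m0 0 = int n" using perm by (simp add: input_mem_def is_perm_def)
  have z0: "?m0 i = 0" if "n < i" for i using that perm by (simp add: input_mem_def is_perm_def)
  have "step ?P (length ([] :: instr list), ?m0) = exec ?j (length ([] :: instr list), ?m0)"
    by (rule step_at[of _ _ _ body_code]) (simp_all add: machine_code_def)
  then have st1: "steps ?P 1 (0, ?m0) = (length [?j], ?m0)"
    using m0 n unfolding steps_1 by simp
  define m1 where "m1 = fold ieff prologue ?m0"
  have m1: "m1 = ?m0(8 * n := ?m0 1, 8 * n + 1 := ?m0 2, 8 * n + 2 := ?m0 3,
    8 * n + 3 := int (8 * n), 0 := int (8 * n), 1 := int (8 * n + 3))"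
    unfolding m1_def by (rule fold_prologue[where m = ?m0, OF m0 n])
  have st2: "steps ?P (length prologue) (length [?j], ?m0) = (length (?j # prologue), m1)"
    using steps_straight[of ?P "[?j]" prologue "?C @ epilogue" ?m0]
    unfolding m1_def by (simp add: machine_code_def body_code_def) (simp add: prologue_def)
  \<comment> \<open>The abstract state is read off the memory left by the prologue, so that
    \<open>sim\<close> holds almost by definition.\<close>
  define v where "v = (\<lambda>x. m1 (8 * n + x))"
  define a where "a = (\<lambda>f i. m1 (8 * n + 32 + 32 * i + f))"
  have sm: "sim (8 * n) m1 (v, a, m1, 0)"
    using n by (simp add: v_def a_def m1)
  have "wp (8 * n) program (\<lambda>(v', a', r', t'). \<exists>es. descending n n es \<and> length es = F n n \<and>
    v' vBASE = int (length es) \<and>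
    listed (r'(1 := v' 0, 2 := v' 1, 3 := v' 2)) es \<and>
    t' \<le> 30 + 50 * n + 60 * card (perm_edges n p)) (v, a, m1, 0)"
  proof (rule wp_program[OF n])
    show "v 0 = ?m0 1" "v 1 = ?m0 2" "v 2 = ?m0 3" "v vBASE = int (8 * n)"
      using n by (auto simp: v_def m1)
    show "v x = 0" if "4 \<le> x" for x using n z0[of "8 * n + x"] that by (auto simp: v_def m1)
    show "a f i = 0" for f i using n z0[of "8 * n + 32 + 32 * i + f"] by (auto simp: a_def m1)
    show "m1 i = ?m0 i" if "4 \<le> i" "i < 8 * n" for i using that by (simp add: m1)
  qed
  then obtain s' where s': "big (8 * n) program (v, a, m1, 0) s'"
    "case s' of (v', a', r', t') \<Rightarrow> \<exists>es. descending n n es \<and> length es = F n n \<and>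
    v' vBASE = int (length es) \<and>
    listed (r'(1 := v' 0, 2 := v' 1, 3 := v' 2)) es \<and>
    t' \<le> 30 + 50 * n + 60 * card (perm_edges n p)" unfolding wp_def by blast
  obtain v' a' r' t' where s'e: "s' = (v', a', r', t')" by (cases s')
  obtain es where es: "descending n n es" "length es = F n n" "v' vBASE = int (length es)"
    "listed (r'(1 := v' 0, 2 := v' 1, 3 := v' 2)) es"
    "t' \<le> 30 + 50 * n + 60 * card (perm_edges n p)" using s'(2) unfolding s'e by auto
  have Pe: "?P = (?j # prologue) @ compile (length (?j # prologue)) program @ epilogue"
    by (simp add: machine_code_def body_code_def)
  obtain t3 m2 where t3: "t3 \<le> 40 * t'" "sim (8 * n) m2 (v', a', r', t')"
    "steps ?P t3 (length (?j # prologue), m1)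
      = (length (?j # prologue) + length (compile (length (?j # prologue)) program), m2)"
    using compile_correct[OF s'(1) wf_program sm Pe] unfolding s'e by auto
  let ?pre = "(?j # prologue) @ compile (length (?j # prologue)) program"
  have b: "m2 0 = int (8 * n)" "4 \<le> 8 * n" using t3(2) by simp_all
  have x: "m2 (8 * n + x) = v' x" if "x < 32" for x using t3(2) that by simp
  define m3 where "m3 = fold ieff epilogue m2"
  have m3: "m3 = m2(0 := v' 3, 1 := v' 0, 2 := v' 1, 3 := v' 2)"
    unfolding m3_def fold_epilogue[where m = m2, OF b] using x[of 0] x[of 1] x[of 2] x[of 3] by simp
  have st4: "steps ?P (length epilogue) (length ?pre, m2) = (length ?P, m3)"
    using steps_straight[of ?P ?pre epilogue "[]" m2] unfolding m3_def
    by (simp add: machine_code_def body_code_def) (simp add: epilogue_def)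
  let ?t = "1 + (length prologue + (t3 + length epilogue))"
  have run: "steps ?P ?t (0, ?m0) = (length ?P, m3)"
    unfolding steps_add[of _ 1] st1 steps_add[of _ "length prologue"] st2 steps_add[of _ t3] t3(3)
    using st4 by simp
  have "listed m3 es"
    unfolding listed_def
  proof (intro allI impI)
    fix j assume j: "j < length es"
    have "length es \<le> n" by (rule descending_length[OF es(1)])
    then have r: "m3 i = (r'(1 := v' 0, 2 := v' 1, 3 := v' 2)) i" if "1 \<le> i" "i \<le> 2 * length es" for i
    proof -
      have "i = 1 \<or> i = 2 \<or> i = 3 \<or> 4 \<le> i" using that(1) by linarith
      then consider "i = 1" | "i = 2" | "i = 3" | "4 \<le> i" by blast
      then show ?thesis
      proof cases
        case 4
        then have "i < 8 * n" using that \<open>length es \<le> n\<close> n by linarith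
        then show ?thesis using 4 t3(2) by (simp add: m3)
      qed (simp_all add: m3)
    qed
    show "m3 (2 * j + 1) = int (fst (es ! j)) \<and> m3 (2 * j + 2) = int (snd (es ! j))"
      using es(4) j r[of "2 * j + 1"] r[of "2 * j + 2"] unfolding listed_def by simp
  qed
  moreover have "m3 0 = int (length es)" using es(3) by (simp add: m3)
  ultimately have "output_matching m3 = {{u, v} | u v. (u, v) \<in> set es}" by (intro output_listed)
  then have "maximum_induced_matching (perm_edges n p) (output_matching m3)"
    using descending_maximum[OF es(1,2)] by simp
  moreover have "halted ?P (length ?P, m3)" by (simp add: halted_def)
  \<comment> \<open>At 40 instructions per tick the program takes at most 1200 + 2000 n + 2400 m
    steps, with m the number of edges; the 27 instructions around it fit into the slack.\<close>
  moreover have "?t \<le> 3000 * (card (perm_edges n p) + n + 1)"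
    using t3(1) es(5) by (simp add: prologue_def epilogue_def)
  ultimately show ?thesis using run by (intro exI[of _ ?t]) simp
qed

end

theorem theorem2:
  shows "\<exists>(P :: instr list) (c :: nat). \<forall>n p. is_perm n p \<longrightarrow>
           (\<exists>t. t \<le> c * (card (perm_edges n p) + n + 1) \<and>
                halted P (steps P t (0, input_mem p)) \<and>
                maximum_induced_matching (perm_edges n p)
                  (output_matching (snd (steps P t (0, input_mem p)))))"
proof (rule exI[of _ machine_code], rule exI[of _ 3000], intro allI impI)
  fix n p assume p: "is_perm n p"
  interpret permutation n p by unfold_locales (rule p)
  show "\<exists>t. t \<le> 3000 * (card (perm_edges n p) + n + 1) \<and>
                halted machine_code (steps machine_code t (0, input_mem p)) \<and>
                maximum_induced_matching (perm_edges n p)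
                  (output_matching (snd (steps machine_code t (0, input_mem p))))"
  proof (cases "n = 0")
    case True
    then have "p = []" using p by (simp add: is_perm_def)
    have m0: "input_mem p 0 = 0" using \<open>p = []\<close> by (simp add: input_mem_def)
    have "step machine_code (length ([] :: instr list), input_mem p)
      = exec (Jz 0 (1 + length body_code)) (length ([] :: instr list), input_mem p)"
      by (rule step_at[of _ _ _ body_code]) (simp_all add: machine_code_def)
    then have st: "steps machine_code 1 (0, input_mem p) = (length machine_code, input_mem p)"
      unfolding steps_1 using m0 by (simp add: machine_code_def)
    have "perm_edges n p = {}" using True by (auto simp: perm_edges_def)
    then have "maximum_induced_matching (perm_edges n p) (output_matching (input_mem p))"
      using m0 by (auto simp: maximum_induced_matching_def induced_matching_def output_matching_def)
    then show ?thesis using st by (intro exI[of _ 1]) (simp add: halted_def)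
  next
    case False
    then show ?thesis using machine_correct by simp
  qed
qed

end
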